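(* Let $B$ be an affine (finitely generated) commutative domain over $\mathsf{k}$ (not necessarily regular) with $n=\operatorname{trdeg}_{\mathsf{k}} B$. Then the ring of differential operators $D(B)$ is $LD$-stable and $LD\, D(B)=2n$.
   Context: $\mathsf{k}$ is a field of characteristic zero; all algebras are $\mathsf{k}$-algebras. For a commutative $\mathsf{k}$-algebra $A$, set $D(A)_0=A$ (acting by multiplication), $D(A)_m=\{d\in \operatorname{End}_{\mathsf{k}}A : [d,a]\in D(A)_{m-1}\ \forall a\in A\}$, and $D(A)=\bigcup_m D(A)_m$. A subframe of an algebra $A$ is a finite-dimensional subspace containing $1$. Gelfand–Kirillov dimension: $GK\,A=\sup_V\limsup_{m\to\infty}\log(\dim V^m)/\log m$ over subframes $V$. Lower transcendence degree: if for every subframe $V$ there is a finite-dimensional nonzero subspace $W\subset A$ with $\dim VW=\dim W$, then $LD\,A=0$. Otherwise, for real $d>0$, a subframe $V$ satisfies $VDI(A)_d$ if there is $c>0$ with $\dim VW\ge \dim W+c(\dim W)^{(d-1)/d}$ for all finite-dimensional nonzero $W$, and $LD\,A=\sup_V\sup\{d: VDI(A)_d \text{ holds for } V\}$. An algebra $A$ is $LD$-stable if $LD\,A=GK\,A$. *)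

theory Defs
  imports Complex_Main "HOL-Library.Function_Algebras" "HOL-Library.Liminf_Limsup"
          "HOL-Library.Extended_Real"
begin

section \<open>Generic k-algebras: an additive group 'a with a k-scalar action,
  a multiplication and a unit, and a carrier set A (a subalgebra)\<close>

definition fd_subspace :: "('k::field \<Rightarrow> 'a::ab_group_add \<Rightarrow> 'a) \<Rightarrow> 'a set \<Rightarrow> 'a set \<Rightarrow> bool" where
  "fd_subspace sc A S \<longleftrightarrow> module.subspace sc S \<and> S \<subseteq> A \<and>
     (\<exists>F. finite F \<and> F \<subseteq> S \<and> module.span sc F = S)"

definition subframe :: "('k::field \<Rightarrow> 'a::ab_group_add \<Rightarrow> 'a) \<Rightarrow> 'a \<Rightarrow> 'a set \<Rightarrow> 'a set \<Rightarrow> bool" where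
  "subframe sc one A V \<longleftrightarrow> fd_subspace sc A V \<and> one \<in> V"

definition prodsp :: "('k::field \<Rightarrow> 'a::ab_group_add \<Rightarrow> 'a) \<Rightarrow> ('a \<Rightarrow> 'a \<Rightarrow> 'a) \<Rightarrow> 'a set \<Rightarrow> 'a set \<Rightarrow> 'a set" where
  "prodsp sc mult V W = module.span sc {mult v w | v w. v \<in> V \<and> w \<in> W}"

fun powsp :: "('k::field \<Rightarrow> 'a::ab_group_add \<Rightarrow> 'a) \<Rightarrow> ('a \<Rightarrow> 'a \<Rightarrow> 'a) \<Rightarrow> 'a \<Rightarrow> 'a set \<Rightarrow> nat \<Rightarrow> 'a set" where
  "powsp sc mult one V 0 = module.span sc {one}"
| "powsp sc mult one V (Suc m) = prodsp sc mult (powsp sc mult one V m) V"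

definition GKdim :: "('k::field \<Rightarrow> 'a::ab_group_add \<Rightarrow> 'a) \<Rightarrow> ('a \<Rightarrow> 'a \<Rightarrow> 'a) \<Rightarrow> 'a \<Rightarrow> 'a set \<Rightarrow> ereal" where
  "GKdim sc mult one A = (SUP V \<in> {V. subframe sc one A V}.
      limsup (\<lambda>m::nat. ereal (ln (real (vector_space.dim sc (powsp sc mult one V m))) / ln (real m))))"

definition VDI :: "('k::field \<Rightarrow> 'a::ab_group_add \<Rightarrow> 'a) \<Rightarrow> ('a \<Rightarrow> 'a \<Rightarrow> 'a) \<Rightarrow> 'a set \<Rightarrow> 'a set \<Rightarrow> real \<Rightarrow> bool" where
  "VDI sc mult A V d \<longleftrightarrow> (\<exists>c>0. \<forall>W. fd_subspace sc A W \<and> W \<noteq> {0} \<longrightarrow>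
      real (vector_space.dim sc (prodsp sc mult V W)) \<ge>
        real (vector_space.dim sc W) + c * real (vector_space.dim sc W) powr ((d - 1) / d))"

definition LDdim :: "('k::field \<Rightarrow> 'a::ab_group_add \<Rightarrow> 'a) \<Rightarrow> ('a \<Rightarrow> 'a \<Rightarrow> 'a) \<Rightarrow> 'a \<Rightarrow> 'a set \<Rightarrow> ereal" where
  "LDdim sc mult one A =
     (if \<forall>V. subframe sc one A V \<longrightarrow>
            (\<exists>W. fd_subspace sc A W \<and> W \<noteq> {0} \<and>
                 vector_space.dim sc (prodsp sc mult V W) = vector_space.dim sc W)
      then 0
      else (SUP V \<in> {V. subframe sc one A V}. SUP d \<in> {d::real. d > 0 \<and> VDI sc mult A V d}. ereal d))"

definition LD_stable :: "('k::field \<Rightarrow> 'a::ab_group_add \<Rightarrow> 'a) \<Rightarrow> ('a \<Rightarrow> 'a \<Rightarrow> 'a) \<Rightarrow> 'a \<Rightarrow> 'a set \<Rightarrow> bool" where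
  "LD_stable sc mult one A \<longleftrightarrow> LDdim sc mult one A = GKdim sc mult one A"

definition alg_hom_struct :: "('k::field \<Rightarrow> 'b::comm_ring_1) \<Rightarrow> bool" where
  "alg_hom_struct \<phi> \<longleftrightarrow> \<phi> 1 = 1 \<and> (\<forall>x y. \<phi> (x + y) = \<phi> x + \<phi> y) \<and> (\<forall>x y. \<phi> (x * y) = \<phi> x * \<phi> y)"

inductive_set gen_subalg :: "('k::field \<Rightarrow> 'b::comm_ring_1) \<Rightarrow> 'b set \<Rightarrow> 'b set"
  for \<phi> S where
  scal: "\<phi> c \<in> gen_subalg \<phi> S"
| gen: "s \<in> S \<Longrightarrow> s \<in> gen_subalg \<phi> S"
| add: "x \<in> gen_subalg \<phi> S \<Longrightarrow> y \<in> gen_subalg \<phi> S \<Longrightarrow> x + y \<in> gen_subalg \<phi> S"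
| mult: "x \<in> gen_subalg \<phi> S \<Longrightarrow> y \<in> gen_subalg \<phi> S \<Longrightarrow> x * y \<in> gen_subalg \<phi> S"

definition affine_alg :: "('k::field \<Rightarrow> 'b::comm_ring_1) \<Rightarrow> bool" where
  "affine_alg \<phi> \<longleftrightarrow> (\<exists>S. finite S \<and> gen_subalg \<phi> S = UNIV)"

text \<open>Algebraic independence over k of x_0,...,x_{n-1}: the monomials in them
  (indexed by exponent vectors e with e i = 0 for i \<ge> n) are k-linearly independent,
  i.e. no nonzero polynomial with coefficients in k vanishes at them.\<close>
definition alg_indep :: "('k::field \<Rightarrow> 'b::comm_ring_1) \<Rightarrow> 'b list \<Rightarrow> bool" where
  "alg_indep \<phi> xs \<longleftrightarrow>
     (\<forall>E c. finite E \<and> E \<subseteq> {e::nat \<Rightarrow> nat. \<forall>i\<ge>length xs. e i = 0} \<and>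
        (\<Sum>e\<in>E. \<phi> (c e) * (\<Prod>i<length xs. (xs ! i) ^ e i)) = 0
        \<longrightarrow> (\<forall>e\<in>E. c e = 0))"

definition trdeg_is :: "('k::field \<Rightarrow> 'b::comm_ring_1) \<Rightarrow> nat \<Rightarrow> bool" where
  "trdeg_is \<phi> n \<longleftrightarrow> (\<exists>xs. length xs = n \<and> alg_indep \<phi> xs) \<and>
     (\<forall>xs. alg_indep \<phi> xs \<longrightarrow> length xs \<le> n)"

definition klinear :: "('k::field \<Rightarrow> 'b::comm_ring_1) \<Rightarrow> ('b \<Rightarrow> 'b) \<Rightarrow> bool" where
  "klinear \<phi> d \<longleftrightarrow> (\<forall>x y. d (x + y) = d x + d y) \<and> (\<forall>c x. d (\<phi> c * x) = \<phi> c * d x)"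

fun diffops :: "('k::field \<Rightarrow> 'b::comm_ring_1) \<Rightarrow> nat \<Rightarrow> ('b \<Rightarrow> 'b) set" where
  "diffops \<phi> 0 = {(\<lambda>x. a * x) | a. True}"
| "diffops \<phi> (Suc m) = {d. klinear \<phi> d \<and> (\<forall>a. (\<lambda>x. d (a * x) - a * d x) \<in> diffops \<phi> m)}"

definition DiffOps :: "('k::field \<Rightarrow> 'b::comm_ring_1) \<Rightarrow> ('b \<Rightarrow> 'b) set" where
  "DiffOps \<phi> = (\<Union>m. diffops \<phi> m)"

text \<open>k-scalar action on End_k(B): (c f)(x) = phi(c) f(x); product is composition, unit is id.\<close>
definition end_scale :: "('k::field \<Rightarrow> 'b::comm_ring_1) \<Rightarrow> 'k \<Rightarrow> ('b \<Rightarrow> 'b) \<Rightarrow> ('b \<Rightarrow> 'b)" where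
  "end_scale \<phi> c f = (\<lambda>x. \<phi> c * f x)"

end

theory Submission
  imports Defs "HOL-Computational_Algebra.Polynomial" "HOL-Analysis.Convex"
begin

text \<open>
  Let \<open>P = k[x\<^sub>1, \<dots>, x\<^sub>n] \<subseteq> B\<close> for a transcendence basis. A differential operator \<open>d\<close> on \<open>B\<close>
  is determined by its symbols \<open>\<sigma>\<^sub>\<beta>(d)\<close>, the iterated commutators of \<open>d\<close> with the \<open>x\<^sub>i\<close> evaluated
  at \<open>1\<close>; this works on \<open>B\<close> itself and avoids its fraction field.

  Lower bound: some derivations \<open>\<delta>\<^sub>i\<close> of \<open>B\<close> satisfy \<open>\<delta>\<^sub>i(x\<^sub>j) = 0\<close> for \<open>i \<noteq> j\<close> and
  \<open>0 \<noteq> \<delta>\<^sub>i(x\<^sub>i) \<in> P\<close>. The lexicographically largest \<open>\<beta>\<close> with \<open>\<sigma>\<^sub>\<beta>(d) \<noteq> 0\<close>, together with a leading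
  term of \<open>\<sigma>\<^sub>\<beta>(d)\<close> as element of a torsion-free \<open>P\<close>-module, defines a leading term of \<open>d\<close> with
  one-dimensional leaves, and (after a shear) left multiplication by \<open>x\<^sub>i\<close> and \<open>\<delta>\<^sub>i\<close> translates it by
  \<open>2 n\<close> different unit vectors. Since \<open>dim W\<close> is the number of leading terms of \<open>W\<close>, the
  Loomis-Whitney inequality gives \<open>VDI\<close> with \<open>d = 2 n\<close> and \<open>c = 1\<close> for the span of \<open>1, x\<^sub>i, \<delta>\<^sub>i\<close>.

  Upper bound: operators in \<open>V\<^sup>N\<close> have order \<open>O(N)\<close> and raise the degree in the generators of \<open>B\<close> by
  \<open>O(N)\<close>, so there are \<open>O(N\<^sup>n)\<close> possible \<open>\<beta>\<close>, and the symbols lie in a space of dimension \<open>O(N\<^sup>n)\<close>.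
  Finally \<open>VDI\<close> for \<open>d \<ge> 1\<close>, applied to \<open>W = V\<^sup>m\<close>, forces \<open>dim V\<^sup>m\<close> to grow at least like \<open>m\<^sup>d\<close>.
\<close>

section \<open>The discrete isoperimetric inequality\<close>

text \<open>The obstacle: for singular \<open>B\<close> no generators of \<open>D(B)\<close> are at
  hand, so the argument uses only left multiplication by a few explicit operators. That is enough,
  because the inequality concerns the products \<open>V W\<close> alone. A partial derivative of
  \<open>P\<close> extends to \<open>B\<close> only after clearing a denominator at each algebraic
  generator, hence \<open>\<delta>\<^sub>i(x\<^sub>i)\<close> is some \<open>f\<^sub>i\<close> and
  not \<open>1\<close>. A last factor moves \<open>f\<^sub>i\<close> into \<open>P\<close>, since
  only multiplication by elements of \<open>P\<close> translates leading terms in \<open>B\<close>.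
  So \<open>\<delta>\<^sub>i\<close> raises \<open>\<beta>\<^sub>i\<close> by one and also shifts
  the other exponents by the leading exponent of \<open>f\<^sub>i\<close>; the shear removes exactly
  this drift. Leading terms in \<open>B\<close>: filter \<open>B\<close> by saturated
  \<open>P\<close>-submodules whose successive quotients are torsion-free of rank at most one. In
  its quotient an element is a fraction of polynomials times a generator, which yields a position
  and an integer vector. The position is one more coordinate of the lattice points, and no operator
  has to move it.\<close>

lemma powr_inverse_power:
  assumes "x > 0" "d > 0" shows "(x powr (1 / real d)) ^ d = x"
proof -
  have "(x powr (1 / real d)) ^ d = (x powr (1 / real d)) powr real d"
    by (rule powr_realpow[symmetric]) (use assms in simp)
  also have "\<dots> = x" using assms by (simp add: powr_powr)
  finally show ?thesis .
qed

lemma power_powr_inverse: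
  assumes "x > 0" "d > 0" shows "(x ^ d) powr (1 / real d) = x"
proof -
  have "x ^ d = x powr real d" by (rule powr_realpow[symmetric]) (use assms in simp)
  then show ?thesis using assms by (simp add: powr_powr)
qed

text \<open>Induction on the directions: slice \<open>S\<close> by the coordinate \<open>t\<close>,
  apply the induction hypothesis to each slice and add up. Instead of Hoelder's inequality the
  arithmetic-geometric mean inequality is used, because for each \<open>i\<close> the weights
  \<open>a i \<tau> / A i\<close> sum to 1 over \<open>\<tau>\<close>. \<open>D\<close> is a subset
  of the coordinates because the lattice points used later have a coordinate along which no step is
  available.\<close>

lemma loomis_whitney:
  fixes S :: "('i \<Rightarrow> int) set"
  assumes "finite D" "D \<noteq> {}" "finite S" "S \<noteq> {}"
  shows "card S ^ (card D - 1) \<le> (\<Prod>i\<in>D. card ((\<lambda>s. s(i := 0)) ` S))"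
  using assms
proof (induction D arbitrary: S rule: finite_ne_induct)
  case (singleton i)
  then show ?case by (simp add: Suc_leI card_gt_0_iff)
next
  case (insert t D)
  define d where "d = card D"
  have d: "d > 0" using insert.hyps by (simp add: d_def card_gt_0_iff)
  define T where "T = (\<lambda>s. s t) ` S"
  define Q where "Q \<tau> = {s\<in>S. s t = \<tau>}" for \<tau>
  define a where "a i \<tau> = card ((\<lambda>s. s(i := 0)) ` Q \<tau>)" for i \<tau>
  define A where "A i = card ((\<lambda>s. s(i := 0)) ` S)" for i
  have finT: "finite T" and finQ: "finite (Q \<tau>)" for \<tau>
    using insert.prems by (auto simp: T_def Q_def)
  have S_eq: "S = (\<Union>\<tau>\<in>T. Q \<tau>)" by (auto simp: T_def Q_def)
  have cardS: "card S = (\<Sum>\<tau>\<in>T. card (Q \<tau>))"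
    unfolding S_eq by (rule card_UN_disjoint) (use finT finQ in \<open>auto simp: Q_def\<close>)
  \<comment> \<open>Projection along \<open>i\<close> keeps the coordinate \<open>t\<close>, so the
    projected slices remain disjoint.\<close>
  have A_eq: "A i = (\<Sum>\<tau>\<in>T. a i \<tau>)" if "i \<in> D" for i
  proof -
    have it: "i \<noteq> t" using that insert.hyps by auto
    have "(\<lambda>s. s(i := 0)) ` S = (\<Union>\<tau>\<in>T. (\<lambda>s. s(i := 0)) ` Q \<tau>)"
      by (subst S_eq) auto
    moreover have "card (\<Union>\<tau>\<in>T. (\<lambda>s. s(i := 0)) ` Q \<tau>) = (\<Sum>\<tau>\<in>T. a i \<tau>)"
      unfolding a_def
    proof (rule card_UN_disjoint)
      show "\<forall>\<tau>\<in>T. \<forall>\<tau>'\<in>T. \<tau> \<noteq> \<tau>' \<longrightarrow> (\<lambda>s. s(i := 0)) ` Q \<tau> \<inter> (\<lambda>s. s(i := 0)) ` Q \<tau>' = {}"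
      proof (intro ballI impI, rule ccontr)
        fix \<tau> \<tau>' assume ne: "\<tau> \<noteq> \<tau>'"
          and "(\<lambda>s. s(i := 0)) ` Q \<tau> \<inter> (\<lambda>s. s(i := 0)) ` Q \<tau>' \<noteq> {}"
        then obtain s s' where "s \<in> Q \<tau>" "s' \<in> Q \<tau>'" "s(i := 0) = s'(i := 0)" by blast
        then have "s t = \<tau>" "s' t = \<tau>'" "(s(i := 0)) t = (s'(i := 0)) t" by (auto simp: Q_def)
        then show False using ne it by simp
      qed
    qed (use finT finQ in auto)
    ultimately show ?thesis by (simp add: A_def)
  qed
  have A_pos: "A i > 0" for i using insert.prems by (auto simp: A_def card_gt_0_iff)
  define P where "P = real (A t) * (\<Prod>i\<in>D. real (A i))"
  have Ppos: "P > 0" unfolding P_def using A_pos by (simp add: prod_pos)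
  have prodA: "(\<Prod>i\<in>D. real (A i)) \<noteq> 0"
    using A_pos insert.hyps by (simp add: prod_zero_iff)
  have slice: "real (card (Q \<tau>)) \<le> P powr (1 / d) * (\<Sum>i\<in>D. (real (a i \<tau>) / real (A i)) / d)"
    if "\<tau> \<in> T" for \<tau>
  proof -
    have ne: "Q \<tau> \<noteq> {}" using that by (auto simp: T_def Q_def)
    have "inj_on (\<lambda>s. s(t := 0)) (Q \<tau>)"
    proof (rule inj_onI)
      fix s s' assume *: "s \<in> Q \<tau>" "s' \<in> Q \<tau>" "s(t := 0) = s'(t := 0)"
      show "s = s'"
      proof
        fix j show "s j = s' j"
        proof (cases "j = t")
          case True
          then show ?thesis using * by (simp add: Q_def)
        next
          case False
          then show ?thesis using fun_cong[OF *(3), of j] by simp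
        qed
      qed
    qed
    then have "card (Q \<tau>) = card ((\<lambda>s. s(t := 0)) ` Q \<tau>)" by (simp add: card_image)
    also have "\<dots> \<le> A t" unfolding A_def
      by (rule card_mono) (use insert.prems in \<open>auto simp: Q_def\<close>)
    finally have le: "card (Q \<tau>) \<le> A t" .
    \<comment> \<open>One factor is bounded by the projection along \<open>t\<close>, which is
      injective on a slice; the remaining power goes to the induction hypothesis.\<close>
    have "card (Q \<tau>) ^ d = card (Q \<tau>) * card (Q \<tau>) ^ (d - 1)"
      using d by (cases d) auto
    also have "\<dots> \<le> A t * (\<Prod>i\<in>D. a i \<tau>)"
      unfolding a_def d_def by (intro mult_le_mono le insert.IH finQ ne)
    finally have "real (card (Q \<tau>) ^ d) \<le> real (A t * (\<Prod>i\<in>D. a i \<tau>))" by (rule of_nat_mono)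
    also have "\<dots> = P * (\<Prod>i\<in>D. real (a i \<tau>) / real (A i))"
      using prodA by (simp add: P_def prod_dividef)
    finally have le2: "real (card (Q \<tau>)) ^ d \<le> P * (\<Prod>i\<in>D. real (a i \<tau>) / real (A i))" by simp
    have "real (card (Q \<tau>)) = (real (card (Q \<tau>)) ^ d) powr (1 / d)"
      by (rule power_powr_inverse[symmetric]) (use d ne finQ in \<open>auto simp: card_gt_0_iff\<close>)
    also have "\<dots> \<le> (P * (\<Prod>i\<in>D. real (a i \<tau>) / real (A i))) powr (1 / d)"
      by (rule powr_mono2) (use le2 in auto)
    also have "\<dots> = P powr (1 / d) * (\<Prod>i\<in>D. real (a i \<tau>) / real (A i)) powr (1 / d)"
      by (rule powr_mult)
    also have "(\<Prod>i\<in>D. real (a i \<tau>) / real (A i)) powr (1 / d)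
        \<le> (\<Sum>i\<in>D. (real (a i \<tau>) / real (A i)) / d)"
      unfolding d_def by (rule arith_geom_mean) (use insert.hyps in auto)
    finally show ?thesis using Ppos by simp
  qed
  have "real (card S) \<le> (\<Sum>\<tau>\<in>T. P powr (1 / d) * (\<Sum>i\<in>D. (real (a i \<tau>) / real (A i)) / d))"
    unfolding cardS of_nat_sum by (rule sum_mono) (rule slice)
  also have "\<dots> = P powr (1 / d) * (\<Sum>i\<in>D. \<Sum>\<tau>\<in>T. (real (a i \<tau>) / real (A i)) / d)"
    by (subst sum.swap) (simp add: sum_distrib_left)
  also have "(\<Sum>i\<in>D. \<Sum>\<tau>\<in>T. (real (a i \<tau>) / real (A i)) / d) = (\<Sum>i\<in>D. 1 / d)"
  proof (rule sum.cong)
    fix i assume i: "i \<in> D"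
    have "(\<Sum>\<tau>\<in>T. (real (a i \<tau>) / real (A i)) / d) = real (A i) / real (A i) / d"
      by (simp add: A_eq[OF i] flip: sum_divide_distrib)
    then show "(\<Sum>\<tau>\<in>T. (real (a i \<tau>) / real (A i)) / d) = 1 / d" using A_pos[of i] by simp
  qed simp
  also have "(\<Sum>i\<in>D. 1 / real d) = 1" using d by (simp add: d_def)
  finally have "real (card S) \<le> P powr (1 / d)" by simp
  then have "real (card S) ^ d \<le> (P powr (1 / d)) ^ d" by (rule power_mono) simp
  also have "\<dots> = P" by (rule powr_inverse_power) (use d Ppos in auto)
  also have "P = real (\<Prod>i\<in>insert t D. A i)" using insert.hyps by (simp add: P_def)
  finally have "card S ^ d \<le> (\<Prod>i\<in>insert t D. A i)"
    by (simp only: of_nat_power[symmetric] of_nat_le_iff)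
  moreover have "card (insert t D) - 1 = d" using insert.hyps by (simp add: d_def)
  ultimately show ?case by (simp only: A_def)
qed

text \<open>If every projection were smaller, the product of all of them would fall below
  \<open>card S ^ (card D - 1)\<close>, against \<open>loomis_whitney\<close>.\<close>

lemma large_projection:
  fixes S :: "('i \<Rightarrow> int) set"
  assumes "finite D" "D \<noteq> {}" "finite S" "S \<noteq> {}"
  shows "\<exists>i\<in>D. real (card S) powr ((real (card D) - 1) / real (card D))
    \<le> real (card ((\<lambda>s. s(i := 0)) ` S))"
proof (rule ccontr)
  define d where "d = card D"
  define c where "c = real (card S) powr ((real d - 1) / real d)"
  have d: "d > 0" using assms by (simp add: d_def card_gt_0_iff)
  have S: "real (card S) > 0" using assms by (simp add: card_gt_0_iff)
  assume "\<not> ?thesis"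
  then have lt: "real (card ((\<lambda>s. s(i := 0)) ` S)) < c" if "i \<in> D" for i
    using that by (force simp: c_def d_def)
  have "(\<Prod>i\<in>D. real (card ((\<lambda>s. s(i := 0)) ` S))) < (\<Prod>i\<in>D. c)"
  proof -
    obtain j where "j \<in> D" using assms by blast
    moreover have "c > 0" using S by (simp add: c_def)
    ultimately show ?thesis
      by (intro prod_mono_strict[of j]) (use assms lt in \<open>auto intro: less_imp_le\<close>)
  qed
  also have "\<dots> = real (card S) powr (real d - 1)"
  proof -
    have "c ^ d = c powr real d" by (rule powr_realpow[symmetric]) (use S in \<open>simp add: c_def\<close>)
    then show ?thesis using d by (simp add: c_def powr_powr flip: d_def)
  qed
  also have "\<dots> = real (card S ^ (d - 1))"
    using d powr_realpow[OF S, of "d - 1"] by (simp add: of_nat_diff Suc_leI)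
  also have "\<dots> \<le> real (\<Prod>i\<in>D. card ((\<lambda>s. s(i := 0)) ` S))"
    unfolding of_nat_le_iff d_def by (rule loomis_whitney[OF assms])
  finally show False by simp
qed

text \<open>Every line in direction \<open>i\<close> that meets \<open>S\<close> has a last point in
  \<open>S\<close>; its successor lies in \<open>T\<close> but not in \<open>S\<close>, and
  different lines give different successors. The projection counts these lines.\<close>

lemma card_shift_union:
  fixes S T :: "('i \<Rightarrow> int) set"
  assumes "finite T" "S \<subseteq> T" "\<And>s. s \<in> S \<Longrightarrow> s(i := s i + 1) \<in> T"
  shows "card S + card ((\<lambda>s. s(i := 0)) ` S) \<le> card T"
proof -
  have finS: "finite S" using assms finite_subset by blast
  define Z where "Z p = {s i | s. s \<in> S \<and> s(i := 0) = p}" for p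
  define top where "top p = p(i := Max (Z p) + 1)" for p
  have finZ: "finite (Z p)" for p using finS by (simp add: Z_def)
  have top: "top p \<in> T - S" if p: "p \<in> (\<lambda>s. s(i := 0)) ` S" for p
  proof -
    have "Z p \<noteq> {}" using p by (auto simp: Z_def)
    then have "Max (Z p) \<in> Z p" using finZ by auto
    then obtain s where s: "s \<in> S" "s(i := 0) = p" "s i = Max (Z p)" by (auto simp: Z_def)
    then have eq: "top p = s(i := s i + 1)" by (auto simp: top_def)
    have "top p \<notin> S"
    proof
      assume "top p \<in> S"
      then have "(top p) i \<in> Z p" unfolding Z_def
        by (intro CollectI exI[of _ "top p"]) (auto simp: top_def s(2)[symmetric])
      then have "(top p) i \<le> Max (Z p)" using finZ by auto
      then show False by (simp add: top_def)
    qed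
    moreover have "top p \<in> T" using assms(3)[OF s(1)] by (simp only: eq)
    ultimately show ?thesis by simp
  qed
  have "inj_on top ((\<lambda>s. s(i := 0)) ` S)"
  proof (rule inj_onI)
    fix p q assume "p \<in> (\<lambda>s. s(i := 0)) ` S" "q \<in> (\<lambda>s. s(i := 0)) ` S" and eq: "top p = top q"
    then have pq: "p i = 0" "q i = 0" by auto
    show "p = q"
    proof
      fix j show "p j = q j"
        using fun_cong[OF eq, of j] pq by (cases "j = i") (auto simp: top_def)
    qed
  qed
  then have "card ((\<lambda>s. s(i := 0)) ` S) = card (top ` (\<lambda>s. s(i := 0)) ` S)"
    by (simp add: card_image)
  also have "\<dots> \<le> card (T - S)" by (rule card_mono) (use assms top in auto)
  also have "\<dots> = card T - card S" using assms finS by (simp add: card_Diff_subset)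
  finally show ?thesis using card_mono[OF assms(1,2)] by simp
qed

section \<open>Leading terms and dimensions\<close>

locale kspace = vector_space scale for scale :: "'k::field \<Rightarrow> 'v::ab_group_add \<Rightarrow> 'v"
begin

text \<open>Meant for arbitrary subsets. Since \<open>dim\<close> is 0 in the infinite-dimensional
  case, every comparison of dimensions carries this condition.\<close>

definition fin_dim :: "'v set \<Rightarrow> bool" where
  "fin_dim S \<longleftrightarrow> (\<exists>F. finite F \<and> S \<subseteq> span F)"

lemma independent_card_le:
  assumes "independent A" "A \<subseteq> S" "fin_dim S"
  shows "finite A" "card A \<le> dim S"
proof -
  obtain C where C: "C \<subseteq> S" "independent C" "S \<subseteq> span C" "card C = dim S"
    using basis_exists by blast
  obtain F where F: "finite F" "S \<subseteq> span F" using assms(3) by (auto simp: fin_dim_def)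
  have "finite C" using independent_span_bound[OF F(1) C(2)] C(1) F(2) by blast
  then have "finite A \<and> card A \<le> card C"
    using independent_span_bound[of C A] assms C by blast
  then show "finite A" "card A \<le> dim S" using C by auto
qed

lemma fin_dim_basis:
  assumes "fin_dim S"
  obtains C where "finite C" "independent C" "C \<subseteq> S" "S \<subseteq> span C" "card C = dim S"
  using basis_exists independent_card_le assms by metis

lemma dim_le:
  assumes "S \<subseteq> T" "fin_dim T" shows "dim S \<le> dim T"
proof -
  obtain C where "independent C" "C \<subseteq> S" "card C = dim S" using basis_exists by blast
  then show ?thesis using independent_card_le[of C T] assms by force
qed

end

lemma fd_subspace_iff:
  assumes "vector_space sc"
  shows "fd_subspace sc A S \<longleftrightarrow>
    module.subspace sc S \<and> S \<subseteq> A \<and> kspace.fin_dim sc S"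
proof -
  interpret vector_space sc by fact
  interpret kspace sc ..
  show ?thesis
  proof
    assume "fd_subspace sc A S"
    then show "subspace S \<and> S \<subseteq> A \<and> fin_dim S" unfolding fd_subspace_def fin_dim_def by blast
  next
    assume *: "subspace S \<and> S \<subseteq> A \<and> fin_dim S"
    then have "fin_dim S" by blast
    then obtain C where "finite C" "C \<subseteq> S" "S \<subseteq> span C" by (rule fin_dim_basis)
    then show "fd_subspace sc A S"
      unfolding fd_subspace_def using * span_subspace[of C S] by (auto intro!: exI[of _ C])
  qed
qed

text \<open>A valuation-like map with one-dimensional leaves; the latter is
  \<open>lead_cancel\<close>. The set \<open>M\<close> is there because operators live in the space
  of all functions, where leading terms are meaningful on a subspace only.\<close>

locale leading = kspace scale
  for scale :: "'k::field \<Rightarrow> 'v::ab_group_add \<Rightarrow> 'v" +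
  fixes M :: "'v set" and lt :: "'i \<Rightarrow> 'i \<Rightarrow> bool" and lead :: "'v \<Rightarrow> 'i"
  assumes M_subspace: "subspace M"
    and lt_irrefl: "\<not> lt s s"
    and lt_trans: "lt s t \<Longrightarrow> lt t u \<Longrightarrow> lt s u"
    and lt_total: "s \<noteq> t \<Longrightarrow> lt s t \<or> lt t s"
    and lead_scale: "v \<in> M \<Longrightarrow> v \<noteq> 0 \<Longrightarrow> c \<noteq> 0 \<Longrightarrow> lead (scale c v) = lead v"
    and lead_add: "v \<in> M \<Longrightarrow> w \<in> M \<Longrightarrow> v \<noteq> 0 \<Longrightarrow> w \<noteq> 0 \<Longrightarrow> lt (lead v) (lead w)
        \<Longrightarrow> v + w \<noteq> 0 \<and> lead (v + w) = lead w"
    and lead_cancel: "v \<in> M \<Longrightarrow> w \<in> M \<Longrightarrow> v \<noteq> 0 \<Longrightarrow> w \<noteq> 0 \<Longrightarrow> lead v = lead w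
        \<Longrightarrow> \<exists>c. v - scale c w = 0 \<or> lt (lead (v - scale c w)) (lead v)"
begin

text \<open>With distinct leading terms nothing can cancel the largest one.\<close>

lemma lead_sum:
  assumes "finite A" "A \<noteq> {}" "A \<subseteq> M - {0}" "inj_on lead A" "\<And>a. a \<in> A \<Longrightarrow> c a \<noteq> 0"
  shows "(\<Sum>a\<in>A. scale (c a) a) \<noteq> 0 \<and> (\<exists>a\<in>A. lead (\<Sum>a\<in>A. scale (c a) a) = lead a)"
  using assms
proof (induction A rule: finite_ne_induct)
  case (singleton a)
  then show ?case using lead_scale by auto
next
  case (insert a A)
  let ?u = "\<Sum>a\<in>A. scale (c a) a" and ?w = "scale (c a) a"
  have u: "?u \<noteq> 0" "\<exists>b\<in>A. lead ?u = lead b" using insert by auto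
  then obtain b where b: "b \<in> A" "lead ?u = lead b" by blast
  have M: "?u \<in> M" "?w \<in> M"
    using insert.prems by (auto intro!: subspace_sum subspace_scale M_subspace)
  have w: "?w \<noteq> 0" "lead ?w = lead a" using insert.prems lead_scale by auto
  have "lead a \<noteq> lead b" using insert b by (auto simp: inj_on_def)
  then have "lt (lead ?w) (lead ?u) \<or> lt (lead ?u) (lead ?w)" using lt_total w b by auto
  then have "?w + ?u \<noteq> 0 \<and> (lead (?w + ?u) = lead ?w \<or> lead (?w + ?u) = lead ?u)"
    using lead_add[OF M(2,1) w(1) u(1)] lead_add[OF M(1,2) u(1) w(1)]
    by (auto simp: add.commute)
  then show ?case using insert.hyps w b by auto
qed

lemma lead_independent:
  assumes "A \<subseteq> M - {0}" "inj_on lead A"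
  shows "independent A"
  unfolding independent_explicit_finite_subsets
proof (intro allI impI ballI, rule ccontr)
  fix S u v
  assume S: "S \<subseteq> A" "finite S" "(\<Sum>v\<in>S. scale (u v) v) = 0" "v \<in> S" "u v \<noteq> 0"
  have "(\<Sum>v\<in>{v\<in>S. u v \<noteq> 0}. scale (u v) v) \<noteq> 0"
  proof -
    let ?T = "{v\<in>S. u v \<noteq> 0}"
    have sub: "?T \<subseteq> A" using S(1) by auto
    then have inj: "inj_on lead ?T" by (rule inj_on_subset[OF assms(2)])
    have "finite ?T" "?T \<noteq> {}" "?T \<subseteq> M - {0}" using S(2,4,5) sub assms(1) by auto
    from lead_sum[OF this inj, of u, THEN conjunct1] show ?thesis by simp
  qed
  moreover have "(\<Sum>v\<in>{v\<in>S. u v \<noteq> 0}. scale (u v) v) = (\<Sum>v\<in>S. scale (u v) v)"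
    by (rule sum.mono_neutral_left) (use S in auto)
  ultimately show False using S by simp
qed

text \<open>One vector is picked for each leading term. These are independent, so there are only
  finitely many leading terms. This finiteness takes the place of well-foundedness: a vector outside
  the span with least leading term could still be lowered by \<open>lead_cancel\<close>.\<close>

theorem dim_eq_card_lead:
  assumes W: "subspace W" "W \<subseteq> M" "fin_dim W"
  shows "finite (lead ` (W - {0}))" "dim W = card (lead ` (W - {0}))"
proof -
  define L where "L = lead ` (W - {0})"
  define pick where "pick s = (SOME w. w \<in> W - {0} \<and> lead w = s)" for s
  have pick: "pick s \<in> W - {0}" "lead (pick s) = s" if s: "s \<in> L" for s
  proof -
    obtain w where "w \<in> W - {0}" "lead w = s" using s unfolding L_def by blast
    then have "pick s \<in> W - {0} \<and> lead (pick s) = s"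
      unfolding pick_def by (intro someI) auto
    then show "pick s \<in> W - {0}" "lead (pick s) = s" by blast+
  qed
  define A where "A = pick ` L"
  have inj: "inj_on pick L" by (rule inj_on_inverseI[of _ lead]) (rule pick)
  have A_sub: "A \<subseteq> W - {0}" using pick(1) by (auto simp: A_def)
  have "inj_on lead A"
  proof (rule inj_on_inverseI)
    fix a assume "a \<in> A"
    then obtain s where "s \<in> L" "a = pick s" by (auto simp: A_def)
    then show "pick (lead a) = a" using pick(2) by simp
  qed
  moreover have "A \<subseteq> M - {0}" using A_sub W(2) by blast
  ultimately have ind: "independent A" by (intro lead_independent)
  have fA: "finite A" by (rule independent_card_le(1)[OF ind _ W(3)]) (use A_sub in blast)
  then have fL: "finite L" using inj by (simp add: A_def finite_image_iff)
  show "finite (lead ` (W - {0}))" using fL by (simp add: L_def)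
  have span: "w \<in> span A" if "w \<in> W" for w
  proof (rule ccontr)
    assume w: "w \<notin> span A"
    let ?X = "{w \<in> W. w \<notin> span A}"
    have ne: "lead ` ?X \<noteq> {}" using w that by auto
    have X0: "?X \<subseteq> W - {0}" using span_zero by auto
    have fX: "finite (lead ` ?X)"
      by (rule finite_subset[OF image_mono[OF X0] fL[unfolded L_def]])
    have "transp_on (lead ` ?X) lt" by (rule transp_onI) (rule lt_trans)
    moreover have "totalp_on (lead ` ?X) lt" by (rule totalp_onI) (rule lt_total)
    ultimately have "\<exists>m\<in>lead ` ?X. \<forall>x\<in>lead ` ?X. x \<noteq> m \<longrightarrow> lt m x"
      by (rule Finite_Set.bex_least_element[OF fX ne])
    then obtain m where m: "m \<in> lead ` ?X" "\<forall>x\<in>lead ` ?X. x \<noteq> m \<longrightarrow> lt m x" by blast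
    obtain v where v: "v \<in> ?X" "m = lead v" using m(1) by (rule imageE)
    have min: "lt (lead v) (lead x)" if "x \<in> ?X" "lead x \<noteq> lead v" for x
      using m(2) v(2) imageI[OF that(1), of lead] that(2) by metis
    let ?a = "pick (lead v)"
    have vL: "lead v \<in> L" using v(1) X0 unfolding L_def by blast
    note a = pick[OF vL]
    have aA: "?a \<in> A" using vL by (simp add: A_def)
    have vW: "v \<in> W" "v \<notin> span A" "v \<noteq> 0" using v(1) X0 by auto
    have aW: "?a \<in> W" "?a \<noteq> 0" using a(1) by auto
    obtain c where c: "v - scale c ?a = 0 \<or> lt (lead (v - scale c ?a)) (lead v)"
      using lead_cancel[OF subsetD[OF W(2) vW(1)] subsetD[OF W(2) aW(1)] vW(3) aW(2)] a(2) by metis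
    let ?u = "v - scale c ?a"
    have in_span: "scale c ?a \<in> span A" using aA by (intro span_scale span_base)
    have "?u \<notin> span A"
    proof
      assume "?u \<in> span A"
      from span_add[OF this in_span] show False using vW by simp
    qed
    moreover have "?u \<in> W" by (intro subspace_diff subspace_scale W(1) vW aW)
    ultimately have X: "?u \<in> ?X" by simp
    then have "?u \<noteq> 0" using X0 by blast
    then have lt: "lt (lead ?u) (lead v)" using c by simp
    then have "lead ?u \<noteq> lead v" using lt_irrefl[of "lead v"] by metis
    from min[OF X this] show False using lt_trans[OF lt] lt_irrefl by metis
  qed
  have "dim W = card A" by (rule dim_unique[of A]) (use A_sub ind span in auto)
  also have "\<dots> = card L" using inj by (simp add: A_def card_image)
  finally show "dim W = card (lead ` (W - {0}))" by (simp add: L_def)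
qed

end

section \<open>Lexicographic comparison\<close>

text \<open>Index 0 is the most significant. Totality holds for all functions, since two different
  ones have a first index at which they differ.\<close>

definition lexlt :: "(nat \<Rightarrow> 'a::linorder) \<Rightarrow> (nat \<Rightarrow> 'a) \<Rightarrow> bool" where
  "lexlt s t \<longleftrightarrow> (\<exists>i. s i < t i \<and> (\<forall>j<i. s j = t j))"

lemma lexlt_irrefl: "\<not> lexlt s s"
  by (simp add: lexlt_def)

lemma lexlt_trans:
  assumes "lexlt s t" "lexlt t u" shows "lexlt s u"
proof -
  obtain i where i: "s i < t i" "\<And>j. j < i \<Longrightarrow> s j = t j" using assms by (auto simp: lexlt_def)
  obtain k where k: "t k < u k" "\<And>j. j < k \<Longrightarrow> t j = u j" using assms by (auto simp: lexlt_def)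
  have "s (min i k) < u (min i k)"
    using i k by (cases i k rule: linorder_cases) (auto simp: min_def dest: order.strict_trans)
  moreover have "\<forall>j<min i k. s j = u j" using i k by auto
  ultimately show ?thesis unfolding lexlt_def by blast
qed

lemma lexlt_total: "s \<noteq> t \<Longrightarrow> lexlt s t \<or> lexlt t s"
proof -
  assume "s \<noteq> t"
  then obtain i0 where "s i0 \<noteq> t i0" by auto
  define i where "i = (LEAST i. s i \<noteq> t i)"
  have "s i \<noteq> t i" unfolding i_def by (rule LeastI) fact
  moreover have "\<forall>j<i. s j = t j" unfolding i_def using not_less_Least by blast
  ultimately show ?thesis unfolding lexlt_def by (metis linorder_neqE)
qed

text \<open>Transports the comparison along translations and from natural to integer
  exponents.\<close>

lemma lexlt_mono:
  fixes h :: "nat \<Rightarrow> 'a::linorder \<Rightarrow> 'b::linorder"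
  assumes "\<And>i. strict_mono (h i)"
  shows "lexlt (\<lambda>i. h i (s i)) (\<lambda>i. h i (t i)) \<longleftrightarrow> lexlt s t"
  using assms by (simp add: lexlt_def strict_mono_less strict_mono_eq)

lemma lexlt_add_left:
  fixes s t :: "nat \<Rightarrow> nat"
  shows "lexlt (\<lambda>i. e i + s i) (\<lambda>i. e i + t i) \<longleftrightarrow> lexlt s t"
  by (rule lexlt_mono) (simp add: strict_mono_def)

lemma finite_lexmax:
  assumes "finite A" "A \<noteq> {}"
  obtains m where "m \<in> A" "\<And>a. a \<in> A \<Longrightarrow> a \<noteq> m \<Longrightarrow> lexlt a m"
proof -
  have "transp_on A lexlt" by (rule transp_onI) (rule lexlt_trans)
  moreover have "totalp_on A lexlt" by (rule totalp_onI) (rule lexlt_total)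
  ultimately show ?thesis
    using Finite_Set.bex_greatest_element[OF assms] that by metis
qed

section \<open>Polynomials in a transcendence basis\<close>

locale kalgebra =
  fixes \<phi> :: "'k::field_char_0 \<Rightarrow> 'b::idom"
  assumes hom: "alg_hom_struct \<phi>"
begin

lemma phi_one [simp]: "\<phi> 1 = 1" and phi_add: "\<phi> (x + y) = \<phi> x + \<phi> y"
  and phi_mult: "\<phi> (x * y) = \<phi> x * \<phi> y"
  using hom by (auto simp: alg_hom_struct_def)

lemma phi_zero [simp]: "\<phi> 0 = 0" using phi_add[of 0 0] by (metis add_cancel_right_left add_0)

lemma phi_minus: "\<phi> (- x) = - \<phi> x"
  using phi_add[of x "- x"] by (simp add: eq_neg_iff_add_eq_0 add.commute)

lemma phi_eq_0_iff [simp]: "\<phi> x = 0 \<longleftrightarrow> x = 0"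
proof
  show "x = 0" if "\<phi> x = 0"
  proof (rule ccontr)
    assume "x \<noteq> 0"
    then have "\<phi> x * \<phi> (inverse x) = 1" by (simp flip: phi_mult)
    then show False using that by simp
  qed
qed simp

lemma phi_of_nat: "\<phi> (of_nat m) = of_nat m"
  by (induction m) (auto simp: phi_add)

lemma of_nat_eq_0_iff_alg [simp]: "(of_nat m :: 'b) = 0 \<longleftrightarrow> m = 0"
  using phi_eq_0_iff[of "of_nat m"] by (simp add: phi_of_nat)

abbreviation scaleB :: "'k \<Rightarrow> 'b \<Rightarrow> 'b" where "scaleB c b \<equiv> \<phi> c * b"

sublocale B: kspace scaleB
  by standard (auto simp: phi_add phi_mult algebra_simps)

sublocale E: kspace "end_scale \<phi>"
  by standard (auto simp: end_scale_def phi_add phi_mult algebra_simps fun_eq_iff)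

lemma span_mult_closed:
  assumes "\<And>a b. a \<in> A \<Longrightarrow> b \<in> A' \<Longrightarrow> a * b \<in> B.span C" "p \<in> B.span A" "q \<in> B.span A'"
  shows "p * q \<in> B.span C"
  using assms(2)
proof (induction rule: B.span_induct_alt)
  case (step c a y)
  have "a * q \<in> B.span C"
    using assms(3)
  proof (induction rule: B.span_induct_alt)
    case (step c b y)
    then have "\<phi> c * (a * b) + a * y \<in> B.span C"
      using assms(1) \<open>a \<in> A\<close> by (intro B.span_add B.span_scale) auto
    then show ?case by (simp add: algebra_simps)
  qed (simp add: B.span_zero)
  then have "\<phi> c * (a * q) + y * q \<in> B.span C"
    using step by (intro B.span_add B.span_scale) auto
  then show ?case by (simp add: algebra_simps)
qed (simp add: B.span_zero)

end

locale transc_basis = kalgebra \<phi>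
  for \<phi> :: "'k::field_char_0 \<Rightarrow> 'b::idom" +
  fixes xs :: "'b list" and n :: nat
  assumes len: "length xs = n" and indep: "alg_indep \<phi> xs"
begin

definition Mon :: "(nat \<Rightarrow> nat) set" where "Mon = {e. \<forall>i\<ge>n. e i = 0}"

definition X :: "(nat \<Rightarrow> nat) \<Rightarrow> 'b" where "X e = (\<Prod>i<n. (xs ! i) ^ e i)"

definition P :: "'b set" where "P = B.span (X ` Mon)"

lemma X_0 [simp]: "X (\<lambda>i. 0) = 1" by (simp add: X_def)

lemma X_add: "X (\<lambda>i. e i + e' i) = X e * X e'"
  by (simp add: X_def power_add prod.distrib)

lemma Mon_0 [simp]: "(\<lambda>i. 0) \<in> Mon" by (simp add: Mon_def)

lemma Mon_add: "e \<in> Mon \<Longrightarrow> e' \<in> Mon \<Longrightarrow> (\<lambda>i. e i + e' i) \<in> Mon" by (simp add: Mon_def)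

lemma X_unit: "i < n \<Longrightarrow> X ((\<lambda>_. 0)(i := Suc 0)) = xs ! i"
proof -
  assume "i < n"
  have "X ((\<lambda>_. 0)(i := Suc 0)) = (\<Prod>j<n. if j = i then xs ! i else 1)"
    unfolding X_def by (rule prod.cong) auto
  then show ?thesis using \<open>i < n\<close> by simp
qed

lemma monomials_indep:
  assumes "finite E" "E \<subseteq> Mon" "(\<Sum>e\<in>E. \<phi> (c e) * X e) = 0" "e \<in> E"
  shows "c e = 0"
proof -
  have "\<forall>e\<in>E. c e = 0"
    using indep[unfolded alg_indep_def, rule_format, of E c] assms(1-3)
    by (simp add: len Mon_def X_def)
  then show ?thesis using assms(4) by blast
qed

lemma inj_X: "inj_on X Mon"
proof (rule inj_onI, rule ccontr)
  fix e e' assume *: "e \<in> Mon" "e' \<in> Mon" "X e = X e'" "e \<noteq> e'"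
  then have "(\<Sum>a\<in>{e, e'}. \<phi> (if a = e then 1 else - 1) * X a) = 0"
    by (simp add: phi_minus)
  from monomials_indep[OF _ _ this, of e] * show False by simp
qed

lemma span_X_explicit:
  assumes "T \<subseteq> Mon" "p \<in> B.span (X ` T)"
  obtains E c where "finite E" "E \<subseteq> T" "p = (\<Sum>e\<in>E. \<phi> (c e) * X e)"
proof -
  obtain t r where t: "finite t" "t \<subseteq> X ` T" "p = (\<Sum>a\<in>t. \<phi> (r a) * a)"
    using assms(2) unfolding B.span_explicit by blast
  from finite_subset_image[OF t(1,2)] obtain E where E: "E \<subseteq> T" "finite E" "t = X ` E" by blast
  have "inj_on X E" by (rule inj_on_subset[OF inj_X]) (use E assms in blast)
  then have "p = (\<Sum>e\<in>E. \<phi> (r (X e)) * X e)" using t E by (simp add: sum.reindex)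
  then show ?thesis by (rule that[OF E(2,1)])
qed

lemma P_0 [simp]: "0 \<in> P" and P_add: "p \<in> P \<Longrightarrow> q \<in> P \<Longrightarrow> p + q \<in> P"
  and P_diff: "p \<in> P \<Longrightarrow> q \<in> P \<Longrightarrow> p - q \<in> P"
  and P_scale: "p \<in> P \<Longrightarrow> \<phi> c * p \<in> P"
  and P_minus: "p \<in> P \<Longrightarrow> - p \<in> P"
  and P_X: "e \<in> Mon \<Longrightarrow> X e \<in> P"
  by (auto simp: P_def B.span_zero B.span_add B.span_diff B.span_scale B.span_neg B.span_base)

lemma P_1 [simp]: "1 \<in> P" using P_X[of "\<lambda>i. 0"] by simp

lemma P_phi [simp]: "\<phi> c \<in> P" using P_scale[of 1 c] by simp

lemma P_x: "i < n \<Longrightarrow> xs ! i \<in> P"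
  using P_X[of "(\<lambda>_. 0)(i := Suc 0)"] by (auto simp: X_unit Mon_def)

lemma P_mult: assumes "p \<in> P" "q \<in> P" shows "p * q \<in> P"
  unfolding P_def
proof (rule span_mult_closed)
  fix a b assume "a \<in> X ` Mon" "b \<in> X ` Mon"
  then obtain e e' where "e \<in> Mon" "e' \<in> Mon" "a = X e" "b = X e'" by blast
  then have "a * b = X (\<lambda>i. e i + e' i)" "(\<lambda>i. e i + e' i) \<in> Mon" by (auto simp: X_add Mon_add)
  then show "a * b \<in> B.span (X ` Mon)" by (auto intro: B.span_base)
qed (use assms in \<open>simp_all add: P_def\<close>)

section \<open>Leading monomials in \<open>P\<close>\<close>

definition below :: "(nat \<Rightarrow> nat) \<Rightarrow> 'b set" where
  "below e = B.span (X ` {e' \<in> Mon. lexlt e' e})"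

text \<open>Phrased by membership in a span, so that no coefficient functions on \<open>P\<close>
  have to be constructed. Uniqueness of \<open>e\<close> rests on
  \<open>X_notin_below\<close>.\<close>

definition has_lm :: "'b \<Rightarrow> (nat \<Rightarrow> nat) \<Rightarrow> bool" where
  "has_lm p e \<longleftrightarrow> e \<in> Mon \<and> (\<exists>c. c \<noteq> 0 \<and> p - \<phi> c * X e \<in> below e)"

lemma below_mono: "lexlt e e' \<Longrightarrow> below e \<subseteq> below e'"
  unfolding below_def by (intro B.span_mono image_mono) (auto intro: lexlt_trans)

lemma X_notin_below: assumes "e \<in> Mon" shows "X e \<notin> below e"
proof
  assume "X e \<in> below e"
  then obtain E c where E: "finite E" "E \<subseteq> {e' \<in> Mon. lexlt e' e}" "X e = (\<Sum>e\<in>E. \<phi> (c e) * X e)"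
    unfolding below_def by (rule span_X_explicit[rotated]) auto
  have nE: "e \<notin> E" using E lexlt_irrefl by auto
  have "(\<Sum>a\<in>insert e E. \<phi> (if a = e then - 1 else c a) * X a)
      = - X e + (\<Sum>a\<in>E. \<phi> (if a = e then - 1 else c a) * X a)"
    using E(1) nE by (simp add: phi_minus)
  also have "(\<Sum>a\<in>E. \<phi> (if a = e then - 1 else c a) * X a) = (\<Sum>a\<in>E. \<phi> (c a) * X a)"
    by (rule sum.cong) (use nE in auto)
  finally have "(\<Sum>a\<in>insert e E. \<phi> (if a = e then - 1 else c a) * X a) = 0" using E(3) by simp
  from monomials_indep[OF _ _ this, of e] E assms show False by auto
qed

lemma has_lm_exists: assumes "p \<in> P" "p \<noteq> 0" shows "\<exists>e. has_lm p e"
proof -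
  obtain E c where E: "finite E" "E \<subseteq> Mon" "p = (\<Sum>e\<in>E. \<phi> (c e) * X e)"
    using assms(1) unfolding P_def by (rule span_X_explicit[OF subset_refl])
  define E' where "E' = {e\<in>E. c e \<noteq> 0}"
  have p: "p = (\<Sum>e\<in>E'. \<phi> (c e) * X e)"
    unfolding E(3) by (rule sum.mono_neutral_right) (use E in \<open>auto simp: E'_def\<close>)
  have "E' \<noteq> {}" using assms(2) p by (metis sum.empty)
  have "finite E'" using E by (auto simp: E'_def)
  obtain m where m: "m \<in> E'" "\<And>a. a \<in> E' \<Longrightarrow> a \<noteq> m \<Longrightarrow> lexlt a m"
    using finite_lexmax[OF \<open>finite E'\<close> \<open>E' \<noteq> {}\<close>] by blast
  have "p - \<phi> (c m) * X m = (\<Sum>e\<in>E' - {m}. \<phi> (c e) * X e)"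
    unfolding p using m(1) \<open>finite E'\<close> by (simp add: sum.remove)
  also have "\<dots> \<in> below m"
    unfolding below_def by (intro B.span_sum B.span_scale B.span_base) (use m E in \<open>auto simp: E'_def\<close>)
  finally show ?thesis using m E unfolding has_lm_def E'_def by blast
qed

lemma has_lm_notin_below: assumes "has_lm p e" shows "p \<notin> below e"
proof
  assume p: "p \<in> below e"
  obtain c where c: "e \<in> Mon" "c \<noteq> 0" "p - \<phi> c * X e \<in> below e" using assms by (auto simp: has_lm_def)
  have "p - (p - \<phi> c * X e) \<in> below e" using B.span_diff[of p _ "p - \<phi> c * X e"] p c unfolding below_def by blast
  then have "\<phi> c * X e \<in> below e" by simp
  then have "\<phi> (inverse c) * (\<phi> c * X e) \<in> below e" unfolding below_def by (rule B.span_scale)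
  also have "\<phi> (inverse c) * (\<phi> c * X e) = X e" using c by (simp flip: phi_mult mult.assoc)
  finally show False using X_notin_below c by blast
qed

lemma has_lm_in_below: "has_lm p e \<Longrightarrow> lexlt e e' \<Longrightarrow> p \<in> below e'"
proof -
  assume a: "has_lm p e" "lexlt e e'"
  then obtain c where c: "e \<in> Mon" "p - \<phi> c * X e \<in> below e" by (auto simp: has_lm_def)
  have "p - \<phi> c * X e \<in> below e'" using c below_mono a by blast
  moreover have "\<phi> c * X e \<in> below e'"
    unfolding below_def using c a by (intro B.span_scale B.span_base) auto
  ultimately have "(p - \<phi> c * X e) + \<phi> c * X e \<in> below e'" unfolding below_def by (rule B.span_add)
  then show ?thesis by simp
qed

lemma has_lm_unique: "has_lm p e \<Longrightarrow> has_lm p e' \<Longrightarrow> e = e'"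
  using has_lm_in_below has_lm_notin_below lexlt_total by metis

lemma has_lm_nonzero: "has_lm p e \<Longrightarrow> p \<noteq> 0"
  using has_lm_notin_below B.span_zero unfolding below_def by blast

definition lm :: "'b \<Rightarrow> nat \<Rightarrow> nat" where "lm p = (THE e. has_lm p e)"

lemma lm_eqI: "has_lm p e \<Longrightarrow> lm p = e"
  unfolding lm_def using has_lm_unique by blast

lemma has_lm_lm: "p \<in> P \<Longrightarrow> p \<noteq> 0 \<Longrightarrow> has_lm p (lm p)"
  using has_lm_exists lm_eqI by metis

lemma lm_Mon: "p \<in> P \<Longrightarrow> p \<noteq> 0 \<Longrightarrow> lm p \<in> Mon"
  using has_lm_lm by (auto simp: has_lm_def)

lemma below_0 [simp]: "0 \<in> below e" by (simp add: below_def B.span_zero)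

lemma lm_X: "e \<in> Mon \<Longrightarrow> lm (X e) = e"
  by (rule lm_eqI) (auto simp: has_lm_def intro!: exI[of _ 1])

lemma lm_phi: "c \<noteq> 0 \<Longrightarrow> lm (\<phi> c) = (\<lambda>i. 0)"
  by (rule lm_eqI) (auto simp: has_lm_def intro!: exI[of _ c])

lemma lm_x: "i < n \<Longrightarrow> lm (xs ! i) = (\<lambda>_. 0)(i := 1)"
  using lm_X[of "(\<lambda>_. 0)(i := Suc 0)"] by (simp add: X_unit Mon_def)

lemma X_times_below:
  assumes "e \<in> Mon" "p \<in> below e'" shows "X e * p \<in> below (\<lambda>i. e i + e' i)"
  unfolding below_def
proof (rule span_mult_closed)
  show "X e \<in> B.span {X e}" by (simp add: B.span_base)
  show "p \<in> B.span (X ` {e''\<in>Mon. lexlt e'' e'})" using assms by (simp add: below_def)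
  fix a b assume "a \<in> {X e}" "b \<in> X ` {e''\<in>Mon. lexlt e'' e'}"
  then obtain f where "f \<in> Mon" "lexlt f e'" "b = X f" "a = X e" by blast
  then show "a * b \<in> B.span (X ` {e''\<in>Mon. lexlt e'' (\<lambda>i. e i + e' i)})"
    using assms by (intro B.span_base)
      (auto simp: lexlt_add_left Mon_add simp flip: X_add intro!: imageI)
qed

lemma below_times_below:
  assumes "p \<in> below e" "q \<in> below e'" shows "p * q \<in> below (\<lambda>i. e i + e' i)"
  unfolding below_def
proof (rule span_mult_closed)
  fix a b assume "a \<in> X ` {f\<in>Mon. lexlt f e}" "b \<in> X ` {f\<in>Mon. lexlt f e'}"
  then obtain f g where fg: "f \<in> Mon" "lexlt f e" "g \<in> Mon" "lexlt g e'" "a = X f" "b = X g" by blast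
  have "lexlt (\<lambda>i. f i + g i) (\<lambda>i. f i + e' i)" using fg by (simp add: lexlt_add_left)
  moreover have "lexlt (\<lambda>i. f i + e' i) (\<lambda>i. e i + e' i)"
    using fg lexlt_add_left[of e' f e] by (simp add: add.commute)
  ultimately have "lexlt (\<lambda>i. f i + g i) (\<lambda>i. e i + e' i)" by (rule lexlt_trans)
  then show "a * b \<in> B.span (X ` {f\<in>Mon. lexlt f (\<lambda>i. e i + e' i)})"
    using fg by (intro B.span_base) (auto simp: Mon_add simp flip: X_add intro!: imageI)
qed (use assms in \<open>simp_all add: below_def\<close>)

text \<open>Only the product of the leading monomials survives; the three other terms of the
  expansion lie below it, because adding exponent vectors is strictly monotone for
  \<open>lexlt\<close>.\<close>

lemma lm_mult:
  assumes "p \<in> P" "q \<in> P" "p \<noteq> 0" "q \<noteq> 0"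
  shows "lm (p * q) = (\<lambda>i. lm p i + lm q i)"
proof -
  obtain c where c: "c \<noteq> 0" "p - \<phi> c * X (lm p) \<in> below (lm p)"
    using has_lm_lm[OF assms(1,3)] by (auto simp: has_lm_def)
  obtain d where d: "d \<noteq> 0" "q - \<phi> d * X (lm q) \<in> below (lm q)"
    using has_lm_lm[OF assms(2,4)] by (auto simp: has_lm_def)
  note M = lm_Mon[OF assms(1,3)] lm_Mon[OF assms(2,4)]
  let ?p = "p - \<phi> c * X (lm p)" and ?q = "q - \<phi> d * X (lm q)"
  let ?e = "\<lambda>i. lm p i + lm q i"
  have 1: "X (lm p) * ?q \<in> below ?e" by (rule X_times_below[OF M(1) d(2)])
  have 2: "X (lm q) * ?p \<in> below ?e"
    using X_times_below[OF M(2) c(2)] by (simp add: add.commute)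
  have 3: "?p * ?q \<in> below ?e" by (rule below_times_below[OF c(2) d(2)])
  have X: "X ?e = X (lm p) * X (lm q)" by (rule X_add)
  have "p * q - \<phi> (c * d) * X ?e
      = \<phi> c * (X (lm p) * ?q) + \<phi> d * (X (lm q) * ?p) + ?p * ?q"
    unfolding X phi_mult by algebra
  also have "\<dots> \<in> below ?e"
    using 1 2 3 unfolding below_def by (intro B.span_add B.span_scale)
  finally show ?thesis
    using M c d by (intro lm_eqI) (auto simp: has_lm_def Mon_add intro!: exI[of _ "c * d"])
qed

lemma lm_add:
  assumes "p \<in> P" "q \<in> P" "p \<noteq> 0" "q \<noteq> 0" "lexlt (lm p) (lm q)"
  shows "p + q \<noteq> 0" "lm (p + q) = lm q"
proof -
  obtain d where d: "lm q \<in> Mon" "d \<noteq> 0" "q - \<phi> d * X (lm q) \<in> below (lm q)"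
    using has_lm_lm[OF assms(2,4)] by (auto simp: has_lm_def)
  have "p \<in> below (lm q)" using has_lm_in_below[OF has_lm_lm] assms by blast
  then have "p + (q - \<phi> d * X (lm q)) \<in> below (lm q)"
    using d(3) unfolding below_def by (rule B.span_add)
  then have "has_lm (p + q) (lm q)" using d by (auto simp: has_lm_def add_diff_eq)
  then show "p + q \<noteq> 0" "lm (p + q) = lm q" using has_lm_nonzero lm_eqI by auto
qed

lemma lm_cancel:
  assumes "p \<in> P" "q \<in> P" "p \<noteq> 0" "q \<noteq> 0" "lm p = lm q"
  shows "\<exists>c. p - \<phi> c * q = 0 \<or> lexlt (lm (p - \<phi> c * q)) (lm p)"
proof -
  let ?e = "lm p"
  obtain c where c: "c \<noteq> 0" "p - \<phi> c * X ?e \<in> below ?e"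
    using has_lm_lm[OF assms(1,3)] by (auto simp: has_lm_def)
  obtain d where d: "d \<noteq> 0" "q - \<phi> d * X ?e \<in> below ?e"
    using has_lm_lm[OF assms(2,4)] assms(5) by (auto simp: has_lm_def)
  let ?r = "p - \<phi> (c / d) * q"
  have "\<phi> c = \<phi> (c / d) * \<phi> d" using d(1) by (simp flip: phi_mult)
  then have "\<phi> (c / d) * (\<phi> d * X ?e) = \<phi> c * X ?e" by (simp only: mult.assoc)
  then have "?r = (p - \<phi> c * X ?e) - \<phi> (c / d) * (q - \<phi> d * X ?e)"
    by (simp only: right_diff_distrib) simp
  also have "\<dots> \<in> below ?e" using B.span_diff[OF _ B.span_scale] c(2) d(2) unfolding below_def by blast
  finally have r: "?r \<in> below ?e" .
  have "lexlt (lm ?r) ?e" if "?r \<noteq> 0"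
  proof (rule ccontr)
    have rP: "?r \<in> P" using assms by (intro P_diff P_scale)
    assume "\<not> lexlt (lm ?r) ?e"
    then have "below ?e \<subseteq> below (lm ?r)" using lexlt_total[of "lm ?r" ?e] below_mono[of ?e "lm ?r"] by (cases "lm ?r = ?e") auto
    moreover note has_lm_notin_below[OF has_lm_lm[OF rP that]]
    ultimately show False using r by auto
  qed
  then show ?thesis by blast
qed

end

section \<open>Leading terms in B\<close>

text \<open>A spanning sequence over the field serves in place of a chosen maximal
  \<open>P\<close>-independent family: a redundant \<open>g j\<close> merely makes
  \<open>N (Suc j)\<close> equal to \<open>N j\<close>.\<close>

locale enumerated_algebra = transc_basis \<phi> xs n
  for \<phi> :: "'k::field_char_0 \<Rightarrow> 'b::idom" and xs n +
  fixes g :: "nat \<Rightarrow> 'b"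
  assumes g_span: "B.span (range g) = UNIV"
begin

text \<open>\<open>N j\<close> consists of the elements that become a \<open>P\<close>-combination of
  \<open>g 0, \<dots>, g (j - 1)\<close> after multiplication with a nonzero element of \<open>P\<close>.\<close>
fun N :: "nat \<Rightarrow> 'b set" where
  "N 0 = {0}"
| "N (Suc j) = {b. \<exists>q\<in>P - {0}. \<exists>p\<in>P. q * b - p * g j \<in> N j}"

lemma N_0 [simp]: "0 \<in> N j"
proof (induction j)
  case (Suc j)
  then show ?case unfolding N.simps by (intro CollectI bexI[of _ 1] bexI[of _ 0]) auto
qed simp

lemma N_mult: "b \<in> N j \<Longrightarrow> r \<in> P \<Longrightarrow> r * b \<in> N j"
proof (induction j arbitrary: b)
  case (Suc j)
  then obtain q p where *: "q \<in> P - {0}" "p \<in> P" "q * b - p * g j \<in> N j" by auto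
  have "q * (r * b) - (r * p) * g j = r * (q * b - p * g j)" by (simp add: algebra_simps)
  then have "q * (r * b) - (r * p) * g j \<in> N j" using Suc.IH[OF *(3) Suc.prems(2)] by simp
  then show ?case using * Suc.prems P_mult[of r p] by auto
qed simp

lemma N_add: "b \<in> N j \<Longrightarrow> b' \<in> N j \<Longrightarrow> b + b' \<in> N j"
proof (induction j arbitrary: b b')
  case (Suc j)
  obtain q p where 1: "q \<in> P - {0}" "p \<in> P" "q * b - p * g j \<in> N j" using Suc.prems by auto
  obtain q' p' where 2: "q' \<in> P - {0}" "p' \<in> P" "q' * b' - p' * g j \<in> N j" using Suc.prems by auto
  have "(q * q') * (b + b') - (q' * p + q * p') * g j
      = q' * (q * b - p * g j) + q * (q' * b' - p' * g j)"
    by (simp add: algebra_simps)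
  also have "\<dots> \<in> N j" using 1 2 by (intro Suc.IH N_mult) auto
  finally have "(q * q') * (b + b') - (q' * p + q * p') * g j \<in> N j" .
  moreover have "q * q' \<in> P - {0}" "q' * p + q * p' \<in> P" using 1 2 by (auto intro!: P_mult P_add)
  ultimately show ?case unfolding N.simps by blast
qed simp

lemma N_scale: "b \<in> N j \<Longrightarrow> \<phi> c * b \<in> N j"
  by (simp add: N_mult)

lemma N_diff: "b \<in> N j \<Longrightarrow> b' \<in> N j \<Longrightarrow> b - b' \<in> N j"
  using N_add[of b j "- b'"] N_scale[of b' j "- 1"] by (simp add: phi_minus)

text \<open>Each \<open>N j\<close> is saturated, so \<open>B\<close> modulo \<open>N j\<close> is
  torsion-free over \<open>P\<close>; this permits computing with fractions in the successive
  quotients.\<close>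

lemma N_cancel: "r * b \<in> N j \<Longrightarrow> r \<in> P \<Longrightarrow> r \<noteq> 0 \<Longrightarrow> b \<in> N j"
proof (cases j)
  case (Suc i)
  assume a: "r * b \<in> N j" "r \<in> P" "r \<noteq> 0"
  then obtain q p where *: "q \<in> P - {0}" "p \<in> P" "(q * r) * b - p * g i \<in> N i"
    unfolding Suc by (auto simp: mult.assoc)
  moreover have "q * r \<in> P - {0}" using a * by (auto intro: P_mult)
  ultimately show ?thesis unfolding Suc N.simps by blast
qed simp

lemma N_Suc: "N j \<subseteq> N (Suc j)"
proof
  fix b assume "b \<in> N j"
  then show "b \<in> N (Suc j)"
    unfolding N.simps by (intro CollectI bexI[of _ 1] bexI[of _ 0]) auto
qed

lemma N_mono: "i \<le> j \<Longrightarrow> N i \<subseteq> N j"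
  by (rule lift_Suc_mono_le[of N]) (use N_Suc in auto)

lemma g_in_N: "g j \<in> N (Suc j)"
  unfolding N.simps by (intro CollectI bexI[of _ 1] bexI[of _ 1]) auto

lemma N_exhaust: "\<exists>j. b \<in> N j"
proof -
  have "b \<in> B.span (range g)" using g_span by simp
  then show ?thesis
  proof (induction rule: B.span_induct_alt)
    case (step c a b)
    obtain i j where "a = g i" "b \<in> N j" using step by blast
    then have "a \<in> N (max (Suc i) j)" "b \<in> N (max (Suc i) j)"
      using g_in_N N_mono[of "Suc i" "max (Suc i) j"] N_mono[of j "max (Suc i) j"] by auto
    then show ?case using N_add N_scale by blast
  qed (use N_0 in blast)
qed

text \<open>Because of the \<open>Suc\<close>, for \<open>b \<noteq> 0\<close> this is the index of
  the generator that carries the leading term: \<open>b\<close> lies in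
  \<open>N (Suc (jdx b))\<close> but not in \<open>N (jdx b)\<close>.\<close>

definition jdx :: "'b \<Rightarrow> nat" where "jdx b = (LEAST j. b \<in> N (Suc j))"

text \<open>Modulo \<open>N j\<close> with \<open>j = jdx b\<close>, the element \<open>b\<close> is
  \<open>p / q\<close> times \<open>g j\<close>; the pair stands for this fraction.\<close>

definition rep :: "'b \<Rightarrow> 'b \<Rightarrow> 'b \<Rightarrow> bool" where
  "rep b q p \<longleftrightarrow> q \<in> P \<and> q \<noteq> 0 \<and> p \<in> P \<and> q * b - p * g (jdx b) \<in> N (jdx b)"

lemma jdx_mem:
  assumes "b \<noteq> 0" shows "b \<in> N (Suc (jdx b))" "b \<notin> N (jdx b)"
proof -
  obtain j where "b \<in> N j" using N_exhaust by blast
  then have "b \<in> N (Suc j)" using N_Suc by blast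
  then show "b \<in> N (Suc (jdx b))" unfolding jdx_def by (rule LeastI)
  show "b \<notin> N (jdx b)"
  proof (cases "jdx b")
    case (Suc i)
    then show ?thesis using not_less_Least[of i "\<lambda>j. b \<in> N (Suc j)"] by (simp add: jdx_def)
  qed (use assms in simp)
qed

lemma jdx_eqI: "b \<in> N (Suc j) \<Longrightarrow> b \<notin> N j \<Longrightarrow> jdx b = j"
  unfolding jdx_def
proof (rule Least_equality)
  fix i assume "b \<notin> N j" "b \<in> N (Suc i)"
  then show "j \<le> i" using N_mono[of "Suc i" j] by (meson not_less_eq_eq subsetD)
qed

lemma jdx_less: assumes "b \<in> N j" "b \<noteq> 0" shows "jdx b < j"
  using jdx_mem(2)[OF assms(2)] N_mono[of j "jdx b"] assms(1) by (meson not_le_imp_less subsetD)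

lemma rep_exists: "b \<noteq> 0 \<Longrightarrow> \<exists>q p. rep b q p"
  using jdx_mem(1)[of b] unfolding rep_def by auto

lemma rep_eqI:
  assumes "q \<in> P" "q \<noteq> 0" "p \<in> P" "q * b - p * g j \<in> N j" "b \<notin> N j"
  shows "jdx b = j" "rep b q p"
proof -
  show "jdx b = j" by (rule jdx_eqI) (use assms in auto)
  then show "rep b q p" using assms by (simp add: rep_def)
qed

lemma rep_g: assumes "b \<noteq> 0" "rep b q p" shows "g (jdx b) \<notin> N (jdx b)"
proof
  assume "g (jdx b) \<in> N (jdx b)"
  then have "q * b - p * g (jdx b) + p * g (jdx b) \<in> N (jdx b)"
    using assms by (intro N_add N_mult) (auto simp: rep_def)
  then have "q * b \<in> N (jdx b)" by simp
  then show False using N_cancel assms jdx_mem(2) by (auto simp: rep_def)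
qed

lemma rep_nonzero: assumes "b \<noteq> 0" "rep b q p" shows "p \<noteq> 0"
proof
  assume "p = 0"
  then have "q * b \<in> N (jdx b)" using assms by (simp add: rep_def)
  then show False using N_cancel assms jdx_mem(2) by (auto simp: rep_def)
qed

text \<open>Two representations are equal as fractions; otherwise a nonzero multiple of
  \<open>g (jdx b)\<close>, and by saturation \<open>g (jdx b)\<close> itself, would lie in
  \<open>N (jdx b)\<close>.\<close>

lemma rep_unique:
  assumes b: "b \<noteq> 0" "rep b q p" "rep b q' p'" shows "q * p' = q' * p"
proof (rule ccontr)
  assume ne: "q * p' \<noteq> q' * p"
  have "q' * (q * b - p * g (jdx b)) - q * (q' * b - p' * g (jdx b)) \<in> N (jdx b)"
    by (rule N_diff; rule N_mult) (use b in \<open>auto simp: rep_def\<close>)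
  then have "(q * p' - q' * p) * g (jdx b) \<in> N (jdx b)" by (simp add: algebra_simps)
  moreover have "q * p' - q' * p \<in> P" using b by (auto simp: rep_def intro!: P_diff P_mult)
  ultimately have "g (jdx b) \<in> N (jdx b)" by (rule N_cancel) (use ne in simp)
  then show False using rep_g b by blast
qed

text \<open>The exponent of a fraction, numerator minus denominator, hence integer-valued. The
  choice of the pair is immaterial by \<open>rep_unique\<close> and additivity of
  \<open>lm\<close>.\<close>

definition expo :: "'b \<Rightarrow> nat \<Rightarrow> int" where
  "expo b = (SOME a. \<exists>q p. rep b q p \<and> a = (\<lambda>i. int (lm p i) - int (lm q i)))"

lemma expo_eq:
  assumes "b \<noteq> 0" "rep b q p" shows "expo b = (\<lambda>i. int (lm p i) - int (lm q i))"
proof -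
  have "\<exists>a q p. rep b q p \<and> a = (\<lambda>i. int (lm p i) - int (lm q i))" using assms(2) by blast
  then have "\<exists>q p. rep b q p \<and> expo b = (\<lambda>i. int (lm p i) - int (lm q i))"
    unfolding expo_def by (rule someI_ex)
  then obtain q' p' where r: "rep b q' p'" "expo b = (\<lambda>i. int (lm p' i) - int (lm q' i))" by blast
  have "lm (q * p') = lm (q' * p)" using rep_unique[OF assms r(1)] by simp
  moreover have "lm (q * p') = (\<lambda>i. lm q i + lm p' i)"
    using assms r rep_nonzero[OF assms(1)] by (intro lm_mult) (auto simp: rep_def)
  moreover have "lm (q' * p) = (\<lambda>i. lm q' i + lm p i)"
    using assms r rep_nonzero[OF assms(1)] by (intro lm_mult) (auto simp: rep_def)
  ultimately have h: "lm q i + lm p' i = lm q' i + lm p i" for i by metis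
  have "int (lm p' i) - int (lm q' i) = int (lm p i) - int (lm q i)" for i
    using h[of i] by linarith
  then show ?thesis using r by simp
qed

definition leadB :: "'b \<Rightarrow> nat \<times> (nat \<Rightarrow> int)" where "leadB b = (jdx b, expo b)"

definition ltB :: "nat \<times> (nat \<Rightarrow> int) \<Rightarrow> nat \<times> (nat \<Rightarrow> int) \<Rightarrow> bool" where
  "ltB s t \<longleftrightarrow> fst s < fst t \<or> fst s = fst t \<and> lexlt (snd s) (snd t)"

text \<open>Saturation keeps \<open>r * b\<close> out of \<open>N (jdx b)\<close>, so the position
  stays; the numerator is multiplied by \<open>r\<close>.\<close>

lemma leadB_mult:
  assumes "b \<noteq> 0" "r \<in> P" "r \<noteq> 0"
  shows "leadB (r * b) = (jdx b, \<lambda>i. expo b i + int (lm r i))"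
proof -
  obtain q p where rep: "rep b q p" using rep_exists assms by blast
  have "q * (r * b) - (r * p) * g (jdx b) = r * (q * b - p * g (jdx b))"
    by (simp add: algebra_simps)
  also have "\<dots> \<in> N (jdx b)" using rep assms by (intro N_mult) (auto simp: rep_def)
  finally have 1: "q * (r * b) - (r * p) * g (jdx b) \<in> N (jdx b)" .
  have 2: "r * b \<notin> N (jdx b)" using N_cancel[OF _ assms(2,3)] jdx_mem(2)[OF assms(1)] by metis
  have *: "q \<in> P" "q \<noteq> 0" "p \<in> P" "p \<noteq> 0" using rep rep_nonzero[OF assms(1) rep] by (auto simp: rep_def)
  have r: "jdx (r * b) = jdx b" "rep (r * b) q (r * p)"
    using rep_eqI[OF *(1,2) P_mult[OF assms(2) *(3)] 1 2] by auto
  have "expo (r * b) = (\<lambda>i. int (lm (r * p) i) - int (lm q i))"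
    by (rule expo_eq) (use r assms in auto)
  also have "\<dots> = (\<lambda>i. expo b i + int (lm r i))"
    using expo_eq[OF assms(1) rep] lm_mult[OF assms(2) *(3) assms(3) *(4)] by auto
  finally show ?thesis using r by (simp add: leadB_def)
qed

lemma lm_int_eq:
  assumes "p \<in> P" "q \<in> P" "p \<noteq> 0" "q \<noteq> 0"
  shows "int (lm (p * q) i) = int (lm p i) + int (lm q i)"
  using lm_mult[OF assms] by simp

text \<open>Adding \<open>lm q\<close> and \<open>lm q'\<close> to both sides clears denominators,
  so fractions are compared through their cross products.\<close>

lemma lexlt_expo:
  assumes "p \<in> P" "q \<in> P" "p' \<in> P" "q' \<in> P" "p \<noteq> 0" "q \<noteq> 0" "p' \<noteq> 0" "q' \<noteq> 0"
  shows "lexlt (\<lambda>i. int (lm p i) - int (lm q i)) (\<lambda>i. int (lm p' i) - int (lm q' i))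
    \<longleftrightarrow> lexlt (lm (q' * p)) (lm (q * p'))"
proof -
  have "lexlt (\<lambda>i. int (lm p i) - int (lm q i)) (\<lambda>i. int (lm p' i) - int (lm q' i)) \<longleftrightarrow>
     lexlt (\<lambda>i. int (lm q i) + int (lm q' i) + (int (lm p i) - int (lm q i)))
       (\<lambda>i. int (lm q i) + int (lm q' i) + (int (lm p' i) - int (lm q' i)))"
    by (rule lexlt_mono[symmetric]) (simp add: strict_mono_def)
  also have "\<dots> \<longleftrightarrow> lexlt (\<lambda>i. int (lm (q' * p) i)) (\<lambda>i. int (lm (q * p') i))"
    using assms by (simp add: lm_int_eq algebra_simps)
  also have "\<dots> \<longleftrightarrow> lexlt (lm (q' * p)) (lm (q * p'))"
    by (rule lexlt_mono) (simp add: strict_mono_def)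
  finally show ?thesis .
qed

text \<open>At different positions the summand \<open>v\<close> already lies in
  \<open>N (jdx w)\<close> and changes nothing modulo it. At equal positions the fractions are added
  over the common denominator \<open>q * q'\<close>, and the leading monomial of the numerator comes
  from \<open>w\<close>.\<close>

lemma leadB_add:
  assumes "v \<noteq> 0" "w \<noteq> 0" "ltB (leadB v) (leadB w)"
  shows "v + w \<noteq> 0 \<and> leadB (v + w) = leadB w"
proof -
  obtain q p where v: "rep v q p" using rep_exists assms by blast
  obtain q' p' where w: "rep w q' p'" using rep_exists assms by blast
  note v' = v[unfolded rep_def] rep_nonzero[OF assms(1) v]
  note w' = w[unfolded rep_def] rep_nonzero[OF assms(2) w]
  have nz: "v + w \<noteq> 0" if "v + w \<notin> N (jdx w)" using that by (metis N_0)
  consider "jdx v < jdx w" | "jdx v = jdx w" "lexlt (expo v) (expo w)"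
    using assms(3) by (auto simp: ltB_def leadB_def)
  then show ?thesis
  proof cases
    case 1
    have vN: "v \<in> N (jdx w)" using jdx_mem(1)[OF assms(1)] N_mono[of "Suc (jdx v)" "jdx w"] 1 by auto
    have nN: "v + w \<notin> N (jdx w)"
      using N_diff[OF _ vN, of "v + w"] jdx_mem(2)[OF assms(2)] by auto
    have "q' * (v + w) - p' * g (jdx w) = q' * v + (q' * w - p' * g (jdx w))"
      by (simp add: algebra_simps)
    also have "\<dots> \<in> N (jdx w)" using vN w' by (intro N_add N_mult) auto
    finally have r: "jdx (v + w) = jdx w" "rep (v + w) q' p'"
      using rep_eqI[of q' p' "v + w" "jdx w"] w' nN by auto
    show ?thesis
      using r expo_eq[OF nz[OF nN] r(2)] expo_eq[OF assms(2) w] nz[OF nN] by (simp add: leadB_def)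
  next
    case 2
    let ?j = "jdx w" let ?p = "q' * p + q * p'"
    have lt: "lexlt (lm (q' * p)) (lm (q * p'))"
      using 2(2) v' w' by (simp add: expo_eq[OF assms(1) v] expo_eq[OF assms(2) w] lexlt_expo)
    have PP: "q' * p \<in> P" "q * p' \<in> P" "q * q' \<in> P" "?p \<in> P"
      using v' w' by (auto intro: P_mult P_add)
    have pn: "?p \<noteq> 0" "lm ?p = lm (q * p')"
      using lm_add[OF PP(1,2) _ _ lt] v' w' by auto
    have "(q * q') * (v + w) - ?p * g ?j = q' * (q * v - p * g ?j) + q * (q' * w - p' * g ?j)"
      by (simp add: algebra_simps)
    also have "\<dots> \<in> N ?j" using v' w' 2(1) by (intro N_add N_mult) auto
    finally have mem: "(q * q') * (v + w) - ?p * g ?j \<in> N ?j" .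
    have nN: "v + w \<notin> N ?j"
    proof
      assume "v + w \<in> N ?j"
      then have "(q * q') * (v + w) - ((q * q') * (v + w) - ?p * g ?j) \<in> N ?j"
        using N_diff[OF N_mult mem] PP(3) by blast
      then have "?p * g ?j \<in> N ?j" by simp
      then have "g ?j \<in> N ?j" using PP(4) pn(1) by (rule N_cancel)
      then show False using rep_g[OF assms(2) w] by blast
    qed
    have r: "jdx (v + w) = ?j" "rep (v + w) (q * q') ?p"
      using rep_eqI[OF PP(3) _ PP(4) mem nN] v' w' by auto
    have "expo (v + w) = (\<lambda>i. int (lm (q * p') i) - int (lm (q * q') i))"
      using expo_eq[OF nz[OF nN] r(2)] pn by simp
    also have "\<dots> = expo w"
      using v' w' by (simp add: expo_eq[OF assms(2) w] lm_int_eq)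
    finally show ?thesis using r nz[OF nN] by (simp add: leadB_def)
  qed
qed

text \<open>One scalar cancels the leading monomials of the cross-multiplied numerators. Then either
  the exponent drops, or the whole difference falls into \<open>N (jdx v)\<close> and is 0 or has a
  lower position.\<close>

lemma leadB_cancel:
  assumes "v \<noteq> 0" "w \<noteq> 0" "leadB v = leadB w"
  shows "\<exists>c. v - \<phi> c * w = 0 \<or> ltB (leadB (v - \<phi> c * w)) (leadB v)"
proof -
  obtain q p where v: "rep v q p" using rep_exists assms by blast
  obtain q' p' where w: "rep w q' p'" using rep_exists assms by blast
  note v' = v[unfolded rep_def] rep_nonzero[OF assms(1) v]
  note w' = w[unfolded rep_def] rep_nonzero[OF assms(2) w]
  have j: "jdx w = jdx v" and e: "expo v = expo w" using assms(3) by (auto simp: leadB_def)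
  let ?j = "jdx v"
  have "(\<lambda>i. int (lm p i) - int (lm q i)) = (\<lambda>i. int (lm p' i) - int (lm q' i))"
    using e by (simp only: expo_eq[OF assms(1) v] expo_eq[OF assms(2) w])
  from fun_cong[OF this] have h: "int (lm p i) - int (lm q i) = int (lm p' i) - int (lm q' i)" for i .
  have "lm (q' * p) = (\<lambda>i. lm q' i + lm p i)" "lm (q * p') = (\<lambda>i. lm q i + lm p' i)"
    using v' w' by (auto intro!: lm_mult)
  moreover have "lm q' i + lm p i = lm q i + lm p' i" for i using h[of i] by linarith
  ultimately have lm_eq: "lm (q' * p) = lm (q * p')" by simp
  have PP: "q' * p \<in> P" "q * p' \<in> P" "q * q' \<in> P" using v' w' by (auto intro: P_mult P_add)
  obtain c where c: "q' * p - \<phi> c * (q * p') = 0 \<or>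
      lexlt (lm (q' * p - \<phi> c * (q * p'))) (lm (q' * p))"
    using lm_cancel[OF PP(1,2) _ _ lm_eq] v' w' by auto
  let ?p = "q' * p - \<phi> c * (q * p')" and ?u = "v - \<phi> c * w"
  have pP: "?p \<in> P" using PP by (intro P_diff P_scale)
  have "(q * q') * ?u - ?p * g ?j = q' * (q * v - p * g ?j) - \<phi> c * (q * (q' * w - p' * g ?j))"
    by (simp add: algebra_simps)
  also have "\<dots> \<in> N ?j" by (rule N_diff[OF N_mult N_scale[OF N_mult]]) (use v' w' j in auto)
  finally have mem: "(q * q') * ?u - ?p * g ?j \<in> N ?j" .
  show ?thesis
  proof (cases "?u \<in> N ?j")
    case True
    then show ?thesis using jdx_less[OF True] by (auto simp: ltB_def leadB_def intro!: exI[of _ c])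
  next
    case False
    then have u0: "?u \<noteq> 0" by (metis N_0)
    have r: "jdx ?u = ?j" "rep ?u (q * q') ?p"
      using rep_eqI[OF PP(3) _ pP mem False] v' w' by auto
    have p0: "?p \<noteq> 0" by (rule rep_nonzero[OF u0 r(2)])
    have lt: "lexlt (lm ?p) (lm (q' * p))" using c p0 by simp
    have "lexlt (expo ?u) (\<lambda>i. int (lm (q' * p) i) - int (lm (q * q') i))"
      unfolding expo_eq[OF u0 r(2)]
      using lexlt_mono[of "\<lambda>i x. int x - int (lm (q * q') i)" "lm ?p" "lm (q' * p)"] lt
      by (simp add: strict_mono_def)
    also have "(\<lambda>i. int (lm (q' * p) i) - int (lm (q * q') i)) = expo v"
      using v' w' by (simp add: expo_eq[OF assms(1) v] lm_int_eq)
    finally show ?thesis using r by (auto simp: ltB_def leadB_def intro!: exI[of _ c])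
  qed
qed

lemma ltB_irrefl: "\<not> ltB s s"
  by (simp add: ltB_def lexlt_irrefl)

lemma ltB_trans: "ltB s t \<Longrightarrow> ltB t u \<Longrightarrow> ltB s u"
  unfolding ltB_def using lexlt_trans[of "snd s" "snd t" "snd u"] by auto

lemma ltB_total: "s \<noteq> t \<Longrightarrow> ltB s t \<or> ltB t s"
  unfolding ltB_def using lexlt_total[of "snd s" "snd t"] by (auto simp: prod_eq_iff)

lemma leadB_scale: "b \<noteq> 0 \<Longrightarrow> c \<noteq> 0 \<Longrightarrow> leadB (\<phi> c * b) = leadB b"
  using leadB_mult[of b "\<phi> c"] by (simp add: lm_phi leadB_def)

sublocale LB: leading scaleB UNIV ltB leadB
proof
  show "B.subspace UNIV" by simp
  show "\<not> ltB s s" for s by (rule ltB_irrefl)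
  show "ltB s u" if "ltB s t" "ltB t u" for s t u using that by (rule ltB_trans)
  show "ltB s t \<or> ltB t s" if "s \<noteq> t" for s t using that by (rule ltB_total)
  show "leadB (\<phi> c * v) = leadB v" if "v \<noteq> 0" "c \<noteq> 0" for v c using that by (rule leadB_scale)
  show "v + w \<noteq> 0 \<and> leadB (v + w) = leadB w" if "v \<noteq> 0" "w \<noteq> 0" "ltB (leadB v) (leadB w)" for v w
    using that by (rule leadB_add)
  show "\<exists>c. v - \<phi> c * w = 0 \<or> ltB (leadB (v - \<phi> c * w)) (leadB v)"
    if "v \<noteq> 0" "w \<noteq> 0" "leadB v = leadB w" for v w
    using that by (rule leadB_cancel)
qed

lemma expo_outside:
  assumes "b \<noteq> 0" "i \<ge> n" shows "expo b i = 0"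
proof -
  obtain q p where r: "rep b q p" using rep_exists assms by blast
  have "lm q \<in> Mon" "lm p \<in> Mon" using r rep_nonzero[OF assms(1) r] lm_Mon by (auto simp: rep_def)
  then show ?thesis using expo_eq[OF assms(1) r] assms(2) by (simp add: Mon_def)
qed

end

section \<open>Extending derivations along algebraic elements\<close>

context kalgebra
begin

definition subalg :: "'b set \<Rightarrow> bool" where
  "subalg A \<longleftrightarrow> (\<forall>c. \<phi> c \<in> A) \<and> (\<forall>a\<in>A. \<forall>b\<in>A. a + b \<in> A \<and> a * b \<in> A)"

text \<open>Values are allowed in all of \<open>B\<close>, so a derivation may be rescaled by any
  element of \<open>B\<close>.\<close>

definition deriv_on :: "'b set \<Rightarrow> ('b \<Rightarrow> 'b) \<Rightarrow> bool" where
  "deriv_on A \<delta> \<longleftrightarrow> (\<forall>c. \<delta> (\<phi> c) = 0) \<and>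
     (\<forall>a\<in>A. \<forall>b\<in>A. \<delta> (a + b) = \<delta> a + \<delta> b \<and> \<delta> (a * b) = a * \<delta> b + b * \<delta> a)"

definition polys :: "'b set \<Rightarrow> 'b poly set" where
  "polys A = {R. \<forall>i. coeff R i \<in> A}"

lemma subalg_phi: "subalg A \<Longrightarrow> \<phi> c \<in> A"
  and subalg_add: "subalg A \<Longrightarrow> a \<in> A \<Longrightarrow> b \<in> A \<Longrightarrow> a + b \<in> A"
  and subalg_mult: "subalg A \<Longrightarrow> a \<in> A \<Longrightarrow> b \<in> A \<Longrightarrow> a * b \<in> A"
  by (auto simp: subalg_def)

lemma subalg_0: "subalg A \<Longrightarrow> 0 \<in> A" and subalg_1: "subalg A \<Longrightarrow> 1 \<in> A"
  and subalg_of_nat: "subalg A \<Longrightarrow> of_nat m \<in> A"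
  using subalg_phi[of A 0] subalg_phi[of A 1] subalg_phi[of A "of_nat m"] by (auto simp: phi_of_nat)

lemma subalg_minus: "subalg A \<Longrightarrow> a \<in> A \<Longrightarrow> - a \<in> A"
  using subalg_mult[OF _ subalg_phi, of A a "- 1"] by (simp add: phi_minus)

lemma subalg_sum: "subalg A \<Longrightarrow> (\<And>i. i \<in> I \<Longrightarrow> f i \<in> A) \<Longrightarrow> sum f I \<in> A"
  by (induction I rule: infinite_finite_induct) (auto intro: subalg_0 subalg_add)

lemma subalg_power: "subalg A \<Longrightarrow> a \<in> A \<Longrightarrow> a ^ m \<in> A"
  by (induction m) (auto intro: subalg_1 subalg_mult)

lemma deriv_on_sum:
  assumes "subalg A" "deriv_on A \<delta>" "\<And>i. i \<in> I \<Longrightarrow> f i \<in> A"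
  shows "\<delta> (sum f I) = (\<Sum>i\<in>I. \<delta> (f i))"
proof -
  have "\<delta> 0 = 0" using assms(2) phi_zero unfolding deriv_on_def by metis
  then show ?thesis using assms(3)
  proof (induction I rule: infinite_finite_induct)
    case (insert x F)
    have "sum f F \<in> A" by (rule subalg_sum[OF assms(1)]) (use insert in auto)
    then show ?case using insert assms(2) by (simp add: deriv_on_def)
  qed auto
qed

lemma polys_add: "subalg A \<Longrightarrow> R \<in> polys A \<Longrightarrow> S \<in> polys A \<Longrightarrow> R + S \<in> polys A"
  by (auto simp: polys_def intro: subalg_add)

lemma polys_mult: "subalg A \<Longrightarrow> R \<in> polys A \<Longrightarrow> S \<in> polys A \<Longrightarrow> R * S \<in> polys A"
  by (auto simp: polys_def coeff_mult intro!: subalg_sum subalg_mult)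

lemma polys_monom: "subalg A \<Longrightarrow> a \<in> A \<Longrightarrow> monom a k \<in> polys A"
  by (auto simp: polys_def intro: subalg_0)

lemma polys_const: "subalg A \<Longrightarrow> a \<in> A \<Longrightarrow> [:a:] \<in> polys A"
  using polys_monom[of A a 0] by (simp add: monom_0)

lemma polys_minus: "subalg A \<Longrightarrow> R \<in> polys A \<Longrightarrow> - R \<in> polys A"
  by (auto simp: polys_def intro: subalg_minus)

lemma polys_diff: "subalg A \<Longrightarrow> R \<in> polys A \<Longrightarrow> S \<in> polys A \<Longrightarrow> R - S \<in> polys A"
  using polys_add[OF _ _ polys_minus, of A R S] by simp

lemma polys_pderiv: "subalg A \<Longrightarrow> R \<in> polys A \<Longrightarrow> pderiv R \<in> polys A"
  using subalg_mult[OF _ subalg_of_nat] by (auto simp: polys_def coeff_pderiv simp del: of_nat_Suc)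

text \<open>Characteristic zero enters: the factor \<open>of_nat (degree Q)\<close> does not
  vanish.\<close>

lemma pderiv_degree_less:
  fixes Q :: "'b poly"
  assumes "degree Q > 0" shows "pderiv Q \<noteq> 0" "degree (pderiv Q) < degree Q"
proof -
  have "coeff (pderiv Q) (degree Q - 1) = of_nat (degree Q) * lead_coeff Q"
    using assms by (simp add: coeff_pderiv del: of_nat_Suc)
  then have "coeff (pderiv Q) (degree Q - 1) \<noteq> 0" using assms by auto
  then show "pderiv Q \<noteq> 0" by auto
  show "degree (pderiv Q) < degree Q"
    by (rule degree_lessI) (use assms in \<open>auto simp: coeff_pderiv coeff_eq_0\<close>)
qed

text \<open>Minimal degree replaces irreducibility over a field; since \<open>A\<close> is only a
  ring, \<open>Q\<close> cannot be normalised to be monic.\<close>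

lemma exists_minimal_poly:
  fixes s :: 'b
  assumes "Q0 \<in> polys A" "Q0 \<noteq> 0" "poly Q0 s = 0"
  obtains Q where "Q \<in> polys A" "Q \<noteq> 0" "poly Q s = 0" "degree Q > 0"
    "\<And>R. R \<in> polys A \<Longrightarrow> R \<noteq> 0 \<Longrightarrow> poly R s = 0 \<Longrightarrow> degree Q \<le> degree R"
proof -
  define good where "good Q \<longleftrightarrow> Q \<in> polys A \<and> Q \<noteq> 0 \<and> poly Q s = 0" for Q
  have "good Q0" using assms by (simp add: good_def)
  then obtain Q where Q: "good Q" "\<And>R. good R \<Longrightarrow> degree Q \<le> degree R"
    using exists_least_iff[of "\<lambda>d. \<exists>Q. good Q \<and> degree Q = d"] by (metis not_le)
  have "degree Q > 0"
  proof (rule ccontr)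
    assume "\<not> 0 < degree Q"
    then obtain a where "Q = [:a:]" by (auto elim: degree_eq_zeroE)
    then show False using Q(1) by (simp add: good_def)
  qed
  then show ?thesis using that Q unfolding good_def by blast
qed

text \<open>In the fraction field the extension is forced: \<open>s\<close> goes to minus the value
  at \<open>s\<close> of \<open>Q\<close> with \<open>\<delta>\<close> applied to its coefficients,
  divided by the derivative of \<open>Q\<close> at \<open>s\<close>. Multiplying the whole
  derivation by that denominator keeps it inside \<open>B\<close>; this is the factor
  \<open>c\<close>, nonzero by minimality of \<open>Q\<close>.\<close>

lemma derivation_extend:
  assumes A: "subalg A" and \<delta>: "deriv_on A \<delta>"
    and Q0: "Q0 \<in> polys A" "Q0 \<noteq> 0" "poly Q0 s = 0"
  shows "\<exists>A' \<delta>' c. subalg A' \<and> A \<subseteq> A' \<and> s \<in> A' \<and> deriv_on A' \<delta>' \<and> c \<noteq> 0 \<and> (\<forall>a\<in>A. \<delta>' a = c * \<delta> a)"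
proof -
  obtain Q where Q: "Q \<in> polys A" "Q \<noteq> 0" "poly Q s = 0" "degree Q > 0"
    and min: "\<And>R. R \<in> polys A \<Longrightarrow> R \<noteq> 0 \<Longrightarrow> poly R s = 0 \<Longrightarrow> degree Q \<le> degree R"
    using exists_minimal_poly[OF Q0] by blast
  have \<delta>0: "\<delta> 0 = 0" using \<delta> phi_zero unfolding deriv_on_def by metis
  have \<delta>phi: "\<delta> (\<phi> c) = 0" for c using \<delta> by (simp add: deriv_on_def)
  define q' where "q' = poly (pderiv Q) s"
  have q': "q' \<noteq> 0"
    using min[OF polys_pderiv[OF A Q(1)]] pderiv_degree_less[OF Q(4)] by (force simp: q'_def)
  define D where "D R = poly (map_poly \<delta> R) s" for R
  have coeff_D: "coeff (map_poly \<delta> R) i = \<delta> (coeff R i)" for R i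
    by (simp add: coeff_map_poly \<delta>0)
  have D_add: "D (R + S) = D R + D S" if "R \<in> polys A" "S \<in> polys A" for R S
  proof -
    have "map_poly \<delta> (R + S) = map_poly \<delta> R + map_poly \<delta> S"
      by (rule poly_eqI) (use that \<delta> in \<open>simp add: coeff_D polys_def deriv_on_def\<close>)
    then show ?thesis by (simp add: D_def)
  qed
  have D_mult: "D (R * S) = D R * poly S s + poly R s * D S"
    if RS: "R \<in> polys A" "S \<in> polys A" for R S
  proof -
    have "map_poly \<delta> (R * S) = map_poly \<delta> R * S + R * map_poly \<delta> S"
    proof (rule poly_eqI)
      fix i
      have "coeff (map_poly \<delta> (R * S)) i = (\<Sum>j\<le>i. \<delta> (coeff R j * coeff S (i - j)))"
        unfolding coeff_D coeff_mult
        by (rule deriv_on_sum[OF A \<delta>]) (use RS A in \<open>auto simp: polys_def intro: subalg_mult\<close>)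
      also have "\<dots> = (\<Sum>j\<le>i. \<delta> (coeff R j) * coeff S (i - j) + coeff R j * \<delta> (coeff S (i - j)))"
        by (rule sum.cong) (use RS \<delta> in \<open>auto simp: polys_def deriv_on_def algebra_simps\<close>)
      also have "\<dots> = coeff (map_poly \<delta> R * S + R * map_poly \<delta> S) i"
        by (simp add: coeff_mult coeff_D sum.distrib)
      finally show "coeff (map_poly \<delta> (R * S)) i = coeff (map_poly \<delta> R * S + R * map_poly \<delta> S) i" .
    qed
    then show ?thesis by (simp add: D_def)
  qed
  text \<open>On \<open>A[T]\<close> the map \<open>E\<close> is the derivation along \<open>T \<mapsto> s\<close> that should extend \<open>q' * \<delta>\<close>
    and send \<open>s\<close> to \<open>- D Q\<close>; it remains to see that it factors through \<open>A[s]\<close>.\<close>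
  define E where "E R = q' * D R - poly (pderiv R) s * D Q" for R
  have E_add: "E (R + S) = E R + E S" if "R \<in> polys A" "S \<in> polys A" for R S
    unfolding E_def D_add[OF that] pderiv_add poly_add by algebra
  have E_mult: "E (R * S) = E R * poly S s + poly R s * E S"
    if "R \<in> polys A" "S \<in> polys A" for R S
    unfolding E_def D_mult[OF that] pderiv_mult poly_add poly_mult by algebra
  have E_Q: "E Q = 0" by (simp add: E_def q'_def)
  \<comment> \<open>Pseudo-division by \<open>Q\<close>: after multiplication by the leading
    coefficient \<open>a\<close>, a multiple of \<open>Q\<close> can be subtracted to lower the
    degree; \<open>a\<close> is cancelled at the end, since \<open>B\<close> is a domain.\<close>
  have E_0: "E R = 0" if "R \<in> polys A" "poly R s = 0" for R
    using that
  proof (induction "degree R" arbitrary: R rule: less_induct)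
    case less
    show ?case
    proof (cases "R = 0")
      case True
      then show ?thesis by (simp add: E_def D_def)
    next
      case False
      define k where "k = degree R - degree Q"
      define a where "a = lead_coeff Q"
      have kd: "k + degree Q = degree R" using min[OF less.prems(1) False less.prems(2)] by (simp add: k_def)
      let ?M = "monom (lead_coeff R) k" let ?R1 = "smult a R - ?M * Q"
      have aA: "a \<in> A" "lead_coeff R \<in> A" using Q(1) less.prems(1) by (auto simp: a_def polys_def)
      note MA = polys_monom[OF A aA(2), of k] and aP = polys_const[OF A aA(1)]
      have sm: "smult a R = [:a:] * R" by simp
      have R1A: "?R1 \<in> polys A"
        unfolding sm by (intro polys_diff polys_mult A aP MA less.prems Q)
      have "degree ?R1 < degree R"
      proof (rule degree_lessI)
        show "?R1 \<noteq> 0 \<or> 0 < degree R" using kd Q(4) by simp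
        show "\<forall>i\<ge>degree R. coeff ?R1 i = 0"
        proof (intro allI impI)
          fix i assume i: "degree R \<le> i"
          show "coeff ?R1 i = 0"
          proof (cases "i = degree R")
            case True
            moreover have "\<not> degree R < k" "degree R - k = degree Q" using kd by auto
            ultimately show ?thesis by (simp add: coeff_monom_mult a_def)
          next
            case False
            then have "degree R < i" "degree Q < i - k" using i kd by auto
            then show ?thesis by (simp add: coeff_monom_mult coeff_eq_0)
          qed
        qed
      qed
      moreover have "poly ?R1 s = 0" using less.prems Q by simp
      ultimately have "E ?R1 = 0" using less.hyps R1A by blast
      moreover have "E (?M * Q) = 0" using E_mult[OF MA Q(1)] E_Q Q(3) by simp
      moreover have "E (?R1 + ?M * Q) = E ?R1 + E (?M * Q)"
        by (intro E_add R1A polys_mult A MA Q)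
      ultimately have "E ([:a:] * R) = 0" by simp
      then have "a * E R = 0" using E_mult[OF aP less.prems(1)] less.prems(2) by simp
      then show ?thesis using Q(2) by (simp add: a_def)
    qed
  qed
  have E_cong: "E R = E S" if "R \<in> polys A" "S \<in> polys A" "poly R s = poly S s" for R S
    using E_add[OF that(2) polys_diff[OF A that(1,2)]] E_0[OF polys_diff[OF A that(1,2)]] that(3)
    by simp
  define A' where "A' = (\<lambda>R. poly R s) ` polys A"
  \<comment> \<open>Any polynomial with value \<open>b\<close> at \<open>s\<close> gives the same
    result, by \<open>E_cong\<close>.\<close>
  define \<delta>' where "\<delta>' b = E (SOME R. R \<in> polys A \<and> poly R s = b)" for b
  have \<delta>': "\<delta>' (poly R s) = E R" if "R \<in> polys A" for R
  proof -
    have "(SOME R'. R' \<in> polys A \<and> poly R' s = poly R s) \<in> polys A \<and>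
        poly (SOME R'. R' \<in> polys A \<and> poly R' s = poly R s) s = poly R s"
      by (rule someI[of _ R]) (use that in simp)
    then show ?thesis unfolding \<delta>'_def using E_cong that by blast
  qed
  have \<delta>'_A: "\<delta>' a = q' * \<delta> a" if "a \<in> A" for a
    using \<delta>'[OF polys_const[OF A that]] by (simp add: E_def D_def map_poly_pCons \<delta>0 pderiv_pCons)
  have AA': "A \<subseteq> A'"
  proof
    fix a assume "a \<in> A"
    then show "a \<in> A'" unfolding A'_def using polys_const[OF A] by (intro image_eqI[of _ _ "[:a:]"]) auto
  qed
  have "s \<in> A'"
    unfolding A'_def using polys_monom[OF A subalg_1[OF A], of 1]
    by (intro image_eqI[of _ _ "monom 1 1"]) (auto simp: poly_monom)
  moreover have "subalg A'"
    unfolding subalg_def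
  proof (intro conjI ballI allI)
    show "\<phi> c \<in> A'" for c using AA' subalg_phi[OF A] by blast
    fix a b assume "a \<in> A'" "b \<in> A'"
    then obtain R S where "R \<in> polys A" "S \<in> polys A" "a = poly R s" "b = poly S s"
      by (auto simp: A'_def)
    then show "a + b \<in> A'" "a * b \<in> A'"
      unfolding A'_def
      using imageI[OF polys_add[OF A], of R S "\<lambda>R. poly R s"] imageI[OF polys_mult[OF A], of R S "\<lambda>R. poly R s"]
      by simp_all
  qed
  moreover have "deriv_on A' \<delta>'"
    unfolding deriv_on_def
  proof (intro conjI ballI allI)
    show "\<delta>' (\<phi> c) = 0" for c using \<delta>'_A[OF subalg_phi[OF A]] by (simp add: \<delta>phi)
    fix a b assume "a \<in> A'" "b \<in> A'"
    then obtain R S where RS: "R \<in> polys A" "S \<in> polys A" "a = poly R s" "b = poly S s"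
      by (auto simp: A'_def)
    show "\<delta>' (a + b) = \<delta>' a + \<delta>' b"
      using \<delta>'[OF polys_add[OF A RS(1,2)]] E_add[OF RS(1,2)] \<delta>'[OF RS(1)] \<delta>'[OF RS(2)] RS by simp
    show "\<delta>' (a * b) = a * \<delta>' b + b * \<delta>' a"
      using \<delta>'[OF polys_mult[OF A RS(1,2)]] E_mult[OF RS(1,2)] \<delta>'[OF RS(1)] \<delta>'[OF RS(2)] RS
      by (simp add: algebra_simps)
  qed
  ultimately show ?thesis using AA' q' \<delta>'_A by blast
qed

end

section \<open>Algebraic elements over \<open>P\<close> and derivations of \<open>B\<close>\<close>

locale affine_domain = transc_basis \<phi> xs n
  for \<phi> :: "'k::field_char_0 \<Rightarrow> 'b::idom" and xs n +
  assumes maximal: "alg_indep \<phi> ys \<Longrightarrow> length ys \<le> n"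
    and affine: "affine_alg \<phi>"
begin

lemma subalg_P: "subalg P"
  by (simp add: subalg_def P_add P_mult)

text \<open>By maximality \<open>xs @ [b]\<close> is dependent; the relation is read as a polynomial
  in \<open>b\<close> by collecting exponent vectors with equal last entry
  \<open>e n\<close>.\<close>

lemma algebraic:
  obtains Q where "Q \<in> polys P" "Q \<noteq> 0" "poly Q b = 0"
proof -
  let ?ys = "xs @ [b]"
  have "\<not> alg_indep \<phi> ?ys" using maximal[of ?ys] len by auto
  then obtain E c e0 where E: "finite E" "E \<subseteq> {e::nat \<Rightarrow> nat. \<forall>i\<ge>Suc n. e i = 0}"
    "(\<Sum>e\<in>E. \<phi> (c e) * (\<Prod>i<Suc n. (?ys ! i) ^ e i)) = 0" "e0 \<in> E" "c e0 \<noteq> 0"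
    unfolding alg_indep_def by (auto simp: len)
  have prod: "(\<Prod>i<Suc n. (?ys ! i) ^ e i) = X e * b ^ e n" for e
  proof -
    have "(\<Prod>i<n. (?ys ! i) ^ e i) = X e"
      unfolding X_def by (rule prod.cong) (auto simp: nth_append len)
    then show ?thesis by (simp add: nth_append len)
  qed
  have X_upd: "X (e(n := m)) = X e" for e m unfolding X_def by (rule prod.cong) auto
  define Q where "Q = (\<Sum>e\<in>E. monom (\<phi> (c e) * X e) (e n))"
  have "poly Q b = 0" using E(3) unfolding prod by (simp add: Q_def poly_sum poly_monom mult.assoc)
  have cQ: "coeff Q i = (\<Sum>e\<in>{e\<in>E. e n = i}. \<phi> (c e) * X e)" for i
    unfolding Q_def coeff_sum coeff_monom using E(1) by (simp add: sum.inter_filter)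
  have MonE: "e(n := 0) \<in> Mon" if "e \<in> E" for e
    using subsetD[OF E(2) that] by (auto simp: Mon_def le_Suc_eq Suc_le_eq)
  have "X e \<in> P" if "e \<in> E" for e
    using P_X[OF MonE[OF that]] by (simp only: X_upd)
  then have "Q \<in> polys P"
    by (auto simp: polys_def cQ intro!: subalg_sum[OF subalg_P] P_scale)
  moreover have "Q \<noteq> 0"
  proof
    assume "Q = 0"
    \<comment> \<open>The coefficient of \<open>Q\<close> in this degree is a combination of
      distinct monomials that contains the nonzero scalar \<open>c e0\<close>.\<close>
    define m where "m = e0 n"
    let ?E = "{e\<in>E. e n = m}"
    have inj: "inj_on (\<lambda>e. e(n := 0)) ?E"
      by (rule inj_on_inverseI[of _ "\<lambda>e. e(n := m)"]) auto
    have "(\<Sum>f\<in>(\<lambda>e. e(n := 0)) ` ?E. \<phi> (c (f(n := m))) * X f) = (\<Sum>e\<in>?E. \<phi> (c e) * X e)"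
      unfolding sum.reindex[OF inj] by (rule sum.cong) (auto simp: X_upd)
    also have "\<dots> = 0" using cQ[of m] \<open>Q = 0\<close> by simp
    finally have "c ((e0(n := 0))(n := m)) = 0"
      by (rule monomials_indep[rotated 2]) (use E MonE in \<open>auto simp: m_def\<close>)
    then show False using E(5) by (simp add: m_def)
  qed
  ultimately show ?thesis using that \<open>poly Q b = 0\<close> by blast
qed

text \<open>Divide an algebraic equation of \<open>b\<close> by the variable until its constant term
  is nonzero; that term is a multiple of \<open>b\<close>.\<close>

lemma nonzero_multiple_in_P:
  assumes "b \<noteq> 0"
  obtains b' where "b' * b \<in> P" "b' * b \<noteq> 0"
proof -
  obtain Q where "Q \<in> polys P" "Q \<noteq> 0" "poly Q b = 0" by (rule algebraic)
  then have "\<exists>b'. b' * b \<in> P \<and> b' * b \<noteq> 0"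
  proof (induction Q)
    case (pCons a Q)
    have Q: "Q \<in> polys P" "a \<in> P"
      using pCons.prems(1) by (auto simp: polys_def coeff_pCons split: nat.splits)
    show ?case
    proof (cases "a = 0")
      case True
      then show ?thesis using pCons assms Q by auto
    next
      case False
      have "- poly Q b * b = a" using pCons.prems(3) unfolding poly_pCons by algebra
      then show ?thesis using False Q by metis
    qed
  qed simp
  then show ?thesis using that by blast
qed

lemma independent_X: "B.independent (X ` Mon)"
  unfolding B.independent_explicit_finite_subsets
proof (intro allI impI ballI)
  fix S u v assume S: "S \<subseteq> X ` Mon" "finite S" "(\<Sum>v\<in>S. \<phi> (u v) * v) = 0" "v \<in> S"
  obtain E where E: "E \<subseteq> Mon" "finite E" "S = X ` E" using finite_subset_image[OF S(2,1)] by blast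
  have "inj_on X E" by (rule inj_on_subset[OF inj_X E(1)])
  then have "(\<Sum>e\<in>E. \<phi> (u (X e)) * X e) = 0" using S E by (simp add: sum.reindex)
  then have "\<forall>e\<in>E. u (X e) = 0" using monomials_indep[OF E(2,1), of "\<lambda>e. u (X e)"] by blast
  then show "u v = 0" using S(4) E(3) by blast
qed

text \<open>Prescribed on the monomials, which are independent, and extended linearly to all of
  \<open>B\<close>; the Leibniz rule is claimed on \<open>P\<close> only.\<close>

lemma partial_derivative:
  assumes i: "i < n"
  obtains \<delta> where "deriv_on P \<delta>" "\<And>j. j < n \<Longrightarrow> \<delta> (xs ! j) = (if j = i then 1 else 0)"
proof -
  interpret BB: vector_space_pair scaleB scaleB ..
  define f where "f b = (let e = inv_into Mon X b in of_nat (e i) * X (e(i := e i - 1)))" for b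
  obtain \<delta> where lin: "Vector_Spaces.linear scaleB scaleB \<delta>" and \<delta>f: "\<And>b. b \<in> X ` Mon \<Longrightarrow> \<delta> b = f b"
    using BB.linear_independent_extend[OF independent_X, of f] by blast
  interpret \<delta>: Vector_Spaces.linear scaleB scaleB \<delta> by fact
  have \<delta>X: "\<delta> (X e) = of_nat (e i) * X (e(i := e i - 1))" if "e \<in> Mon" for e
    using \<delta>f[of "X e"] that by (simp add: f_def inv_into_f_f[OF inj_X])
  have Xi: "X (e(i := a)) * (xs ! i) ^ b = X (e(i := a + b))" for e a b
  proof -
    have "X (e(i := m)) = (xs ! i) ^ m * (\<Prod>j\<in>{..<n} - {i}. (xs ! j) ^ e j)" for m
      unfolding X_def using i by (subst prod.remove[of _ i]) (auto intro!: prod.cong)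
    then show ?thesis by (simp add: power_add)
  qed
  have leib_X: "\<delta> (X e * X e') = X e * \<delta> (X e') + X e' * \<delta> (X e)" if e: "e \<in> Mon" "e' \<in> Mon" for e e'
  proof -
    \<comment> \<open>The truncated exponent \<open>e' i - 1\<close> is harmless at
      \<open>e' i = 0\<close>, where both sides carry the factor 0.\<close>
    have key: "of_nat (e' i) * (X e * X (e'(i := e' i - 1)))
        = of_nat (e' i) * X ((\<lambda>j. e j + e' j)(i := e i + e' i - 1))" for e e'
    proof (cases "e' i = 0")
      case False
      have "X e * X (e'(i := e' i - 1)) = X (\<lambda>j. e j + (e'(i := e' i - 1)) j)" by (simp only: X_add)
      also have "(\<lambda>j. e j + (e'(i := e' i - 1)) j) = (\<lambda>j. e j + e' j)(i := e i + e' i - 1)"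
        using False by auto
      finally show ?thesis by (simp only:)
    qed simp
    have "\<delta> (X e * X e') = of_nat (e i + e' i) * X ((\<lambda>j. e j + e' j)(i := e i + e' i - 1))"
      using \<delta>X[OF Mon_add[OF e]] by (simp add: X_add)
    also have "\<dots> = of_nat (e' i) * (X e * X (e'(i := e' i - 1))) + of_nat (e i) * (X e' * X (e(i := e i - 1)))"
      unfolding key of_nat_add distrib_right
      by (simp only: add.commute[of "e' _" "e _"] add.commute[of "e' i" "e i"] add.commute[of "of_nat (e' i) * _"])
    finally show ?thesis using \<delta>X e by (simp add: algebra_simps)
  qed
  have leib1: "\<delta> (X e * q) = X e * \<delta> q + q * \<delta> (X e)" if e: "e \<in> Mon" and "q \<in> P" for e q
    using that(2) unfolding P_def
  proof (induction rule: B.span_induct_alt)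
    case base
    then show ?case by simp
  next
    case (step c a y)
    then obtain e' where e': "e' \<in> Mon" "a = X e'" by blast
    have "\<delta> (X e * (\<phi> c * a + y)) = \<delta> (\<phi> c * (X e * a) + X e * y)" by (simp add: algebra_simps)
    also have "\<dots> = \<phi> c * \<delta> (X e * a) + \<delta> (X e * y)" by (simp only: \<delta>.add \<delta>.scale)
    also have "\<dots> = X e * \<delta> (\<phi> c * a + y) + (\<phi> c * a + y) * \<delta> (X e)"
      unfolding \<delta>.add \<delta>.scale step.IH e'(2) leib_X[OF e e'(1)] by (simp add: algebra_simps)
    finally show ?case .
  qed
  have leib: "\<delta> (p * q) = p * \<delta> q + q * \<delta> p" if "p \<in> P" "q \<in> P" for p q
    using that(1) unfolding P_def
  proof (induction rule: B.span_induct_alt)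
    case base
    then show ?case by simp
  next
    case (step c a y)
    then obtain e where e: "e \<in> Mon" "a = X e" by blast
    have "\<delta> ((\<phi> c * a + y) * q) = \<delta> (\<phi> c * (a * q) + y * q)" by (simp add: algebra_simps)
    also have "\<dots> = \<phi> c * \<delta> (a * q) + \<delta> (y * q)" by (simp only: \<delta>.add \<delta>.scale)
    also have "\<dots> = (\<phi> c * a + y) * \<delta> q + q * \<delta> (\<phi> c * a + y)"
      unfolding \<delta>.add \<delta>.scale step.IH e(2) leib1[OF e(1) that(2)] by (simp add: algebra_simps)
    finally show ?case .
  qed
  have "\<delta> 1 = 0" using \<delta>X[of "\<lambda>_. 0"] by simp
  then have "\<delta> (\<phi> c) = 0" for c using \<delta>.scale[of c 1] by simp
  then have "deriv_on P \<delta>" using leib by (simp add: deriv_on_def \<delta>.add)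
  moreover have "\<delta> (xs ! j) = (if j = i then 1 else 0)" if "j < n" for j
  proof -
    have "(\<lambda>_. 0)(j := Suc 0) \<in> Mon" using that by (auto simp: Mon_def)
    from \<delta>X[OF this] show ?thesis
      using that X_unit[OF that] X_0 by (auto simp: fun_upd_idem)
  qed
  ultimately show ?thesis using that by blast
qed

text \<open>To be applied to the generators of \<open>B\<close>: finitely many extensions suffice,
  and their nonzero factors multiply up to \<open>c\<close>.\<close>

lemma derivation_extend_finite:
  assumes "deriv_on P \<delta>" "finite S"
  shows "\<exists>A \<delta>' c. subalg A \<and> P \<subseteq> A \<and> S \<subseteq> A \<and> deriv_on A \<delta>' \<and> c \<noteq> 0 \<and> (\<forall>p\<in>P. \<delta>' p = c * \<delta> p)"
  using assms(2)
proof induction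
  case empty
  then show ?case using assms(1) subalg_P by (intro exI[of _ P] exI[of _ \<delta>] exI[of _ 1]) auto
next
  case (insert s S)
  then obtain A \<delta>1 c where 1: "subalg A" "P \<subseteq> A" "S \<subseteq> A" "deriv_on A \<delta>1" "c \<noteq> 0"
    "\<forall>p\<in>P. \<delta>1 p = c * \<delta> p" by blast
  obtain Q where "Q \<in> polys P" "Q \<noteq> 0" "poly Q s = 0" by (rule algebraic)
  moreover from this have "Q \<in> polys A" using 1(2) by (auto simp: polys_def)
  ultimately obtain A' \<delta>' c' where 2: "subalg A'" "A \<subseteq> A'" "s \<in> A'" "deriv_on A' \<delta>'" "c' \<noteq> 0"
    "\<forall>a\<in>A. \<delta>' a = c' * \<delta>1 a"
    using derivation_extend[OF 1(1,4)] by blast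
  have "\<forall>p\<in>P. \<delta>' p = (c' * c) * \<delta> p" using 1(2,6) 2(6) by (auto simp: mult.assoc)
  moreover have "c' * c \<noteq> 0" using 1 2 by simp
  moreover have "P \<subseteq> A'" "insert s S \<subseteq> A'" using 1 2 by auto
  ultimately show ?case using 2 by blast
qed

text \<open>The factor \<open>c\<close> produced by the extension lies in \<open>B\<close> only; a
  second factor \<open>c'\<close> moves it into \<open>P\<close>, where \<open>leadB_mult\<close>
  describes its effect on leading terms.\<close>

lemma derivation_exists:
  assumes i: "i < n"
  obtains \<delta> f where "deriv_on UNIV \<delta>" "f \<in> P" "f \<noteq> 0"
    "\<And>j. j < n \<Longrightarrow> \<delta> (xs ! j) = (if j = i then f else 0)"
proof -
  obtain \<delta> where \<delta>: "deriv_on P \<delta>" "\<And>j. j < n \<Longrightarrow> \<delta> (xs ! j) = (if j = i then 1 else 0)"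
    using partial_derivative[OF i] by blast
  obtain S where S: "finite S" "gen_subalg \<phi> S = UNIV" using affine by (auto simp: affine_alg_def)
  obtain A \<delta>' c where A: "subalg A" "P \<subseteq> A" "S \<subseteq> A" "deriv_on A \<delta>'" "c \<noteq> 0"
    "\<forall>p\<in>P. \<delta>' p = c * \<delta> p" using derivation_extend_finite[OF \<delta>(1) S(1)] by blast
  have "b \<in> A" for b
  proof -
    have "b \<in> gen_subalg \<phi> S" using S by simp
    then show ?thesis by induction (use A in \<open>auto simp: subalg_def\<close>)
  qed
  then have AU: "A = UNIV" by auto
  obtain c' where c': "c' * c \<in> P" "c' * c \<noteq> 0" using nonzero_multiple_in_P[OF A(5)] by blast
  have "deriv_on UNIV (\<lambda>b. c' * \<delta>' b)"
    using A(4) unfolding AU deriv_on_def by (simp add: algebra_simps)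
  moreover have "c' * \<delta>' (xs ! j) = (if j = i then c' * c else 0)" if "j < n" for j
    using A(6) P_x[OF that] \<delta>(2)[OF that] by simp
  ultimately show ?thesis using that c' by blast
qed

end

section \<open>Differential operators and their symbols\<close>

context kalgebra
begin

text \<open>The commutator \<open>[d, a]\<close> from the definition of differential
  operators.\<close>

definition C :: "'b \<Rightarrow> ('b \<Rightarrow> 'b) \<Rightarrow> 'b \<Rightarrow> 'b" where
  "C a d = (\<lambda>x. d (a * x) - a * d x)"

lemma klinear_add: "klinear \<phi> d \<Longrightarrow> d (x + y) = d x + d y"
  and klinear_scale: "klinear \<phi> d \<Longrightarrow> d (\<phi> c * x) = \<phi> c * d x"
  by (auto simp: klinear_def)

lemma klinear_0: "klinear \<phi> d \<Longrightarrow> d 0 = 0"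
  using klinear_scale[of d 0 0] by simp

lemma klinear_diff: "klinear \<phi> d \<Longrightarrow> d (x - y) = d x - d y"
  using klinear_add[of d "x - y" y] by simp

lemma diffops_Suc: "d \<in> diffops \<phi> (Suc m) \<longleftrightarrow> klinear \<phi> d \<and> (\<forall>a. C a d \<in> diffops \<phi> m)"
  by (simp add: C_def)

lemma diffops_klinear: "d \<in> diffops \<phi> m \<Longrightarrow> klinear \<phi> d"
  by (cases m) (auto simp: klinear_def algebra_simps)

lemma C_mult_op: "d \<in> diffops \<phi> 0 \<Longrightarrow> C a d = (\<lambda>_. 0)"
  by (auto simp: C_def algebra_simps)

lemma C_zero [simp]: "C a (\<lambda>_. 0) = (\<lambda>_. 0)"
  by (simp add: C_def)

lemma diffops_zero [simp]: "(\<lambda>_. 0) \<in> diffops \<phi> m"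
proof (induction m)
  case 0
  then show ?case by (auto intro!: exI[of _ 0])
next
  case (Suc m)
  then show ?case unfolding diffops_Suc by (simp add: klinear_def)
qed

declare diffops.simps [simp del]

lemma diffops_mult_op: "(\<lambda>x. a * x) \<in> diffops \<phi> 0"
  by (auto simp: diffops.simps)

lemma diffops_0E: "d \<in> diffops \<phi> 0 \<Longrightarrow> d = (\<lambda>x. d 1 * x)"
  by (auto simp: diffops.simps)

lemma diffops_mono_Suc: "diffops \<phi> m \<subseteq> diffops \<phi> (Suc m)"
proof (induction m)
  case 0
  show ?case using C_mult_op diffops_klinear diffops_zero by (auto simp: diffops_Suc)
next
  case (Suc m)
  show ?case
  proof
    fix d assume "d \<in> diffops \<phi> (Suc m)"
    then have "klinear \<phi> d" "C a d \<in> diffops \<phi> m" for a by (auto simp: diffops_Suc)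
    then show "d \<in> diffops \<phi> (Suc (Suc m))"
      unfolding diffops_Suc[of d "Suc m"] using Suc.IH by blast
  qed
qed

lemma diffops_mono: "m \<le> m' \<Longrightarrow> diffops \<phi> m \<subseteq> diffops \<phi> m'"
  by (rule lift_Suc_mono_le[of "diffops \<phi>"]) (use diffops_mono_Suc in auto)

lemma C_add: "C a (\<lambda>x. d x + e x) = (\<lambda>x. C a d x + C a e x)"
  by (simp add: C_def fun_eq_iff algebra_simps)

lemma C_lmult: "C a (\<lambda>x. b * d x) = (\<lambda>x. b * C a d x)"
  by (simp add: C_def fun_eq_iff algebra_simps)

lemma C_commute: "C a (C b d) = C b (C a d)"
  by (simp add: C_def fun_eq_iff algebra_simps)

lemma C_comp: "klinear \<phi> d \<Longrightarrow> C a (d \<circ> e) = (\<lambda>x. (C a d \<circ> e) x + (d \<circ> C a e) x)"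
  by (simp add: C_def fun_eq_iff klinear_diff)

lemma klinear_comp: "klinear \<phi> d \<Longrightarrow> klinear \<phi> e \<Longrightarrow> klinear \<phi> (d \<circ> e)"
  by (simp add: klinear_def)

lemma klinear_C: "klinear \<phi> d \<Longrightarrow> klinear \<phi> (C a d)"
proof -
  assume d: "klinear \<phi> d"
  have "C a d (x + y) = C a d x + C a d y" for x y
    unfolding C_def distrib_left klinear_add[OF d] by simp
  moreover have "C a d (\<phi> c * x) = \<phi> c * C a d x" for c x
    unfolding C_def mult.left_commute[of a] klinear_scale[OF d] by (simp add: algebra_simps)
  ultimately show ?thesis unfolding klinear_def by blast
qed

lemma diffops_add: "d \<in> diffops \<phi> m \<Longrightarrow> e \<in> diffops \<phi> m \<Longrightarrow> (\<lambda>x. d x + e x) \<in> diffops \<phi> m"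
proof (induction m arbitrary: d e)
  case 0
  then obtain a b where "d = (\<lambda>x. a * x)" "e = (\<lambda>x. b * x)" by (auto simp: diffops.simps)
  then have "(\<lambda>x. d x + e x) = (\<lambda>x. (a + b) * x)" by (auto simp: algebra_simps)
  then show ?case by (simp add: diffops_mult_op)
next
  case (Suc m)
  then show ?case by (auto simp: diffops_Suc C_add klinear_def algebra_simps)
qed

lemma diffops_lmult: "d \<in> diffops \<phi> m \<Longrightarrow> (\<lambda>x. b * d x) \<in> diffops \<phi> m"
proof (induction m arbitrary: d)
  case 0
  then have "(\<lambda>x. b * d x) = (\<lambda>x. (b * d 1) * x)" using diffops_0E[of d] by (metis mult.assoc)
  then show ?case by (simp add: diffops_mult_op)
next
  case (Suc m)
  then show ?case by (auto simp: diffops_Suc C_lmult klinear_def algebra_simps)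
qed

lemma diffops_scale: "d \<in> diffops \<phi> m \<Longrightarrow> end_scale \<phi> c d \<in> diffops \<phi> m"
  unfolding end_scale_def by (rule diffops_lmult)

lemma subspace_diffops: "E.subspace (diffops \<phi> m)"
  using diffops_zero
    by (intro E.subspaceI) (auto simp: diffops_add diffops_scale zero_fun_def plus_fun_def)

text \<open>Induction on the total order: the commutator of a composite is a sum of two composites
  of smaller total order. A factor of order 0 has no predecessor, but its commutator
  vanishes.\<close>

lemma diffops_comp:
  assumes "d \<in> diffops \<phi> m" "e \<in> diffops \<phi> m'" shows "d \<circ> e \<in> diffops \<phi> (m + m')"
  using assms
proof (induction "m + m'" arbitrary: d e m m')
  case 0
  then have "d = (\<lambda>x. d 1 * x)" "e \<in> diffops \<phi> 0" using diffops_0E by auto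
  from diffops_lmult[OF this(2), of "d 1"] this(1) show ?case using 0 by (simp add: comp_def)
next
  case (Suc k)
  note kl = diffops_klinear[OF Suc.prems(1)] diffops_klinear[OF Suc.prems(2)]
  have "C a (d \<circ> e) \<in> diffops \<phi> k" for a
  proof -
    have "C a d \<circ> e \<in> diffops \<phi> k"
    proof (cases m)
      case 0
      then have "C a d \<circ> e = (\<lambda>_. 0)" using C_mult_op Suc.prems by (simp add: comp_def)
      then show ?thesis by simp
    next
      case (Suc i)
      then show ?thesis using Suc.hyps Suc.prems \<open>Suc k = m + m'\<close> by (simp add: diffops_Suc)
    qed
    moreover have "d \<circ> C a e \<in> diffops \<phi> k"
    proof (cases m')
      case 0
      then have "d \<circ> C a e = (\<lambda>_. 0)" using C_mult_op Suc.prems klinear_0[OF kl(1)] by (simp add: comp_def)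
      then show ?thesis by simp
    next
      case (Suc i)
      then show ?thesis using Suc.hyps(1)[of m i] Suc.prems \<open>Suc k = m + m'\<close> by (simp add: diffops_Suc)
    qed
    ultimately show ?thesis unfolding C_comp[OF kl(1)] by (rule diffops_add)
  qed
  then show ?case using klinear_comp[OF kl] by (simp add: diffops_Suc flip: Suc.hyps(2))
qed

lemma DiffOps_bound:
  assumes "finite F" "F \<subseteq> DiffOps \<phi>" obtains m where "F \<subseteq> diffops \<phi> m"
proof -
  have "\<exists>m. F \<subseteq> diffops \<phi> m" using assms
  proof induction
    case (insert d F)
    then obtain m where "F \<subseteq> diffops \<phi> m" by blast
    moreover obtain m' where "d \<in> diffops \<phi> m'" using insert.prems by (auto simp: DiffOps_def)
    ultimately have "insert d F \<subseteq> diffops \<phi> (max m m')"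
      using diffops_mono[of m "max m m'"] diffops_mono[of m' "max m m'"] by auto
    then show ?case by blast
  qed simp
  then show ?thesis using that by blast
qed

lemma subspace_DiffOps: "E.subspace (DiffOps \<phi>)"
proof (rule E.subspaceI)
  show "0 \<in> DiffOps \<phi>" using diffops_zero by (auto simp: DiffOps_def zero_fun_def)
  show "d + e \<in> DiffOps \<phi>" if de: "d \<in> DiffOps \<phi>" "e \<in> DiffOps \<phi>" for d e
  proof -
    obtain m where "{d, e} \<subseteq> diffops \<phi> m" by (rule DiffOps_bound[of "{d, e}"]) (use de in auto)
    then show ?thesis using diffops_add[of d m e] by (auto simp: DiffOps_def plus_fun_def)
  qed
  show "end_scale \<phi> c d \<in> DiffOps \<phi>" if "d \<in> DiffOps \<phi>" for c d
    using that diffops_scale by (auto simp: DiffOps_def)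
qed

lemma DiffOps_comp: "d \<in> DiffOps \<phi> \<Longrightarrow> e \<in> DiffOps \<phi> \<Longrightarrow> d \<circ> e \<in> DiffOps \<phi>"
  using diffops_comp by (fastforce simp: DiffOps_def)

lemma DiffOps_klinear: "d \<in> DiffOps \<phi> \<Longrightarrow> klinear \<phi> d"
  using diffops_klinear by (auto simp: DiffOps_def)

lemma mult_op_DiffOps: "(\<lambda>x. a * x) \<in> DiffOps \<phi>"
  using diffops_mult_op by (auto simp: DiffOps_def)

lemma id_DiffOps: "id \<in> DiffOps \<phi>"
  using mult_op_DiffOps[of 1] by (simp add: id_def)

lemma deriv_klinear: "deriv_on UNIV \<delta> \<Longrightarrow> klinear \<phi> \<delta>"
  by (simp add: deriv_on_def klinear_def)

lemma deriv_DiffOps: assumes "deriv_on UNIV \<delta>" shows "\<delta> \<in> DiffOps \<phi>"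
proof -
  have "C a \<delta> = (\<lambda>x. \<delta> a * x)" for a
    using assms by (auto simp: C_def deriv_on_def algebra_simps)
  then have "\<delta> \<in> diffops \<phi> (Suc 0)"
    using deriv_klinear[OF assms] diffops_mult_op by (simp add: diffops_Suc)
  then show ?thesis by (auto simp: DiffOps_def)
qed

text \<open>Indexed by integers, with only the zero operator in negative orders, so that commutators
  lower the index by one without truncation at 0.\<close>

definition Ord :: "int \<Rightarrow> ('b \<Rightarrow> 'b) set" where
  "Ord m = (if m < 0 then {\<lambda>_. 0} else diffops \<phi> (nat m))"

lemma Ord_C: "d \<in> Ord m \<Longrightarrow> C a d \<in> Ord (m - 1)"
proof -
  assume d: "d \<in> Ord m"
  consider "m < 0" | "m = 0" | "m > 0" by linarith
  then show ?thesis
  proof cases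
    case 3
    then have "nat m = Suc (nat (m - 1))" by simp
    then show ?thesis using d 3 by (simp add: Ord_def diffops_Suc)
  qed (use d C_mult_op in \<open>auto simp: Ord_def\<close>)
qed

lemma Ord_C_power: "d \<in> Ord m \<Longrightarrow> (C a ^^ k) d \<in> Ord (m - int k)"
proof (induction k)
  case (Suc k)
  then show ?case using Ord_C[of "(C a ^^ k) d" "m - int k" a] by (simp add: algebra_simps)
qed simp

lemma C_power_add: "(C a ^^ k) (\<lambda>x. d x + e x) = (\<lambda>x. (C a ^^ k) d x + (C a ^^ k) e x)"
  by (induction k) (auto simp: C_add)

lemma C_power_lmult: "(C a ^^ k) (\<lambda>x. b * d x) = (\<lambda>x. b * (C a ^^ k) d x)"
  by (induction k) (auto simp: C_lmult)

lemma C_power_commute: "(C a ^^ k) (C b d) = C b ((C a ^^ k) d)"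
  by (induction k) (auto simp: C_commute[of a])

lemma C_deriv: "deriv_on UNIV \<delta> \<Longrightarrow> C a (\<delta> \<circ> d) = (\<lambda>x. \<delta> (C a d x) + \<delta> a * d x)"
proof
  fix x assume d: "deriv_on UNIV \<delta>"
  show "C a (\<delta> \<circ> d) x = \<delta> (C a d x) + \<delta> a * d x"
    using d unfolding C_def klinear_diff[OF deriv_klinear[OF d]]
    by (simp add: deriv_on_def algebra_simps)
qed

text \<open>Leibniz rule: the commutator of \<open>\<delta>\<close> with \<open>a\<close> is
  multiplication by \<open>\<delta> a\<close>, which has zero commutator with \<open>a\<close>, so
  it arises from exactly one of \<open>k\<close> commutators. For \<open>k = 0\<close> the truncated
  \<open>k - 1\<close> meets the factor 0.\<close>

lemma C_power_deriv:
  assumes "deriv_on UNIV \<delta>"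
  shows "(C a ^^ k) (\<delta> \<circ> d) = (\<lambda>x. \<delta> ((C a ^^ k) d x) + (of_nat k * \<delta> a) * (C a ^^ (k - 1)) d x)"
proof (induction k)
  case (Suc k)
  have "(C a ^^ Suc k) (\<delta> \<circ> d)
     = C a (\<lambda>x. (\<delta> \<circ> (C a ^^ k) d) x + (of_nat k * \<delta> a) * (C a ^^ (k - 1)) d x)"
    by (simp add: Suc.IH)
  also have "\<dots> = (\<lambda>x. \<delta> (C a ((C a ^^ k) d) x) + \<delta> a * (C a ^^ k) d x
      + (of_nat k * \<delta> a) * C a ((C a ^^ (k - 1)) d) x)"
    unfolding C_add C_lmult C_deriv[OF assms] by simp
  finally have "(C a ^^ Suc k) (\<delta> \<circ> d) = \<dots>" .
  moreover have h: "(of_nat k * \<delta> a) * C a ((C a ^^ (k - 1)) d) x = (of_nat k * \<delta> a) * (C a ^^ k) d x" for x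
    by (cases k) auto
  ultimately have "(C a ^^ Suc k) (\<delta> \<circ> d)
      = (\<lambda>x. \<delta> ((C a ^^ Suc k) d x) + \<delta> a * (C a ^^ k) d x + (of_nat k * \<delta> a) * (C a ^^ k) d x)"
    unfolding h by simp
  also have "\<dots> = (\<lambda>x. \<delta> ((C a ^^ Suc k) d x) + (of_nat (Suc k) * \<delta> a) * (C a ^^ (Suc k - 1)) d x)"
    by (simp add: fun_eq_iff algebra_simps)
  finally show ?case .
qed (simp add: fun_eq_iff)

end

section \<open>Iterated commutators and symbols\<close>

context transc_basis
begin

text \<open>Commutators with different elements commute by \<open>C_commute\<close>, so the order of
  the indices is only a convention.\<close>

fun adp :: "nat \<Rightarrow> (nat \<Rightarrow> nat) \<Rightarrow> ('b \<Rightarrow> 'b) \<Rightarrow> 'b \<Rightarrow> 'b" where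
  "adp 0 \<beta> d = d"
| "adp (Suc m) \<beta> d = (C (xs ! m) ^^ \<beta> m) (adp m \<beta> d)"

text \<open>\<open>sig \<beta> d\<close> is \<open>\<beta>!\<close> times the coefficient of \<open>\<partial>\<^sup>\<beta>\<close> in \<open>d\<close>.\<close>
definition sig :: "(nat \<Rightarrow> nat) \<Rightarrow> ('b \<Rightarrow> 'b) \<Rightarrow> 'b" where
  "sig \<beta> d = adp n \<beta> d 1"

lemma adp_add: "adp m \<beta> (\<lambda>x. d x + e x) = (\<lambda>x. adp m \<beta> d x + adp m \<beta> e x)"
  by (induction m) (auto simp: C_power_add)

lemma adp_lmult: "adp m \<beta> (\<lambda>x. b * d x) = (\<lambda>x. b * adp m \<beta> d x)"
  by (induction m) (auto simp: C_power_lmult)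

lemma adp_C: "adp m \<beta> (C a d) = C a (adp m \<beta> d)"
  by (induction m) (auto simp: C_power_commute)

lemma adp_0 [simp]: "adp m (\<lambda>_. 0) d = d"
  by (induction m) auto

lemma adp_upd_above: "m \<le> i \<Longrightarrow> adp m (\<beta>(i := a)) d = adp m \<beta> d"
  by (induction m) auto

lemma adp_Suc_exponent: "i < m \<Longrightarrow> adp m (\<beta>(i := Suc (\<beta> i))) d = C (xs ! i) (adp m \<beta> d)"
proof (induction m)
  case (Suc m)
  then show ?case
    using adp_upd_above[of m m \<beta> "Suc (\<beta> m)" d]
    by (cases "i = m") (auto simp: C_power_commute simp del: fun_upd_apply, simp_all)
qed simp

text \<open>Only \<open>xs ! i\<close> has a nonzero derivative among the \<open>xs\<close>, so the
  correction term arises at stage \<open>i\<close> and is carried along afterwards.\<close>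

lemma adp_deriv:
  assumes "deriv_on UNIV \<delta>" "\<And>j. j < n \<Longrightarrow> \<delta> (xs ! j) = (if j = i then f else 0)" "i < n"
  shows "m \<le> n \<Longrightarrow> adp m \<beta> (\<delta> \<circ> d) = (if i < m
     then (\<lambda>x. (\<delta> \<circ> adp m \<beta> d) x + (of_nat (\<beta> i) * f) * adp m (\<beta>(i := \<beta> i - 1)) d x)
     else \<delta> \<circ> adp m \<beta> d)"
proof (induction m)
  case 0
  then show ?case by (simp add: fun_eq_iff)
next
  case (Suc m)
  let ?y = "xs ! m"
  have m: "m < n" using Suc by simp
  note IH = Suc.IH[OF Suc_leD[OF Suc.prems]]
  consider "m < i" | "m = i" | "i < m" by linarith
  then show ?case
  proof cases
    case 1
    then have "\<not> i < m" by simp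
    note eq = IH[unfolded if_not_P[OF this]]
    show ?thesis using 1 assms(2)[OF m]
      unfolding adp.simps eq C_power_deriv[OF assms(1)] by (simp add: comp_def)
  next
    case 2
    then have "\<not> i < m" by simp
    note eq = IH[unfolded if_not_P[OF this]]
    have eq2: "adp m (\<beta>(i := \<beta> i - 1)) d = adp m \<beta> d" by (rule adp_upd_above) (use 2 in simp)
    show ?thesis using 2 assms(2)[OF m]
      unfolding adp.simps eq eq2 C_power_deriv[OF assms(1)] by (simp add: comp_def)
  next
    case 3
    note eq = IH[unfolded if_P[OF 3]]
    show ?thesis using 3 assms(2)[OF m]
      unfolding adp.simps eq C_power_add C_power_lmult
      using C_power_deriv[OF assms(1), of "\<beta> m" ?y "adp m \<beta> d"] by (simp add: comp_def)
  qed
qed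

lemma adp_Ord: "d \<in> Ord k \<Longrightarrow> adp m \<beta> d \<in> Ord (k - int (\<Sum>i<m. \<beta> i))"
proof (induction m)
  case (Suc m)
  then show ?case
    using Ord_C_power[of "adp m \<beta> d" "k - int (\<Sum>i<m. \<beta> i)" "\<beta> m" "xs ! m"] by (simp add: algebra_simps)
qed simp

lemma sig_add: "sig \<beta> (d + e) = sig \<beta> d + sig \<beta> e"
  by (simp add: sig_def adp_add plus_fun_def)

lemma sig_lmult: "sig \<beta> (\<lambda>x. b * d x) = b * sig \<beta> d"
  by (simp add: sig_def adp_lmult)

lemma sig_scale: "sig \<beta> (end_scale \<phi> c d) = \<phi> c * sig \<beta> d"
  unfolding end_scale_def by (rule sig_lmult)

lemma sig_zero [simp]: "sig \<beta> 0 = 0"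
  using sig_scale[of \<beta> 0 0] by (simp add: end_scale_def zero_fun_def)

lemma sig_diff: "sig \<beta> (d - e) = sig \<beta> d - sig \<beta> e"
  using sig_add[of \<beta> "d - e" e] by simp

lemma sig_C: "i < n \<Longrightarrow> sig \<beta> (C (xs ! i) d) = sig (\<beta>(i := Suc (\<beta> i))) d"
  by (simp add: sig_def adp_C adp_Suc_exponent)

text \<open>In \<open>\<delta> \<circ> d\<close> the derivation either differentiates a coefficient
  or raises the power of the \<open>i\<close>-th partial derivative. The factor
  \<open>\<beta> i\<close> comes from the normalisation of \<open>sig\<close> by
  \<open>\<beta>!\<close>.\<close>

lemma sig_deriv:
  assumes "deriv_on UNIV \<delta>" "\<And>j. j < n \<Longrightarrow> \<delta> (xs ! j) = (if j = i then f else 0)" "i < n"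
  shows "sig \<beta> (\<delta> \<circ> d) = \<delta> (sig \<beta> d) + (of_nat (\<beta> i) * f) * sig (\<beta>(i := \<beta> i - 1)) d"
  using adp_deriv[OF assms, of n \<beta> d] assms(3) by (simp add: sig_def)

lemma sig_eq_0: "d \<in> diffops \<phi> m \<Longrightarrow> (\<Sum>i<n. \<beta> i) > m \<Longrightarrow> sig \<beta> d = 0"
proof -
  assume d: "d \<in> diffops \<phi> m" "(\<Sum>i<n. \<beta> i) > m"
  then have "adp n \<beta> d \<in> Ord (int m - int (\<Sum>i<n. \<beta> i))" by (intro adp_Ord) (simp add: Ord_def)
  moreover have "int m - int (\<Sum>i<n. \<beta> i) < 0" using d(2) by linarith
  ultimately show ?thesis unfolding Ord_def by (simp add: sig_def)
qed

definition box :: "nat \<Rightarrow> (nat \<Rightarrow> nat) set" where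
  "box h = {e \<in> Mon. \<forall>i. e i \<le> h}"

lemma finite_box: "finite (box h)" and card_box: "card (box h) \<le> (h + 1) ^ n"
proof -
  have inj: "inj_on (\<lambda>e. restrict e {..<n}) (box h)"
  proof (rule inj_onI)
    fix e e' assume *: "e \<in> box h" "e' \<in> box h" "restrict e {..<n} = restrict e' {..<n}"
    show "e = e'"
    proof
      fix i show "e i = e' i"
      proof (cases "i < n")
        case True
        then show ?thesis using fun_cong[OF *(3), of i] by simp
      qed (use * in \<open>auto simp: box_def Mon_def\<close>)
    qed
  qed
  have sub: "(\<lambda>e. restrict e {..<n}) ` box h \<subseteq> PiE {..<n} (\<lambda>_. {..h})"
    by (intro image_subsetI) (simp add: box_def restrict_PiE_iff)
  show "finite (box h)"
    by (rule inj_on_finite[OF inj sub]) (simp add: finite_PiE)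
  have "card (box h) \<le> card (PiE {..<n} (\<lambda>_. {..h}))"
    by (rule card_inj_on_le[OF inj sub]) (simp add: finite_PiE)
  then show "card (box h) \<le> (h + 1) ^ n" by (simp add: card_PiE)
qed

lemma sig_support:
  assumes "d \<in> diffops \<phi> m" shows "{\<beta> \<in> Mon. sig \<beta> d \<noteq> 0} \<subseteq> box m"
proof safe
  fix \<beta> assume b: "\<beta> \<in> Mon" "sig \<beta> d \<noteq> 0"
  then have le: "(\<Sum>i<n. \<beta> i) \<le> m" using sig_eq_0[OF assms, of \<beta>] by (meson not_le)
  have "\<beta> i \<le> m" for i
  proof (cases "i < n")
    case True
    then have "\<beta> i \<le> (\<Sum>i<n. \<beta> i)" by (intro member_le_sum) auto
    then show ?thesis using le by simp
  qed (use b in \<open>auto simp: Mon_def\<close>)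
  then show "\<beta> \<in> box m" using b by (simp add: box_def)
qed

end

section \<open>Symbols determine the operator\<close>

context affine_domain
begin

text \<open>An operator that commutes with \<open>P\<close> commutes with every \<open>b\<close>: otherwise some iterated
  commutator \<open>D\<close> satisfies \<open>C b D \<noteq> 0 = C b (C b D)\<close>, and applying \<open>D\<close> to \<open>Q(b) = 0\<close> gives
  \<open>Q'(b) * C b D = 0\<close>.\<close>
lemma commutes_with_P_imp_commutes:
  assumes d: "d \<in> DiffOps \<phi>" and comm: "\<And>p x. p \<in> P \<Longrightarrow> d (p * x) = p * d x"
  shows "C b d = (\<lambda>_. 0)"
proof (rule ccontr)
  assume ne: "C b d \<noteq> (\<lambda>_. 0)"
  obtain m where m: "d \<in> diffops \<phi> m" using d by (auto simp: DiffOps_def)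
  have "(C b ^^ Suc m) d = (\<lambda>_. 0)"
    using Ord_C_power[of d "int m" "Suc m" b] m by (simp add: Ord_def)
  then obtain j where j: "(C b ^^ j) d = (\<lambda>_. 0)" "\<And>i. i < j \<Longrightarrow> (C b ^^ i) d \<noteq> (\<lambda>_. 0)"
    using exists_least_iff[of "\<lambda>j. (C b ^^ j) d = (\<lambda>_. 0)"] by blast
  have "j \<noteq> 0" using j(1) ne by (intro notI) simp
  moreover have "j \<noteq> 1" using j(1) ne by (intro notI) simp
  ultimately obtain i where i: "j = Suc (Suc i)" by (metis One_nat_def not0_implies_Suc)
  define D where "D = (C b ^^ i) d"
  define D' where "D' = C b D"
  have D'0: "D' \<noteq> (\<lambda>_. 0)" using j(2)[of "Suc i"] i by (simp add: D'_def D_def)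
  have CD': "C b D' = (\<lambda>_. 0)" using j(1) i by (simp add: D'_def D_def)
  have kl: "klinear \<phi> ((C b ^^ k) d)" for k
  proof (induction k)
    case (Suc k)
    then show ?case using klinear_C by simp
  qed (use DiffOps_klinear[OF d] in simp)
  have com: "(C b ^^ k) d (p * x) = p * (C b ^^ k) d x" if "p \<in> P" for k p x
  proof (induction k arbitrary: x)
    case (Suc k)
    have step: "(C b ^^ Suc k) d y = (C b ^^ k) d (b * y) - b * (C b ^^ k) d y" for y
      unfolding funpow.simps comp_apply C_def[of b "(C b ^^ k) d"] by simp
    have "(C b ^^ Suc k) d (p * x) = (C b ^^ k) d (p * (b * x)) - b * (C b ^^ k) d (p * x)"
      unfolding step by (simp only: mult.left_commute)
    also have "\<dots> = p * (C b ^^ Suc k) d x"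
      unfolding Suc.IH step by (simp only: right_diff_distrib mult.left_commute)
    finally show ?case .
  qed (use comm that in simp)
  have D_add: "D (x + y) = D x + D y" and D'_add: "D' (x + y) = D' x + D' y" for x y
    using klinear_add[OF kl[of i]] klinear_add[OF kl[of "Suc i"]] by (auto simp: D_def D'_def)
  have D_P: "D (p * x) = p * D x" and D'_P: "D' (p * x) = p * D' x" if "p \<in> P" for p x
    using com[OF that, of i] com[OF that, of "Suc i"] by (auto simp: D_def D'_def)
  have D_b: "D (b * x) = b * D x + D' x" for x by (simp add: D'_def C_def)
  have D'_b: "D' (b * x) = b * D' x" for x using fun_cong[OF CD', of x] by (simp add: C_def)
  have D'_poly: "D' (poly Q b * x) = poly Q b * D' x" if "Q \<in> polys P" for Q x
    using that
  proof (induction Q arbitrary: x)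
    case 0
    then show ?case using D'_P[of 0 x] by simp
  next
    case (pCons a Q)
    have Q: "Q \<in> polys P" "a \<in> P"
      using pCons.prems by (auto simp: polys_def coeff_pCons split: nat.splits)
    have "D' (poly (pCons a Q) b * x) = D' (a * x + b * (poly Q b * x))" by (simp add: algebra_simps)
    then show ?case unfolding D'_add D'_P[OF Q(2)] D'_b pCons.IH[OF Q(1)] by (simp add: algebra_simps)
  qed
  \<comment> \<open>A Taylor formula in \<open>b\<close> that stops after the linear term, because
    \<open>D'\<close> commutes with \<open>b\<close>.\<close>
  have D_poly: "D (poly Q b * x) = poly Q b * D x + poly (pderiv Q) b * D' x" if "Q \<in> polys P" for Q x
    using that
  proof (induction Q arbitrary: x)
    case 0
    then show ?case using D_P[of 0 x] by simp
  next
    case (pCons a Q)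
    have Q: "Q \<in> polys P" "a \<in> P"
      using pCons.prems by (auto simp: polys_def coeff_pCons split: nat.splits)
    have "D (poly (pCons a Q) b * x) = D (a * x + b * (poly Q b * x))" by (simp add: algebra_simps)
    then show ?case unfolding D_add D_P[OF Q(2)] D_b pCons.IH[OF Q(1)] D'_poly[OF Q(1)]
      by (simp add: algebra_simps pderiv_pCons)
  qed
  obtain Q0 where "Q0 \<in> polys P" "Q0 \<noteq> 0" "poly Q0 b = 0" by (rule algebraic)
  then obtain Q where Q: "Q \<in> polys P" "poly Q b = 0" "degree Q > 0"
    and min: "\<And>R. R \<in> polys P \<Longrightarrow> R \<noteq> 0 \<Longrightarrow> poly R b = 0 \<Longrightarrow> degree Q \<le> degree R"
    using exists_minimal_poly by blast
  have "poly (pderiv Q) b \<noteq> 0"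
    using min[OF polys_pderiv[OF subalg_P Q(1)]] pderiv_degree_less[OF Q(3)] by force
  moreover have "poly (pderiv Q) b * D' x = 0" for x
    using D_poly[OF Q(1), of x] Q(2) D_P[of 0 x] by simp
  ultimately show False using D'0 by auto
qed

text \<open>Induction on the order. Commutators with the \<open>xs ! i\<close> have lower order and
  shifted symbols, so they vanish; then \<open>d\<close> commutes with \<open>P\<close>, hence with
  \<open>B\<close>, and is multiplication by \<open>d 1\<close>, its symbol at
  \<open>\<beta> = 0\<close>.\<close>

lemma sig_injective:
  assumes "d \<in> DiffOps \<phi>" "\<And>\<beta>. \<beta> \<in> Mon \<Longrightarrow> sig \<beta> d = 0"
  shows "d = (\<lambda>_. 0)"
proof -
  obtain m where "d \<in> diffops \<phi> m" using assms by (auto simp: DiffOps_def)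
  then show ?thesis using assms(2)
  proof (induction m arbitrary: d)
    case 0
    then have "d 1 = 0" using 0(2)[of "\<lambda>_. 0"] by (simp add: sig_def)
    moreover obtain a where "d = (\<lambda>x. a * x)" using diffops_0E[OF 0(1)] by blast
    ultimately show ?case by simp
  next
    case (Suc m)
    have kl: "klinear \<phi> d" using Suc.prems diffops_klinear by blast
    have dD: "d \<in> DiffOps \<phi>" using Suc.prems by (auto simp: DiffOps_def)
    have Cx: "C (xs ! i) d = (\<lambda>_. 0)" if "i < n" for i
    proof (rule Suc.IH)
      show "C (xs ! i) d \<in> diffops \<phi> m" using Suc.prems by (simp add: diffops_Suc)
      show "sig \<beta> (C (xs ! i) d) = 0" if "\<beta> \<in> Mon" for \<beta>
        unfolding sig_C[OF \<open>i < n\<close>]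
        by (rule Suc.prems) (use that \<open>i < n\<close> in \<open>auto simp: Mon_def\<close>)
    qed
    define Z where "Z = {p. \<forall>x. d (p * x) = p * d x}"
    have Z: "subalg Z"
      unfolding subalg_def Z_def using klinear_add[OF kl] klinear_scale[OF kl]
      by (auto simp: distrib_right mult.assoc)
    have xZ: "xs ! i \<in> Z" if "i < n" for i
      using fun_cong[OF Cx[OF that]] by (simp add: Z_def C_def)
    have XZ: "X e \<in> Z" for e
    proof -
      have "(\<Prod>i\<in>I. xs ! i ^ e i) \<in> Z" if "I \<subseteq> {..<n}" "finite I" for I
        using that(2,1) by induction (auto intro!: subalg_1[OF Z] subalg_mult[OF Z] subalg_power[OF Z] xZ)
      then show ?thesis by (simp add: X_def)
    qed
    have "P \<subseteq> Z"
    proof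
      fix p assume "p \<in> P"
      then show "p \<in> Z" unfolding P_def
        by (induction rule: B.span_induct_alt)
           (auto intro!: subalg_0[OF Z] subalg_add[OF Z] subalg_mult[OF Z] subalg_phi[OF Z] XZ)
    qed
    then have "C b d = (\<lambda>_. 0)" for b
      by (intro commutes_with_P_imp_commutes[OF dD]) (auto simp: Z_def)
    from fun_cong[OF this, of _ 1] have "d (b * 1) - b * d 1 = 0" for b unfolding C_def .
    then have "d b = b * d 1" for b unfolding mult_1_right eq_iff_diff_eq_0[symmetric] .
    moreover have "d 1 = 0" using Suc.prems(2)[of "\<lambda>_. 0"] by (simp add: sig_def)
    ultimately have "d b = 0" for b by (metis mult_zero_right)
    then show ?case by blast
  qed
qed

end

section \<open>Leading terms of differential operators and the isoperimetric inequality in D(B)\<close>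

locale diffop_algebra = affine_domain \<phi> xs n + enumerated_algebra \<phi> xs n g
  for \<phi> :: "'k::field_char_0 \<Rightarrow> 'b::idom" and xs n g
begin

definition is_top :: "('b \<Rightarrow> 'b) \<Rightarrow> (nat \<Rightarrow> nat) \<Rightarrow> bool" where
  "is_top d \<beta> \<longleftrightarrow> \<beta> \<in> Mon \<and> sig \<beta> d \<noteq> 0 \<and> (\<forall>\<gamma>\<in>Mon. lexlt \<beta> \<gamma> \<longrightarrow> sig \<gamma> d = 0)"

definition dtop :: "('b \<Rightarrow> 'b) \<Rightarrow> nat \<Rightarrow> nat" where "dtop d = (SOME \<beta>. is_top d \<beta>)"

lemma is_top_unique: "is_top d \<beta> \<Longrightarrow> is_top d \<beta>' \<Longrightarrow> \<beta> = \<beta>'"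
  unfolding is_top_def using lexlt_total by metis

lemma top_eqI: "is_top d \<beta> \<Longrightarrow> dtop d = \<beta>"
  unfolding dtop_def using is_top_unique someI by metis

lemma is_top_top: assumes "d \<in> DiffOps \<phi>" "d \<noteq> 0" shows "is_top d (dtop d)"
proof -
  obtain m where "d \<in> diffops \<phi> m" using assms by (auto simp: DiffOps_def)
  then have "finite {\<beta> \<in> Mon. sig \<beta> d \<noteq> 0}"
    using sig_support finite_box finite_subset by blast
  moreover have "{\<beta> \<in> Mon. sig \<beta> d \<noteq> 0} \<noteq> {}"
    using sig_injective[OF assms(1)] assms(2) by (auto simp: zero_fun_def)
  ultimately obtain \<beta> where \<beta>: "\<beta> \<in> {\<beta> \<in> Mon. sig \<beta> d \<noteq> 0}"
    "\<And>\<gamma>. \<gamma> \<in> {\<beta> \<in> Mon. sig \<beta> d \<noteq> 0} \<Longrightarrow> \<gamma> \<noteq> \<beta> \<Longrightarrow> lexlt \<gamma> \<beta>"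
    by (rule finite_lexmax) blast
  have "sig \<gamma> d = 0" if "\<gamma> \<in> Mon" "lexlt \<beta> \<gamma>" for \<gamma>
  proof (rule ccontr)
    assume ne: "sig \<gamma> d \<noteq> 0"
    have "\<gamma> \<noteq> \<beta>" using that lexlt_irrefl by metis
    then have "lexlt \<gamma> \<beta>" using \<beta>(2) that ne by simp
    then show False using that lexlt_trans lexlt_irrefl by metis
  qed
  then have "is_top d \<beta>" using \<beta>(1) by (simp add: is_top_def)
  then show ?thesis using top_eqI by metis
qed

lemma is_top_nonzero: "is_top d \<beta> \<Longrightarrow> d \<noteq> 0"
  by (auto simp: is_top_def)

definition leadD :: "('b \<Rightarrow> 'b) \<Rightarrow> (nat \<Rightarrow> nat) \<times> nat \<times> (nat \<Rightarrow> int)" where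
  "leadD d = (dtop d, leadB (sig (dtop d) d))"

definition ltD :: "(nat \<Rightarrow> nat) \<times> nat \<times> (nat \<Rightarrow> int) \<Rightarrow> (nat \<Rightarrow> nat) \<times> nat \<times> (nat \<Rightarrow> int) \<Rightarrow> bool" where
  "ltD s t \<longleftrightarrow> lexlt (fst s) (fst t) \<or> fst s = fst t \<and> ltB (snd s) (snd t)"

lemma leadD_eqI: "is_top d \<beta> \<Longrightarrow> leadD d = (\<beta>, leadB (sig \<beta> d))"
  using top_eqI by (simp add: leadD_def)

text \<open>A lexicographic product of \<open>\<beta>\<close> with the leading terms of
  \<open>B\<close>. One-dimensional leaves are inherited: the scalar that lowers the top symbol
  lowers the operator.\<close>

sublocale LD: leading "end_scale \<phi>" "DiffOps \<phi>" ltD leadD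
proof
  show "E.subspace (DiffOps \<phi>)" by (rule subspace_DiffOps)
  show "\<not> ltD s s" for s by (simp add: ltD_def lexlt_irrefl ltB_irrefl)
  show "ltD s u" if "ltD s t" "ltD t u" for s t u
    using that lexlt_trans[of "fst s" "fst t" "fst u"] ltB_trans[of "snd s" "snd t" "snd u"]
    unfolding ltD_def by auto
  show "ltD s t \<or> ltD t s" if "s \<noteq> t" for s t
    using that lexlt_total[of "fst s" "fst t"] ltB_total[of "snd s" "snd t"]
    unfolding ltD_def by (metis prod.collapse)
  show "leadD (end_scale \<phi> c v) = leadD v" if v: "v \<in> DiffOps \<phi>" "v \<noteq> 0" and c: "c \<noteq> 0" for v c
  proof -
    note top = is_top_top[OF v]
    then have "is_top (end_scale \<phi> c v) (dtop v)" using c by (simp add: is_top_def sig_scale)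
    then have "leadD (end_scale \<phi> c v) = (dtop v, leadB (sig (dtop v) (end_scale \<phi> c v)))" by (rule leadD_eqI)
    then show ?thesis using top c by (simp add: sig_scale leadB_scale leadD_def is_top_def)
  qed
  show "v + w \<noteq> 0 \<and> leadD (v + w) = leadD w"
    if v: "v \<in> DiffOps \<phi>" "v \<noteq> 0" and w: "w \<in> DiffOps \<phi>" "w \<noteq> 0" and lt: "ltD (leadD v) (leadD w)"
    for v w
  proof -
    have "w \<in> DiffOps \<phi>" "v \<in> DiffOps \<phi>" using v w by auto
    note tv = is_top_top[OF v] and tw = is_top_top[OF w]
    let ?\<beta> = "dtop w"
    have "lexlt (dtop v) ?\<beta> \<or> dtop v = ?\<beta> \<and> ltB (leadB (sig (dtop v) v)) (leadB (sig ?\<beta> w))"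
      using lt by (simp add: ltD_def leadD_def)
    then have "is_top (v + w) ?\<beta> \<and> leadB (sig ?\<beta> (v + w)) = leadB (sig ?\<beta> w)"
    proof
      assume less: "lexlt (dtop v) ?\<beta>"
      then have "sig \<gamma> v = 0" if "\<gamma> \<in> Mon" "lexlt ?\<beta> \<gamma>" for \<gamma>
        using tv that lexlt_trans[OF less] by (auto simp: is_top_def)
      moreover have "sig ?\<beta> v = 0" using tv tw less by (auto simp: is_top_def)
      ultimately show ?thesis using tw by (auto simp: is_top_def sig_add)
    next
      assume *: "dtop v = ?\<beta> \<and> ltB (leadB (sig (dtop v) v)) (leadB (sig ?\<beta> w))"
      then have "sig ?\<beta> v + sig ?\<beta> w \<noteq> 0 \<and> leadB (sig ?\<beta> v + sig ?\<beta> w) = leadB (sig ?\<beta> w)"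
        using tv tw by (intro leadB_add) (auto simp: is_top_def)
      moreover have "sig \<gamma> v = 0" if "\<gamma> \<in> Mon" "lexlt ?\<beta> \<gamma>" for \<gamma>
        using tv that * by (auto simp: is_top_def)
      ultimately show ?thesis using tw by (auto simp: is_top_def sig_add)
    qed
    then show ?thesis using leadD_eqI is_top_nonzero by (metis leadD_def)
  qed
  show "\<exists>c. v - end_scale \<phi> c w = 0 \<or> ltD (leadD (v - end_scale \<phi> c w)) (leadD v)"
    if v: "v \<in> DiffOps \<phi>" "v \<noteq> 0" and w: "w \<in> DiffOps \<phi>" "w \<noteq> 0" and eq: "leadD v = leadD w"
    for v w
  proof -
    note tv = is_top_top[OF v] and tw = is_top_top[OF w]
    let ?\<beta> = "dtop v"
    have top_eq: "dtop w = ?\<beta>" and B_eq: "leadB (sig ?\<beta> v) = leadB (sig ?\<beta> w)"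
      using eq by (auto simp: leadD_def)
    obtain c where c: "sig ?\<beta> v - \<phi> c * sig ?\<beta> w = 0 \<or>
        ltB (leadB (sig ?\<beta> v - \<phi> c * sig ?\<beta> w)) (leadB (sig ?\<beta> v))"
      using leadB_cancel[OF _ _ B_eq] tv tw top_eq by (auto simp: is_top_def)
    let ?u = "v - end_scale \<phi> c w"
    have sig_u: "sig \<gamma> ?u = sig \<gamma> v - \<phi> c * sig \<gamma> w" for \<gamma> by (simp add: sig_diff sig_scale)
    have above: "sig \<gamma> ?u = 0" if "\<gamma> \<in> Mon" "lexlt ?\<beta> \<gamma>" for \<gamma>
      using tv tw that top_eq by (auto simp: sig_u is_top_def)
    have uD: "?u \<in> DiffOps \<phi>"
      by (intro E.subspace_diff[OF subspace_DiffOps] E.subspace_scale[OF subspace_DiffOps] v w)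
    \<comment> \<open>Either the symbol at \<open>?\<beta>\<close> disappears and the top index
      drops, or the index stays and the leading term of its symbol drops.\<close>
    have "ltD (leadD ?u) (leadD v)" if u0: "?u \<noteq> 0"
    proof (cases "sig ?\<beta> ?u = 0")
      case True
      note tu = is_top_top[OF uD u0]
      then have "dtop ?u \<noteq> ?\<beta>" "\<not> lexlt ?\<beta> (dtop ?u)" using True above by (auto simp: is_top_def)
      then have "lexlt (dtop ?u) ?\<beta>" using lexlt_total by blast
      then show ?thesis by (simp add: ltD_def leadD_def)
    next
      case False
      then have "is_top ?u ?\<beta>" using above tv by (auto simp: is_top_def)
      then have "leadD ?u = (?\<beta>, leadB (sig ?\<beta> ?u))" by (rule leadD_eqI)
      moreover have "ltB (leadB (sig ?\<beta> ?u)) (leadB (sig ?\<beta> v))" using c False by (simp add: sig_u)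
      ultimately show ?thesis by (simp add: ltD_def leadD_def)
    qed
    then show ?thesis by blast
  qed
qed

text \<open>Every symbol is multiplied by \<open>xs ! i\<close>, so the top index stays and the
  exponent moves by a unit vector.\<close>

lemma leadD_mult_op:
  assumes d: "d \<in> DiffOps \<phi>" "d \<noteq> 0" and i: "i < n"
    and lead: "leadD d = (\<beta>, j, \<alpha>)"
  shows "(\<lambda>x. xs ! i * x) \<circ> d \<noteq> 0" "leadD ((\<lambda>x. xs ! i * x) \<circ> d) = (\<beta>, j, \<alpha>(i := \<alpha> i + 1))"
proof -
  note top = is_top_top[OF d]
  have x: "xs ! i \<in> P" "xs ! i \<noteq> 0"
    using P_x[OF i] lm_x[OF i] has_lm_nonzero i X_unit[OF i]
      X_notin_below[of "(\<lambda>_. 0)(i := Suc 0)"] by (auto simp: Mon_def)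
  have sig: "sig \<gamma> ((\<lambda>x. xs ! i * x) \<circ> d) = xs ! i * sig \<gamma> d" for \<gamma>
    using sig_lmult[of \<gamma> "xs ! i" d] by (simp add: comp_def)
  have top': "is_top ((\<lambda>x. xs ! i * x) \<circ> d) (dtop d)"
    using top x unfolding is_top_def sig by simp
  then show "(\<lambda>x. xs ! i * x) \<circ> d \<noteq> 0" by (rule is_top_nonzero)
  have "leadB (xs ! i * sig (dtop d) d)
      = (jdx (sig (dtop d) d), \<lambda>l. expo (sig (dtop d) d) l + int (lm (xs ! i) l))"
    by (rule leadB_mult) (use top x in \<open>auto simp: is_top_def\<close>)
  then show "leadD ((\<lambda>x. xs ! i * x) \<circ> d) = (\<beta>, j, \<alpha>(i := \<alpha> i + 1))"
    unfolding leadD_eqI[OF top'] sig using lead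
    by (auto simp: leadD_def leadB_def lm_x[OF i])
qed

text \<open>One unit above the top index in direction \<open>i\<close> the symbol of
  \<open>d\<close> is 0, so only the second term of \<open>sig_deriv\<close> survives there, with
  the factor \<open>\<beta> i + 1\<close>, nonzero in characteristic zero. The exponent drifts by
  \<open>lm f\<close>, which \<open>point\<close> compensates.\<close>

lemma leadD_deriv:
  assumes \<delta>: "deriv_on UNIV \<delta>" "\<And>j. j < n \<Longrightarrow> \<delta> (xs ! j) = (if j = i then f else 0)"
    and f: "f \<in> P" "f \<noteq> 0"
    and d: "d \<in> DiffOps \<phi>" "d \<noteq> 0" and i: "i < n"
    and lead: "leadD d = (\<beta>, j, \<alpha>)"
  shows "\<delta> \<circ> d \<noteq> 0" "leadD (\<delta> \<circ> d) = (\<beta>(i := \<beta> i + 1), j, \<lambda>l. \<alpha> l + int (lm f l))"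
proof -
  note top = is_top_top[OF d]
  have tb: "dtop d = \<beta>" using lead by (simp add: leadD_def)
  note topb = top[unfolded tb]
  have sig: "sig \<gamma> (\<delta> \<circ> d) = \<delta> (sig \<gamma> d) + (of_nat (\<gamma> i) * f) * sig (\<gamma>(i := \<gamma> i - 1)) d" for \<gamma>
    by (rule sig_deriv) (use \<delta> i in auto)
  have \<delta>0: "\<delta> 0 = 0" using klinear_0[OF deriv_klinear[OF \<delta>(1)]] .
  let ?\<beta> = "\<beta>(i := \<beta> i + 1)" and ?c = "of_nat (\<beta> i + 1) * f"
  have below: "lexlt \<beta> ?\<beta>" by (auto simp: lexlt_def intro!: exI[of _ i])
  have M: "?\<beta> \<in> Mon" using topb i by (auto simp: is_top_def Mon_def)
  have sig_top: "sig ?\<beta> (\<delta> \<circ> d) = ?c * sig \<beta> d"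
    using topb M below unfolding sig by (simp add: is_top_def \<delta>0)
  have c: "?c \<in> P" "?c \<noteq> 0" "lm ?c = lm f"
  proof -
    have oc: "of_nat (\<beta> i + 1) = \<phi> (of_nat (\<beta> i + 1))" by (simp only: phi_of_nat)
    show "?c \<in> P" unfolding oc by (rule P_scale[OF f(1)])
    show "?c \<noteq> 0" using f by (simp del: of_nat_add of_nat_Suc)
    show "lm ?c = lm f" unfolding oc using lm_mult[OF P_phi f(1) _ f(2)]
      by (simp add: lm_phi del: of_nat_add of_nat_Suc)
  qed
  have "sig \<gamma> (\<delta> \<circ> d) = 0" if g: "\<gamma> \<in> Mon" "lexlt ?\<beta> \<gamma>" for \<gamma>
  proof -
    have 1: "sig \<gamma> d = 0" using topb g lexlt_trans[OF below g(2)] by (simp add: is_top_def)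
    \<comment> \<open>An index above \<open>?\<beta>\<close> stays above \<open>\<beta>\<close> when
      one unit is taken off in direction \<open>i\<close>.\<close>
    have 2: "of_nat (\<gamma> i) * sig (\<gamma>(i := \<gamma> i - 1)) d = 0"
    proof (cases "\<gamma> i = 0")
      case False
      let ?e = "(\<lambda>_. 0)(i := Suc 0)"
      have "(\<lambda>l. ?e l + \<beta> l) = ?\<beta>" "(\<lambda>l. ?e l + (\<gamma>(i := \<gamma> i - 1)) l) = \<gamma>" using False by auto
      then have "lexlt \<beta> (\<gamma>(i := \<gamma> i - 1))" using g(2) lexlt_add_left[of ?e \<beta> "\<gamma>(i := \<gamma> i - 1)"] by metis
      moreover have "\<gamma>(i := \<gamma> i - 1) \<in> Mon" using g by (auto simp: Mon_def)
      ultimately show ?thesis using topb by (simp add: is_top_def)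
    qed simp
    have "sig \<gamma> (\<delta> \<circ> d) = f * (of_nat (\<gamma> i) * sig (\<gamma>(i := \<gamma> i - 1)) d)"
      unfolding sig 1 \<delta>0 by simp
    then show ?thesis unfolding 2 by simp
  qed
  moreover have "sig ?\<beta> (\<delta> \<circ> d) \<noteq> 0" unfolding sig_top using c topb by (simp only: is_top_def mult_eq_0_iff) simp
  ultimately have top': "is_top (\<delta> \<circ> d) ?\<beta>" using M by (simp only: is_top_def) blast
  then show "\<delta> \<circ> d \<noteq> 0" by (rule is_top_nonzero)
  have "leadB (?c * sig \<beta> d) = (jdx (sig \<beta> d), \<lambda>l. expo (sig \<beta> d) l + int (lm f l))"
    unfolding c(3)[symmetric] by (rule leadB_mult) (use topb c in \<open>auto simp only: is_top_def\<close>)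
  moreover have "(jdx (sig \<beta> d), expo (sig \<beta> d)) = (j, \<alpha>)" using lead tb by (simp add: leadD_def leadB_def)
  ultimately show "leadD (\<delta> \<circ> d) = (?\<beta>, j, \<lambda>l. \<alpha> l + int (lm f l))"
    unfolding leadD_eqI[OF top'] sig_top by simp
qed

lemma leadD_support:
  assumes "d \<in> DiffOps \<phi>" "d \<noteq> 0" "leadD d = (\<beta>, j, \<alpha>)"
  shows "\<beta> \<in> Mon" "\<And>l. l \<ge> n \<Longrightarrow> \<alpha> l = 0"
  using is_top_top[OF assms(1,2)] assms(3) expo_outside[of "sig (dtop d) d"]
  by (auto simp: leadD_def leadB_def is_top_def)

text \<open>Leading terms as lattice points: coordinates \<open>0, \<dots>, n - 1\<close> carry \<open>\<beta>\<close>, coordinates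
  \<open>n, \<dots>, 2 n - 1\<close> carry \<open>\<alpha>\<close>, sheared so that left multiplication by \<open>\<delta> i\<close> is a unit step,
  and coordinate \<open>2 n\<close> carries \<open>j\<close>.\<close>
definition point :: "(nat \<Rightarrow> 'b) \<Rightarrow> (nat \<Rightarrow> nat) \<times> nat \<times> (nat \<Rightarrow> int) \<Rightarrow> nat \<Rightarrow> int" where
  "point f = (\<lambda>(\<beta>, j, \<alpha>) i. if i < n then int (\<beta> i)
     else if i < 2 * n then \<alpha> (i - n) - (\<Sum>l<n. int (\<beta> l) * int (lm (f l) (i - n)))
     else if i = 2 * n then int j else 0)"

text \<open>The shear is invertible: \<open>\<beta>\<close> is read off first and then determines
  the correction in the coordinates of \<open>\<alpha>\<close>.\<close>

lemma point_inj:
  assumes "point f (\<beta>, j, \<alpha>) = point f (\<beta>', j', \<alpha>')" "\<beta> \<in> Mon" "\<beta>' \<in> Mon"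
    "\<And>l. l \<ge> n \<Longrightarrow> \<alpha> l = 0" "\<And>l. l \<ge> n \<Longrightarrow> \<alpha>' l = 0"
  shows "(\<beta>, j, \<alpha>) = (\<beta>', j', \<alpha>')"
proof -
  have eq: "point f (\<beta>, j, \<alpha>) i = point f (\<beta>', j', \<alpha>') i" for i using assms(1) by simp
  have "\<beta> l = \<beta>' l" for l
  proof (cases "l < n")
    case True
    then show ?thesis using eq[of l] by (simp add: point_def)
  qed (use assms in \<open>auto simp: Mon_def\<close>)
  then have \<beta>: "\<beta> = \<beta>'" by blast
  have "\<alpha> l = \<alpha>' l" for l
  proof (cases "l < n")
    case True
    then show ?thesis using eq[of "n + l"] by (simp add: point_def \<beta>)
  qed (use assms in auto)
  moreover have "j = j'" using eq[of "2 * n"] by (simp add: point_def)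
  ultimately show ?thesis using \<beta> by blast
qed

lemma point_alpha_step:
  assumes "i < n"
  shows "point f (\<beta>, j, \<alpha>(i := \<alpha> i + 1)) = (point f (\<beta>, j, \<alpha>))(n + i := point f (\<beta>, j, \<alpha>) (n + i) + 1)"
  using assms by (auto simp: point_def fun_eq_iff)

text \<open>The sum subtracted in \<open>point\<close> grows by \<open>lm (f i)\<close>, exactly the
  drift of \<open>\<alpha>\<close>.\<close>

lemma point_beta_step:
  assumes "i < n"
  shows "point f (\<beta>(i := \<beta> i + 1), j, \<lambda>l. \<alpha> l + int (lm (f i) l))
    = (point f (\<beta>, j, \<alpha>))(i := point f (\<beta>, j, \<alpha>) i + 1)"
proof -
  have "(\<Sum>l<n. int ((\<beta>(i := \<beta> i + 1)) l) * int (lm (f l) k))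
      = (\<Sum>l<n. int (\<beta> l) * int (lm (f l) k)) + int (lm (f i) k)" for k
  proof -
    have "(\<Sum>l<n. int ((\<beta>(i := \<beta> i + 1)) l) * int (lm (f l) k))
       = (\<Sum>l<n. int (\<beta> l) * int (lm (f l) k) + (if l = i then int (lm (f i) k) else 0))"
      by (rule sum.cong) (auto simp: algebra_simps)
    also have "\<dots> = (\<Sum>l<n. int (\<beta> l) * int (lm (f l) k)) + int (lm (f i) k)"
      using assms by (simp add: sum.distrib)
    finally show ?thesis .
  qed
  then show ?thesis using assms by (auto simp: point_def fun_eq_iff)
qed

text \<open>Composition is linear in the left factor by definition; in the right factor this rests
  on the linearity of differential operators.\<close>

lemma fin_dim_prodsp:
  assumes "E.fin_dim V" "E.fin_dim W" "W \<subseteq> DiffOps \<phi>" "V \<subseteq> DiffOps \<phi>"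
  shows "E.fin_dim (prodsp (end_scale \<phi>) (\<circ>) V W)"
proof -
  obtain A where A: "finite A" "A \<subseteq> V" "V \<subseteq> E.span A" using assms(1) by (rule E.fin_dim_basis)
  obtain A' where A': "finite A'" "A' \<subseteq> W" "W \<subseteq> E.span A'" using assms(2) by (rule E.fin_dim_basis)
  let ?S = "(\<lambda>(v, w). v \<circ> w) ` (A \<times> A')"
  have lin1: "v \<circ> w \<in> E.span ?S" if "v \<in> A" "w \<in> E.span A'" for v w
    using that(2)
  proof (induction rule: E.span_induct_alt)
    case base
    have "v \<circ> 0 = 0"
      using klinear_0[OF DiffOps_klinear] that(1) A(2) assms(4) by (auto simp: fun_eq_iff)
    then show ?case using E.span_zero by metis
  next
    case (step c a y)
    have kl: "klinear \<phi> v" using DiffOps_klinear that(1) A(2) assms(4) by blast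
    have "v \<circ> (end_scale \<phi> c a + y) = end_scale \<phi> c (v \<circ> a) + (v \<circ> y)"
      using klinear_add[OF kl] klinear_scale[OF kl] by (auto simp: end_scale_def fun_eq_iff)
    moreover have "v \<circ> a \<in> E.span ?S" using step(1) that(1) by (intro E.span_base) auto
    ultimately show ?case using E.span_add[OF E.span_scale step(2)] by metis
  qed
  have lin2: "v \<circ> w \<in> E.span ?S" if "v \<in> E.span A" "w \<in> E.span A'" for v w
    using that(1)
  proof (induction rule: E.span_induct_alt)
    case base
    have "0 \<circ> w = 0" by (auto simp: fun_eq_iff)
    then show ?case using E.span_zero by metis
  next
    case (step c a y)
    have "(end_scale \<phi> c a + y) \<circ> w = end_scale \<phi> c (a \<circ> w) + (y \<circ> w)"
      by (auto simp: end_scale_def fun_eq_iff)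
    then show ?case using E.span_add[OF E.span_scale[OF lin1[OF step(1) that(2)]] step(2)] by metis
  qed
  have "prodsp (end_scale \<phi>) (\<circ>) V W \<subseteq> E.span ?S"
    unfolding prodsp_def
  proof (rule E.span_minimal)
    show "{v \<circ> w | v w. v \<in> V \<and> w \<in> W} \<subseteq> E.span ?S" using lin2 A(3) A'(3) by blast
  qed simp
  then show ?thesis unfolding E.fin_dim_def using A(1) A'(1) by (intro exI[of _ ?S]) auto
qed

lemma prodsp_subset_DiffOps:
  assumes "V \<subseteq> DiffOps \<phi>" "W \<subseteq> DiffOps \<phi>"
  shows "prodsp (end_scale \<phi>) (\<circ>) V W \<subseteq> DiffOps \<phi>"
  unfolding prodsp_def
  by (rule E.span_minimal[OF _ subspace_DiffOps]) (use assms DiffOps_comp in auto)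

lemma comp_in_prodsp: "v \<in> V \<Longrightarrow> w \<in> W \<Longrightarrow> v \<circ> w \<in> prodsp (end_scale \<phi>) (\<circ>) V W"
  unfolding prodsp_def by (rule E.span_base) auto

lemma subspace_prodsp: "E.subspace (prodsp (end_scale \<phi>) (\<circ>) V W)"
  unfolding prodsp_def by simp

lemma fd_iff: "fd_subspace (end_scale \<phi>) A W \<longleftrightarrow> E.subspace W \<and> W \<subseteq> A \<and> E.fin_dim W"
  by (rule fd_subspace_iff) (rule E.vector_space_axioms)

theorem exists_VDI:
  assumes n: "n > 0"
  obtains V where "subframe (end_scale \<phi>) id (DiffOps \<phi>) V"
    "VDI (end_scale \<phi>) (\<circ>) (DiffOps \<phi>) V (2 * real n)"
proof -
  have "\<forall>i<n. \<exists>\<delta> f. deriv_on UNIV \<delta> \<and> f \<in> P \<and> f \<noteq> 0 \<and> (\<forall>j<n. \<delta> (xs ! j) = (if j = i then f else 0))"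
    using derivation_exists by metis
  then obtain \<delta> f where \<delta>: "\<And>i. i < n \<Longrightarrow> deriv_on UNIV (\<delta> i)"
    "\<And>i j. i < n \<Longrightarrow> j < n \<Longrightarrow> \<delta> i (xs ! j) = (if j = i then f i else 0)"
    and f: "\<And>i. i < n \<Longrightarrow> f i \<in> P" "\<And>i. i < n \<Longrightarrow> f i \<noteq> 0" by metis
  \<comment> \<open>\<open>id\<close> puts \<open>W\<close> inside \<open>V W\<close>; the other
    operators supply a unit step in each of the first \<open>2 * n\<close> coordinates.\<close>
  define G where "G = insert id ((\<lambda>i x. xs ! i * x) ` {..<n} \<union> \<delta> ` {..<n})"
  define V where "V = E.span G"
  have G: "finite G" "G \<subseteq> DiffOps \<phi>"
    using id_DiffOps mult_op_DiffOps deriv_DiffOps \<delta>(1) by (auto simp: G_def)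
  have V: "V \<subseteq> DiffOps \<phi>" "E.fin_dim V" "G \<subseteq> V"
    using E.span_minimal[OF G(2) subspace_DiffOps] G(1)
    by (auto simp: V_def E.fin_dim_def intro: E.span_base)
  have "subframe (end_scale \<phi>) id (DiffOps \<phi>) V"
    unfolding subframe_def fd_iff using V by (auto simp: V_def G_def)
  moreover have "VDI (end_scale \<phi>) (\<circ>) (DiffOps \<phi>) V (2 * real n)"
    unfolding VDI_def
  \<comment> \<open>The constant 1: each line counted by the large projection contributes at least
    one new lattice point.\<close>
  proof (intro exI[of _ 1] conjI allI impI)
    fix W assume "fd_subspace (end_scale \<phi>) (DiffOps \<phi>) W \<and> W \<noteq> {0}"
    then have W: "E.subspace W" "W \<subseteq> DiffOps \<phi>" "E.fin_dim W" "W \<noteq> {0}" by (auto simp: fd_iff)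
    define U where "U = prodsp (end_scale \<phi>) (\<circ>) V W"
    have U: "E.subspace U" "U \<subseteq> DiffOps \<phi>" "E.fin_dim U"
      using subspace_prodsp prodsp_subset_DiffOps[OF V(1) W(2)] fin_dim_prodsp[OF V(2) W(3,2) V(1)]
      by (auto simp: U_def)
    have comp: "v \<circ> w \<in> U" if "v \<in> G" "w \<in> W" for v w
      unfolding U_def using that V(3) by (intro comp_in_prodsp) auto
    have WU: "W \<subseteq> U"
    proof
      fix w assume "w \<in> W"
      then have "id \<circ> w \<in> U" by (intro comp) (auto simp: G_def)
      then show "w \<in> U" by simp
    qed
    define pt where "pt d = point f (leadD d)" for d
    have inj: "inj_on (point f) (leadD ` (U - {0}))"
    proof (rule inj_onI, elim imageE)
      fix s t u v assume uv: "s = leadD u" "u \<in> U - {0}" "t = leadD v" "v \<in> U - {0}"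
        and eq: "point f s = point f t"
      obtain \<beta> j \<alpha> where s: "leadD u = (\<beta>, j, \<alpha>)" by (cases "leadD u") auto
      obtain \<beta>' j' \<alpha>' where t: "leadD v = (\<beta>', j', \<alpha>')" by (cases "leadD v") auto
      have uvD: "u \<in> DiffOps \<phi>" "u \<noteq> 0" "v \<in> DiffOps \<phi>" "v \<noteq> 0" using uv U by auto
      have "(\<beta>, j, \<alpha>) = (\<beta>', j', \<alpha>')"
        by (rule point_inj[of f])
          (use eq uv s t leadD_support[OF uvD(1,2) s] leadD_support[OF uvD(3,4) t] in auto)
      then show "s = t" using uv s t by simp
    qed
    define S T where "S = pt ` (W - {0})" and "T = pt ` (U - {0})"
    have dimW: "E.dim W = card S"
    proof -
      have "inj_on (point f) (leadD ` (W - {0}))" by (rule inj_on_subset[OF inj]) (use WU in auto)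
      then show ?thesis
        using LD.dim_eq_card_lead(2)[OF W(1-3)] by (simp add: S_def pt_def card_image flip: image_image)
    qed
    have dimU: "E.dim U = card T"
      using LD.dim_eq_card_lead(2)[OF U] inj by (simp add: T_def pt_def card_image flip: image_image)
    have finT: "finite T"
      using LD.dim_eq_card_lead(1)[OF U] by (simp add: T_def pt_def flip: image_image)
    have ST: "S \<subseteq> T" using WU by (auto simp: S_def T_def)
    have S0: "S \<noteq> {}" using W(1,4) E.subspace_0 by (auto simp: S_def)
    have step: "s(i := s i + 1) \<in> T" if s: "s \<in> S" and i: "i < 2 * n" for s i
    proof -
      obtain w where w: "w \<in> W" "w \<noteq> 0" "s = pt w" using s by (auto simp: S_def)
      obtain \<beta> j \<alpha> where l: "leadD w = (\<beta>, j, \<alpha>)" by (cases "leadD w") auto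
      have wD: "w \<in> DiffOps \<phi>" using w W by auto
      show ?thesis
      proof (cases "i < n")
        case True
        have ld: "\<delta> i \<circ> w \<noteq> 0"
          "leadD (\<delta> i \<circ> w) = (\<beta>(i := \<beta> i + 1), j, \<lambda>l. \<alpha> l + int (lm (f i) l))"
          by (rule leadD_deriv[of "\<delta> i" i "f i"]; use \<delta> f wD w(2) True l in simp)+
        have "pt (\<delta> i \<circ> w) = s(i := s i + 1)"
          unfolding pt_def ld(2) w(3) l by (rule point_beta_step[OF True])
        moreover have "\<delta> i \<circ> w \<in> U" using True w by (intro comp) (auto simp: G_def)
        ultimately show ?thesis using ld(1) by (auto simp: T_def intro!: image_eqI[of _ _ "\<delta> i \<circ> w"])
      next
        case False
        define k where "k = i - n"
        have k: "k < n" "i = n + k" using False i by (auto simp: k_def)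
        note ld = leadD_mult_op[OF wD w(2) k(1) l]
        have "pt ((\<lambda>x. xs ! k * x) \<circ> w) = s(i := s i + 1)"
          unfolding pt_def ld(2) w(3) l k(2) by (rule point_alpha_step[OF k(1)])
        moreover have "(\<lambda>x. xs ! k * x) \<circ> w \<in> U" using k w by (intro comp) (auto simp: G_def)
        ultimately show ?thesis
          using ld(1) by (auto simp: T_def intro!: image_eqI[of _ _ "(\<lambda>x. xs ! k * x) \<circ> w"])
      qed
    qed
    have finS: "finite S" using ST finT finite_subset by blast
    \<comment> \<open>Only the first \<open>2 * n\<close> coordinates serve as directions; the last
      one, the position \<open>j\<close>, is carried along.\<close>
    obtain i where i: "i < 2 * n"
      "real (card S) powr ((2 * real n - 1) / (2 * real n)) \<le> real (card ((\<lambda>s. s(i := 0)) ` S))"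
    proof -
      have "{..<2 * n} \<noteq> {}" using n by (simp add: lessThan_empty_iff)
      from large_projection[OF _ this finS S0] show ?thesis using that by auto
    qed
    have "card S + card ((\<lambda>s. s(i := 0)) ` S) \<le> card T"
      by (rule card_shift_union[OF finT ST]) (use step i in auto)
    then have "real (card S) + real (card ((\<lambda>s. s(i := 0)) ` S)) \<le> real (card T)"
      by (simp flip: of_nat_add)
    then show "real (E.dim W) + 1 * real (E.dim W) powr ((2 * real n - 1) / (2 * real n))
        \<le> real (E.dim (prodsp (end_scale \<phi>) (\<circ>) V W))"
      using i(2) by (simp add: dimW dimU flip: U_def)
  qed simp
  ultimately show ?thesis using that by blast
qed

end

section \<open>The growth of D(B)\<close>

context kalgebra
begin

lemma klinear_span:
  assumes "klinear \<phi> d" "B.subspace U" "\<And>a. a \<in> A \<Longrightarrow> d a \<in> U" "b \<in> B.span A"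
  shows "d b \<in> U"
  using assms(4)
proof (induction rule: B.span_induct_alt)
  case base
  then show ?case using klinear_0[OF assms(1)] B.subspace_0[OF assms(2)] by simp
next
  case (step c a y)
  have "\<phi> c * d a + d y \<in> U"
    using step assms(3) by (intro B.subspace_add[OF assms(2)] B.subspace_scale[OF assms(2)]) auto
  then show ?case by (simp add: klinear_add[OF assms(1)] klinear_scale[OF assms(1)])
qed

text \<open>For \<open>1 \<in> S\<close> this is the degree filtration: combinations of products of
  at most \<open>M\<close> elements of \<open>S\<close>.\<close>

fun fil :: "'b set \<Rightarrow> nat \<Rightarrow> 'b set" where
  "fil S 0 = B.span {1}"
| "fil S (Suc M) = B.span ((\<lambda>(s, b). s * b) ` (S \<times> fil S M))"

lemma subspace_fil: "B.subspace (fil S M)"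
  by (cases M) auto

lemma fil_step: "s \<in> S \<Longrightarrow> b \<in> fil S M \<Longrightarrow> s * b \<in> fil S (Suc M)"
  by (auto intro!: B.span_base)

lemma fil_mono: assumes "1 \<in> S" "M \<le> M'" shows "fil S M \<subseteq> fil S M'"
proof (rule lift_Suc_mono_le[of "fil S"])
  show "fil S k \<subseteq> fil S (Suc k)" for k using fil_step[OF assms(1)] by fastforce
qed (use assms in auto)

lemma fil_mult: "a \<in> fil S M \<Longrightarrow> b \<in> fil S M' \<Longrightarrow> a * b \<in> fil S (M + M')"
proof (induction M arbitrary: a)
  case 0
  then obtain c where "a = \<phi> c" by (auto simp: B.span_singleton)
  then show ?case using 0 B.subspace_scale[OF subspace_fil] by simp
next
  case (Suc M)
  have "klinear \<phi> (\<lambda>x. x * b)" by (simp add: klinear_def algebra_simps)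
  moreover have "x * b \<in> fil S (Suc M + M')" if x: "x \<in> (\<lambda>(s, b). s * b) ` (S \<times> fil S M)" for x
  proof -
    obtain s y where "s \<in> S" "y \<in> fil S M" "x = s * y" using x by auto
    then show ?thesis using fil_step[of s S "y * b"] Suc.IH[of y] Suc.prems
      by (simp only: add_Suc mult.assoc)
  qed
  moreover have "a \<in> B.span ((\<lambda>(s, b). s * b) ` (S \<times> fil S M))" using Suc.prems by simp
  ultimately show ?case using klinear_span[OF _ subspace_fil] by metis
qed

lemma fil_exhaust:
  assumes "1 \<in> S" "gen_subalg \<phi> S' = UNIV" "S' \<subseteq> S"
  obtains M where "b \<in> fil S M"
proof -
  have one: "1 \<in> fil S 0" by (simp add: B.span_base)
  have "b \<in> gen_subalg \<phi> S'" using assms by simp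
  then have "\<exists>M. b \<in> fil S M"
  proof induction
    case (scal c)
    have "\<phi> c * 1 \<in> fil S 0" using one by (rule B.subspace_scale[OF subspace_fil])
    then show ?case by (metis mult_1_right)
  next
    case (gen s)
    then have "s * 1 \<in> fil S (Suc 0)" using one assms(3) by (intro fil_step) auto
    then show ?case by (metis mult_1_right)
  next
    case (add x y)
    then obtain M M' where "x \<in> fil S M" "y \<in> fil S M'" by blast
    then have "x \<in> fil S (max M M')" "y \<in> fil S (max M M')"
      using fil_mono[OF assms(1), of M "max M M'"] fil_mono[OF assms(1), of M' "max M M'"] by auto
    then show ?case using B.subspace_add[OF subspace_fil] by blast
  next
    case (mult x y)
    then show ?case using fil_mult by blast
  qed
  then show ?thesis using that by blast
qed

definition deg_le :: "'b set \<Rightarrow> nat \<Rightarrow> ('b \<Rightarrow> 'b) set" where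
  "deg_le S c = {d. \<forall>M. d ` fil S M \<subseteq> fil S (M + c)}"

lemma subspace_deg_le: "E.subspace (deg_le S c)"
  using B.subspace_0[OF subspace_fil] B.subspace_add[OF subspace_fil] B.subspace_scale[OF subspace_fil]
  by (intro E.subspaceI) (auto simp: deg_le_def end_scale_def image_subset_iff)

lemma deg_le_mono: "1 \<in> S \<Longrightarrow> c \<le> c' \<Longrightarrow> deg_le S c \<subseteq> deg_le S c'"
  using fil_mono[of S "M + c" "M + c'" for M] by (fastforce simp: deg_le_def)

lemma deg_le_comp:
  assumes "d \<in> deg_le S c" "e \<in> deg_le S c'" shows "d \<circ> e \<in> deg_le S (c + c')"
  unfolding deg_le_def
proof (intro CollectI allI image_subsetI)
  fix M x assume "x \<in> fil S M"
  then have "e x \<in> fil S (M + c')" using assms(2) by (auto simp: deg_le_def)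
  then have "d (e x) \<in> fil S (M + c' + c)" using assms(1) unfolding deg_le_def by blast
  then show "(d \<circ> e) x \<in> fil S (M + (c + c'))" by (simp add: ac_simps)
qed

text \<open>Each commutator with a generator costs one degree; this couples the order of an operator
  to the degree of its symbols.\<close>

lemma deg_le_C:
  assumes "d \<in> deg_le S c" "s \<in> S" shows "C s d \<in> deg_le S (Suc c)"
  unfolding deg_le_def
proof (intro CollectI allI image_subsetI)
  fix M x assume x: "x \<in> fil S M"
  have "d (s * x) \<in> fil S (Suc M + c)" using fil_step[OF assms(2) x] assms(1) unfolding deg_le_def by blast
  moreover have "s * d x \<in> fil S (Suc (M + c))" using x assms by (intro fil_step) (auto simp: deg_le_def)
  ultimately have "d (s * x) - s * d x \<in> fil S (Suc (M + c))"
    by (intro B.subspace_diff[OF subspace_fil]) (simp_all only: add_Suc)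
  then show "C s d x \<in> fil S (M + Suc c)" by (simp add: C_def)
qed

text \<open>Induction on the order: \<open>d (s * b)\<close> is \<open>s * d b\<close> plus the
  commutator \<open>C s d\<close> at \<open>b\<close>. The finitely many commutators have a common
  bound by induction, and the degree of \<open>d 1\<close> starts the inner induction on
  \<open>M\<close>.\<close>

lemma deg_le_exists:
  assumes S: "1 \<in> S" "finite S" "gen_subalg \<phi> S' = UNIV" "S' \<subseteq> S" and d: "d \<in> diffops \<phi> m"
  shows "\<exists>c. d \<in> deg_le S c"
  using d
proof (induction m arbitrary: d)
  case 0
  obtain a where a: "d = (\<lambda>x. a * x)" using diffops_0E[OF 0] by blast
  obtain c where "a \<in> fil S c" using fil_exhaust[OF S(1,3,4)] by blast
  then have "d \<in> deg_le S c"
    using fil_mult[of a S c _ M for M] unfolding a deg_le_def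
    by (simp add: image_subset_iff add.commute[of _ c])
  then show ?case by blast
next
  case (Suc m)
  have kl: "klinear \<phi> d" using Suc.prems diffops_klinear by blast
  have "\<exists>c. \<forall>s\<in>T. C s d \<in> deg_le S c" if "finite T" for T
    using that
  proof induction
    case (insert s T)
    obtain c where c: "\<forall>s\<in>T. C s d \<in> deg_le S c" using insert by blast
    obtain c' where c': "C s d \<in> deg_le S c'" using Suc.IH Suc.prems by (auto simp: diffops_Suc)
    show ?case
      using c c' deg_le_mono[OF S(1), of c "max c c'"] deg_le_mono[OF S(1), of c' "max c c'"]
      by (intro exI[of _ "max c c'"]) auto
  qed simp
  then obtain c where c: "\<And>s. s \<in> S \<Longrightarrow> C s d \<in> deg_le S c" using S(2) by blast
  obtain c0 where c0: "d 1 \<in> fil S c0" using fil_exhaust[OF S(1,3,4)] by blast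
  let ?c = "max c c0"
  have "d x \<in> fil S (M + ?c)" if "x \<in> fil S M" for M x
    using that
  proof (induction M arbitrary: x)
    case 0
    have "d 1 \<in> fil S ?c" using c0 fil_mono[OF S(1), of c0 ?c] by auto
    then show ?case using klinear_span[OF kl subspace_fil, of "{1}"] 0 by simp
  next
    case (Suc M)
    have "d y \<in> fil S (Suc M + ?c)" if y: "y \<in> (\<lambda>(s, b). s * b) ` (S \<times> fil S M)" for y
    proof -
      obtain s b where sb: "s \<in> S" "b \<in> fil S M" "y = s * b" using y by auto
      have "C s d b \<in> fil S (M + c)" using c[OF sb(1)] sb(2) by (auto simp: deg_le_def)
      then have 1: "C s d b \<in> fil S (Suc M + ?c)" by (rule subsetD[OF fil_mono[OF S(1)], rotated]) simp
      have 2: "s * d b \<in> fil S (Suc M + ?c)" using fil_step[OF sb(1) Suc.IH[OF sb(2)]] by (simp only: add_Suc)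
      have "d y = s * d b + C s d b" by (simp add: C_def sb)
      then show ?thesis using B.subspace_add[OF subspace_fil 2 1] by (simp only:)
    qed
    then show ?case using klinear_span[OF kl subspace_fil] Suc.prems unfolding fil.simps by metis
  qed
  then have "d \<in> deg_le S ?c" by (auto simp: deg_le_def)
  then show ?case by blast
qed

lemma fin_dim_fil: "finite S \<Longrightarrow> B.fin_dim (fil S M)"
proof (induction M)
  case 0
  show ?case unfolding B.fin_dim_def by (intro exI[of _ "{1}"]) auto
next
  case (Suc M)
  then obtain F where F: "finite F" "fil S M \<subseteq> B.span F" by (auto simp: B.fin_dim_def)
  let ?T = "(\<lambda>(s, b). s * b) ` (S \<times> F)"
  have "s * b \<in> B.span ?T" if sb: "s \<in> S" "b \<in> fil S M" for s b
  proof (rule span_mult_closed[of "{s}" F])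
    show "s \<in> B.span {s}" by (simp add: B.span_base)
    show "b \<in> B.span F" using sb F by blast
    show "x * y \<in> B.span ?T" if "x \<in> {s}" "y \<in> F" for x y
      using that sb by (intro B.span_base) auto
  qed
  then have "(\<lambda>(s, b). s * b) ` (S \<times> fil S M) \<subseteq> B.span ?T" by auto
  then have "fil S (Suc M) \<subseteq> B.span ?T" unfolding fil.simps by (rule B.span_minimal) simp
  then show ?case unfolding B.fin_dim_def using F Suc.prems by (intro exI[of _ ?T]) auto
qed

end

section \<open>Dimension of the degree filtration\<close>

context transc_basis
begin

text \<open>For \<open>E = Mon\<close> this is the \<open>P\<close>-module generated by
  \<open>G\<close>; a box \<open>E\<close> bounds the exponents, and for finite \<open>G\<close> the
  dimension.\<close>

definition comb :: "(nat \<Rightarrow> nat) set \<Rightarrow> 'b set \<Rightarrow> 'b set" where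
  "comb E G = B.span ((\<lambda>(e, g). X e * g) ` (E \<times> G))"

lemma subspace_comb: "B.subspace (comb E G)"
  by (simp add: comb_def)

lemma comb_mono: "E \<subseteq> E' \<Longrightarrow> comb E G \<subseteq> comb E' G"
  unfolding comb_def by (intro B.span_mono) auto

lemma comb_base: "e \<in> E \<Longrightarrow> g \<in> G \<Longrightarrow> X e * g \<in> comb E G"
  unfolding comb_def by (intro B.span_base) auto

lemma P_mult_comb: "p \<in> P \<Longrightarrow> m \<in> comb Mon G \<Longrightarrow> p * m \<in> comb Mon G"
  unfolding P_def comb_def
proof (erule span_mult_closed[rotated])
  fix a b assume "a \<in> X ` Mon" "b \<in> (\<lambda>(e, g). X e * g) ` (Mon \<times> G)"
  then obtain e e' g where *: "e \<in> Mon" "e' \<in> Mon" "g \<in> G" "a = X e" "b = X e' * g" by auto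
  then have "a * b = X (\<lambda>i. e i + e' i) * g" by (simp add: X_add)
  then show "a * b \<in> B.span ((\<lambda>(e, g). X e * g) ` (Mon \<times> G))"
    using comb_base[OF Mon_add[OF *(1,2)] *(3)] by (simp add: comb_def)
qed

lemma comb_box: "m \<in> comb Mon G \<Longrightarrow> \<exists>h. m \<in> comb (box h) G"
  unfolding comb_def[of Mon]
proof (induction rule: B.span_induct_alt)
  case base
  show ?case using B.subspace_0[OF subspace_comb] by blast
next
  case (step c a y)
  then obtain e g h where *: "e \<in> Mon" "g \<in> G" "a = X e * g" "y \<in> comb (box h) G" by auto
  define h' where "h' = (\<Sum>i<n. e i) + h"
  have "e i \<le> h'" for i
  proof (cases "i < n")
    case True
    then have "e i \<le> (\<Sum>i<n. e i)" by (intro member_le_sum) auto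
    then show ?thesis by (simp add: h'_def)
  qed (use * in \<open>auto simp: Mon_def\<close>)
  then have "e \<in> box h'" using * by (simp add: box_def)
  then have "a \<in> comb (box h') G" using * comb_base by blast
  moreover have "box h \<subseteq> box h'" by (auto simp: box_def h'_def intro: trans_le_add2)
  then have "y \<in> comb (box h') G" using *(4) comb_mono by blast
  ultimately show ?case
    using B.subspace_add[OF subspace_comb B.subspace_scale[OF subspace_comb]] by blast
qed

end

context affine_domain
begin

text \<open>Multiplication by \<open>S\<close> preserves the module generated by \<open>G\<close> up
  to one denominator \<open>f\<close>. For a new \<open>s\<close> with an equation of degree
  \<open>D\<close>, the powers of \<open>s\<close> below \<open>D\<close> are adjoined to the
  module, and the leading coefficient \<open>a\<close> joins the denominator so that
  \<open>s ^ D\<close> can be rewritten.\<close>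

lemma denominators:
  assumes "finite S"
  shows "\<exists>f G. f \<in> P \<and> f \<noteq> 0 \<and> finite G \<and> 1 \<in> G \<and> (\<forall>s\<in>S. \<forall>g\<in>G. f * (s * g) \<in> comb Mon G)"
  using assms
proof induction
  case empty
  show ?case by (intro exI[of _ 1] exI[of _ "{1}"]) auto
next
  case (insert s S)
  then obtain f G where f: "f \<in> P" "f \<noteq> 0" and G: "finite G" "1 \<in> G"
    and fG: "\<And>s g. s \<in> S \<Longrightarrow> g \<in> G \<Longrightarrow> f * (s * g) \<in> comb Mon G" by blast
  obtain Q0 where "Q0 \<in> polys P" "Q0 \<noteq> 0" "poly Q0 s = 0" by (rule algebraic)
  then obtain Q where Q: "Q \<in> polys P" "Q \<noteq> 0" "poly Q s = 0" "degree Q > 0"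
    using exists_minimal_poly by blast
  define D where "D = degree Q"
  define a where "a = lead_coeff Q"
  have a: "a \<in> P" "a \<noteq> 0" using Q by (auto simp: a_def polys_def)
  define G' where "G' = (\<lambda>(g, l). g * s ^ l) ` (G \<times> {..<D})"
  have G'_mem: "g * s ^ l \<in> comb Mon G'" if "g \<in> G" "l < D" for g l
  proof -
    have "g * s ^ l \<in> G'" using that unfolding G'_def by (intro image_eqI[of _ _ "(g, l)"]) auto
    then show ?thesis using comb_base[of "\<lambda>_. 0" Mon "g * s ^ l" G'] by simp
  qed
  have comb_s: "m * s ^ l \<in> comb Mon G'" if "m \<in> comb Mon G" "l < D" for m l
    unfolding comb_def
  proof (rule span_mult_closed)
    show "m \<in> B.span ((\<lambda>(e, g). X e * g) ` (Mon \<times> G))" using that by (simp add: comb_def)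
    show "s ^ l \<in> B.span {s ^ l}" by (simp add: B.span_base)
    fix x y assume "x \<in> (\<lambda>(e, g). X e * g) ` (Mon \<times> G)" "y \<in> {s ^ l}"
    then obtain e g where "e \<in> Mon" "g \<in> G" "x * y = X e * (g * s ^ l)" by (auto simp: mult.assoc)
    then show "x * y \<in> B.span ((\<lambda>(e, g). X e * g) ` (Mon \<times> G'))"
      using P_mult_comb[OF P_X G'_mem] that by (simp add: comb_def)
  qed
  have top: "g * (a * s ^ D) \<in> comb Mon G'" if "g \<in> G" for g
  proof -
    have "0 = (\<Sum>i\<le>D. coeff Q i * s ^ i)" using Q(3) by (simp add: poly_altdef D_def)
    also have "\<dots> = (\<Sum>i<D. coeff Q i * s ^ i) + a * s ^ D"
      by (simp add: a_def D_def lessThan_Suc_atMost[symmetric])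
    finally have "a * s ^ D = - (\<Sum>i<D. coeff Q i * s ^ i)" by (simp add: eq_neg_iff_add_eq_0 add.commute)
    then have "g * (a * s ^ D) = (\<Sum>i<D. (- coeff Q i) * (g * s ^ i))"
      by (simp add: sum_distrib_left sum_negf mult.left_commute)
    also have "\<dots> \<in> comb Mon G'"
      using Q(1) that
      by (intro B.subspace_sum[OF subspace_comb] P_mult_comb P_minus G'_mem) (auto simp: polys_def)
    finally show ?thesis .
  qed
  \<comment> \<open>An old \<open>s'\<close> leaves the power of \<open>s\<close> alone;
    \<open>s\<close> itself raises the power within the range, or reaches \<open>s ^ D\<close>,
    which \<open>top\<close> rewrites.\<close>
  have "f * a * (s' * g') \<in> comb Mon G'" if s': "s' \<in> insert s S" and g': "g' \<in> G'" for s' g'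
  proof -
    obtain g l where gl: "g \<in> G" "l < D" "g' = g * s ^ l" using g' by (auto simp: G'_def)
    show ?thesis
    proof (cases "s' = s")
      case False
      then have "a * ((f * (s' * g)) * s ^ l) \<in> comb Mon G'"
        using s' gl by (intro P_mult_comb a comb_s fG) auto
      then show ?thesis by (simp add: gl ac_simps)
    next
      case True
      show ?thesis
      proof (cases "Suc l < D")
        case True
        then have "(f * a) * (g * s ^ Suc l) \<in> comb Mon G'"
          using f a gl by (intro P_mult_comb G'_mem P_mult) auto
        then show ?thesis by (simp add: gl \<open>s' = s\<close> ac_simps)
      next
        case False
        then have "D = Suc l" using gl by simp
        then have "f * (g * (a * s ^ Suc l)) \<in> comb Mon G'" using P_mult_comb[OF f(1) top[OF gl(1)]] by simp
        then show ?thesis by (simp add: gl \<open>s' = s\<close> ac_simps)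
      qed
    qed
  qed
  moreover have "finite G'" using G by (simp add: G'_def)
  moreover have "1 \<in> G'" using G Q(4) by (auto simp: G'_def D_def intro!: image_eqI[of _ _ "(1, 0)"])
  moreover have "f * a \<in> P" "f * a \<noteq> 0" using f a by (auto intro: P_mult)
  ultimately show ?case by blast
qed

text \<open>Multiplication by \<open>f ^ M\<close> embeds \<open>fil S M\<close> into combinations
  of the finite set \<open>G\<close> with exponents at most \<open>h * M\<close>: each factor from
  \<open>S\<close> costs one \<open>f\<close> and \<open>h\<close> units of exponent.\<close>

lemma dim_fil_le:
  assumes "finite S"
  obtains K where "\<And>M. B.dim (fil S M) \<le> K * (M + 1) ^ n"
proof -
  obtain f G where f: "f \<in> P" "f \<noteq> 0" and G: "finite G" "1 \<in> G"
    and fG: "\<And>s g. s \<in> S \<Longrightarrow> g \<in> G \<Longrightarrow> f * (s * g) \<in> comb Mon G"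
    using denominators[OF assms] by blast
  \<comment> \<open>As \<open>S \<times> G\<close> is finite, one bound \<open>h\<close> serves all
    products.\<close>
  have "\<exists>h. \<forall>t\<in>T. (\<lambda>(s, g). f * (s * g)) t \<in> comb (box h) G" if "finite T" "T \<subseteq> S \<times> G" for T
    using that
  proof induction
    case (insert t T)
    obtain h where h: "\<forall>t\<in>T. (\<lambda>(s, g). f * (s * g)) t \<in> comb (box h) G" using insert by blast
    obtain h' where h': "(\<lambda>(s, g). f * (s * g)) t \<in> comb (box h') G"
      using comb_box fG insert.prems by (cases t) fastforce
    have "box h \<subseteq> box (max h h')" "box h' \<subseteq> box (max h h')" by (auto simp: box_def le_max_iff_disj)
    then show ?case using h h' comb_mono by (intro exI[of _ "max h h'"]) blast
  qed simp
  from this[of "S \<times> G"] obtain h where h: "\<And>s g. s \<in> S \<Longrightarrow> g \<in> G \<Longrightarrow> f * (s * g) \<in> comb (box h) G"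
    using assms G by auto
  have box_add: "(\<lambda>i. e i + e' i) \<in> box (k + k')" if "e \<in> box k" "e' \<in> box k'" for e e' k k'
    using that by (auto simp: box_def Mon_def intro: add_mono)
  have fs: "(f * s) * m \<in> comb (box (k + h)) G" if "s \<in> S" "m \<in> comb (box k) G" for s m k
    unfolding comb_def
  proof (rule span_mult_closed)
    show "f * s \<in> B.span {f * s}" by (simp add: B.span_base)
    show "m \<in> B.span ((\<lambda>(e, g). X e * g) ` (box k \<times> G))" using that by (simp add: comb_def)
    fix x y assume "x \<in> {f * s}" "y \<in> (\<lambda>(e, g). X e * g) ` (box k \<times> G)"
    then obtain e g where eg: "e \<in> box k" "g \<in> G" "x * y = X e * (f * (s * g))" by (auto simp: ac_simps)
    have "X e * (f * (s * g)) \<in> B.span ((\<lambda>(e, g). X e * g) ` (box (k + h) \<times> G))"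
    proof (rule span_mult_closed)
      show "X e \<in> B.span {X e}" by (simp add: B.span_base)
      show "f * (s * g) \<in> B.span ((\<lambda>(e, g). X e * g) ` (box h \<times> G))"
        using h[OF that(1) eg(2)] by (simp add: comb_def)
      fix x y assume "x \<in> {X e}" "y \<in> (\<lambda>(e, g). X e * g) ` (box h \<times> G)"
      then obtain e' g' where *: "e' \<in> box h" "g' \<in> G" "x * y = X (\<lambda>i. e i + e' i) * g'"
        by (auto simp: X_add mult.assoc)
      then show "x * y \<in> B.span ((\<lambda>(e, g). X e * g) ` (box (k + h) \<times> G))"
        using comb_base[OF box_add[OF eg(1) *(1)] *(2)] by (simp add: comb_def)
    qed
    then show "x * y \<in> B.span ((\<lambda>(e, g). X e * g) ` (box (k + h) \<times> G))" using eg by simp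
  qed
  have fM: "f ^ M * b \<in> comb (box (h * M)) G" if "b \<in> fil S M" for M b
    using that
  proof (induction M arbitrary: b)
    case 0
    then obtain c where "b = \<phi> c" by (auto simp: B.span_singleton)
    moreover have "X (\<lambda>_. 0) * 1 \<in> comb (box (h * 0)) G" using G by (intro comb_base) (auto simp: box_def)
    ultimately show ?case using B.subspace_scale[OF subspace_comb, of 1 _ _ c] by simp
  next
    case (Suc M)
    have "klinear \<phi> (\<lambda>x. f ^ Suc M * x)" by (simp add: klinear_def algebra_simps)
    moreover have "f ^ Suc M * y \<in> comb (box (h * Suc M)) G"
      if y: "y \<in> (\<lambda>(s, b). s * b) ` (S \<times> fil S M)" for y
    proof -
      obtain s b where sb: "s \<in> S" "b \<in> fil S M" "y = s * b" using y by auto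
      have "(f * s) * (f ^ M * b) \<in> comb (box (h * M + h)) G" by (rule fs[OF sb(1) Suc.IH[OF sb(2)]])
      then show ?thesis by (simp add: sb ac_simps)
    qed
    ultimately show ?case using klinear_span[OF _ subspace_comb] Suc.prems unfolding fil.simps by metis
  qed
  have "B.dim (fil S M) \<le> (card G * (h + 1) ^ n) * (M + 1) ^ n" for M
  proof -
    obtain A where A: "finite A" "B.independent A" "A \<subseteq> fil S M" "card A = B.dim (fil S M)"
      using B.fin_dim_basis[OF fin_dim_fil[OF assms]] by metis
    interpret F: module_hom scaleB scaleB "\<lambda>b. f ^ M * b"
      by standard (auto simp: algebra_simps)
    have inj: "inj (\<lambda>b. f ^ M * b)" using f by (auto simp: inj_def)
    have "B.independent ((\<lambda>b. f ^ M * b) ` A)"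
      by (rule F.independent_injective_image[OF A(2)]) (rule inj_on_subset[OF inj subset_UNIV])
    moreover have "(\<lambda>b. f ^ M * b) ` A \<subseteq> B.span ((\<lambda>(e, g). X e * g) ` (box (h * M) \<times> G))"
      using fM A(3) by (auto simp: comb_def)
    ultimately have "card ((\<lambda>b. f ^ M * b) ` A) \<le> card ((\<lambda>(e, g). X e * g) ` (box (h * M) \<times> G))"
      using B.independent_span_bound[OF finite_imageI[OF finite_cartesian_product[OF finite_box G(1)]]] by metis
    also have "\<dots> \<le> card (box (h * M) \<times> G)" by (rule card_image_le) (use finite_box G in auto)
    also have "\<dots> \<le> (h * M + 1) ^ n * card G" using card_box by (simp add: card_cartesian_product)
    also have "\<dots> \<le> ((h + 1) * (M + 1)) ^ n * card G" by (intro mult_right_mono power_mono) auto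
    finally show ?thesis
      unfolding A(4)[symmetric] card_image[OF inj_on_subset[OF inj subset_UNIV]] power_mult_distrib
      by (simp only: ac_simps)
  qed
  then show ?thesis using that by blast
qed

end

section \<open>Dimension of the powers of a subframe\<close>

context diffop_algebra
begin

lemma adp_deg_le:
  assumes "set xs \<subseteq> S" "d \<in> deg_le S c" "m \<le> n"
  shows "adp m \<beta> d \<in> deg_le S (c + (\<Sum>i<m. \<beta> i))"
  using assms(3)
proof (induction m)
  case (Suc m)
  have x: "xs ! m \<in> S" using Suc.prems assms(1) len by auto
  have "(C (xs ! m) ^^ k) e \<in> deg_le S (c' + k)" if "e \<in> deg_le S c'" for k e c'
    by (induction k) (use that deg_le_C[OF _ x] in auto)
  from this[OF Suc.IH] show ?case using Suc.prems by (simp add: add.assoc)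
qed (use assms in simp)

theorem powsp_growth:
  assumes "subframe (end_scale \<phi>) id (DiffOps \<phi>) V"
  obtains K where
    "\<And>N. E.dim (powsp (end_scale \<phi>) (\<circ>) id V N) \<le> K * (N + 1) ^ (2 * n)"
    "\<And>N. fd_subspace (end_scale \<phi>) (DiffOps \<phi>) (powsp (end_scale \<phi>) (\<circ>) id V N)"
proof -
  obtain S' where S': "finite S'" "gen_subalg \<phi> S' = UNIV" using affine by (auto simp: affine_alg_def)
  define S where "S = insert 1 (S' \<union> set xs)"
  have S: "1 \<in> S" "finite S" "S' \<subseteq> S" "set xs \<subseteq> S" using S' by (auto simp: S_def)
  have V: "E.subspace V" "V \<subseteq> DiffOps \<phi>" "E.fin_dim V"
    using assms by (auto simp: subframe_def fd_iff)
  obtain F where F: "finite F" "F \<subseteq> V" "V \<subseteq> E.span F" using E.fin_dim_basis[OF V(3)] by metis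
  obtain m where m: "F \<subseteq> diffops \<phi> m" using DiffOps_bound[of F] F V by blast
  have "\<exists>c. T \<subseteq> deg_le S c" if "finite T" "T \<subseteq> F" for T
    using that
  proof induction
    case (insert d T)
    obtain c where c: "T \<subseteq> deg_le S c" using insert by blast
    obtain c' where c': "d \<in> deg_le S c'"
      using deg_le_exists[OF S(1,2) S'(2) S(3)] m insert.prems by blast
    show ?case
      using c c' deg_le_mono[OF S(1), of c "max c c'"] deg_le_mono[OF S(1), of c' "max c c'"]
      by (intro exI[of _ "max c c'"]) auto
  qed simp
  then obtain c where c: "F \<subseteq> deg_le S c" using F by blast
  have Vm: "V \<subseteq> diffops \<phi> m" using E.span_minimal[OF m subspace_diffops] F by blast
  have Vc: "V \<subseteq> deg_le S c" using E.span_minimal[OF c subspace_deg_le] F by blast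
  define U where "U N = powsp (end_scale \<phi>) (\<circ>) id V N" for N
  have U_Suc: "U (Suc N) = prodsp (end_scale \<phi>) (\<circ>) (U N) V" for N by (simp add: U_def)
  have U_0: "U 0 = E.span {id}" by (simp add: U_def)
  have sub: "E.subspace (U N)" for N by (cases N) (simp_all add: U_0 U_Suc subspace_prodsp)
  have UD: "U N \<subseteq> DiffOps \<phi> \<and> E.fin_dim (U N)" for N
  proof (induction N)
    case 0
    have "E.fin_dim (E.span {id})" unfolding E.fin_dim_def by (intro exI[of _ "{id}"]) simp
    then show ?case using E.span_minimal[OF _ subspace_DiffOps, of "{id}"] id_DiffOps by (simp add: U_0)
  next
    case (Suc N)
    then show ?case unfolding U_Suc using prodsp_subset_DiffOps fin_dim_prodsp V by blast
  qed
  have Um: "U N \<subseteq> diffops \<phi> (m * N)" for N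
  proof (induction N)
    case 0
    have "id \<in> diffops \<phi> 0" using diffops_mult_op[of 1] by (simp add: id_def)
    then show ?case using E.span_minimal[OF _ subspace_diffops, of "{id}"] by (simp add: U_0)
  next
    case (Suc N)
    show ?case unfolding U_Suc prodsp_def
    proof (rule E.span_minimal[OF _ subspace_diffops], safe)
      fix v w assume "v \<in> U N" "w \<in> V"
      then have "v \<circ> w \<in> diffops \<phi> (m * N + m)" using Suc Vm by (intro diffops_comp) auto
      then show "v \<circ> w \<in> diffops \<phi> (m * Suc N)" by (simp add: add.commute)
    qed
  qed
  have Uc: "U N \<subseteq> deg_le S (c * N)" for N
  proof (induction N)
    case 0
    have "id \<in> deg_le S 0" by (simp add: deg_le_def)
    then show ?case using E.span_minimal[OF _ subspace_deg_le, of "{id}"] by (simp add: U_0)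
  next
    case (Suc N)
    show ?case unfolding U_Suc prodsp_def
    proof (rule E.span_minimal[OF _ subspace_deg_le], safe)
      fix v w assume "v \<in> U N" "w \<in> V"
      then have "v \<circ> w \<in> deg_le S (c * N + c)" using Suc Vc by (intro deg_le_comp) auto
      then show "v \<circ> w \<in> deg_le S (c * Suc N)" by (simp add: add.commute)
    qed
  qed
  obtain K where K: "\<And>M. B.dim (fil S M) \<le> K * (M + 1) ^ n" using dim_fil_le[OF S(2)] by blast
  have "E.dim (U N) \<le> ((m + 1) ^ n * K * (c + m + 1) ^ n) * (N + 1) ^ (2 * n)" for N
  proof -
    \<comment> \<open>Operators in \<open>U N\<close> raise degrees by at most \<open>c * N\<close>
      and have order at most \<open>m * N\<close>; a nonzero symbol uses at most
      \<open>m * N\<close> commutators, each worth one more degree.\<close>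
    let ?M = "(c + m) * N"
    let ?L = "leadB ` (fil S ?M - {0})"
    have L: "finite ?L" "card ?L = B.dim (fil S ?M)"
      using LB.dim_eq_card_lead[OF subspace_fil _ fin_dim_fil[OF S(2)]] by auto
    have "leadD ` (U N - {0}) \<subseteq> box (m * N) \<times> ?L"
    proof
      fix t assume "t \<in> leadD ` (U N - {0})"
      then obtain d where d: "d \<in> U N" "d \<noteq> 0" "t = leadD d" by auto
      have dm: "d \<in> diffops \<phi> (m * N)" using d Um by blast
      have top: "is_top d (dtop d)" by (rule is_top_top) (use d UD in auto)
      then have b: "sig (dtop d) d \<noteq> 0" "dtop d \<in> Mon" by (auto simp: is_top_def)
      then have box: "dtop d \<in> box (m * N)" using sig_support[OF dm] by blast
      have "(\<Sum>i<n. dtop d i) \<le> m * N" using sig_eq_0[OF dm] b by (meson not_le)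
      moreover have "adp n (dtop d) d \<in> deg_le S (c * N + (\<Sum>i<n. dtop d i))"
        by (rule adp_deg_le[OF S(4)]) (use d Uc in auto)
      moreover have "1 \<in> fil S 0" by (simp add: B.span_base)
      ultimately have "sig (dtop d) d \<in> fil S (0 + (c * N + (\<Sum>i<n. dtop d i)))"
        unfolding sig_def deg_le_def by blast
      also have "\<dots> \<subseteq> fil S ?M"
        by (rule fil_mono[OF S(1)]) (use \<open>(\<Sum>i<n. dtop d i) \<le> m * N\<close> in \<open>simp add: algebra_simps\<close>)
      finally have "sig (dtop d) d \<in> fil S ?M" .
      then show "t \<in> box (m * N) \<times> ?L" using b box d by (auto simp: leadD_def)
    qed
    then have "card (leadD ` (U N - {0})) \<le> card (box (m * N) \<times> ?L)"
      by (intro card_mono) (use finite_box L in auto)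
    also have "\<dots> = card (box (m * N)) * B.dim (fil S ?M)" by (simp add: card_cartesian_product L)
    also have "\<dots> \<le> (m * N + 1) ^ n * (K * (?M + 1) ^ n)" by (intro mult_le_mono card_box K)
    also have "\<dots> \<le> ((m + 1) * (N + 1)) ^ n * (K * ((c + m + 1) * (N + 1)) ^ n)"
      by (intro mult_le_mono power_mono order_refl) (auto simp: algebra_simps)
    also have "\<dots> = ((m + 1) ^ n * K * (c + m + 1) ^ n) * (N + 1) ^ (2 * n)"
    proof -
      have "(N + 1) ^ (2 * n) = (N + 1) ^ n * (N + 1) ^ n" by (simp only: mult_2 power_add)
      then show ?thesis by (simp only: power_mult_distrib ac_simps)
    qed
    finally show ?thesis using LD.dim_eq_card_lead(2)[OF sub] UD by simp
  qed
  moreover have "fd_subspace (end_scale \<phi>) (DiffOps \<phi>) (U N)" for N using sub UD by (simp add: fd_iff)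
  ultimately show ?thesis using that unfolding U_def by blast
qed

end

section \<open>Comparing growth rates\<close>

lemma tendsto_const_div_ln: "(\<lambda>m::nat. c / ln (real m)) \<longlonglongrightarrow> 0"
  by (rule tendsto_divide_0[OF tendsto_const filterlim_at_top_imp_at_infinity])
     (rule filterlim_compose[OF ln_at_top filterlim_real_sequentially])

lemma limsup_log_le:
  fixes a :: "nat \<Rightarrow> nat"
  assumes "\<And>m. a m \<le> K * (m + 1) ^ r"
  shows "limsup (\<lambda>m. ereal (ln (real (a m)) / ln (real m))) \<le> ereal (real r)"
proof -
  \<comment> \<open>Absorbs the constant \<open>K\<close>, enlarged by 1 to stay positive, and the
    error in \<open>ln (m + 1) \<le> ln m + 1\<close>.\<close>
  define L where "L = ln (real K + 1) + real r"
  have "ln (real (a m)) / ln (real m) \<le> real r + L / ln (real m)" if m: "m \<ge> 2" for m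
  proof -
    have lnm: "ln (real m) > 0" using m by simp
    have "ln (real (a m)) \<le> ln ((real K + 1) * (real m + 1) ^ r)"
    proof (cases "a m = 0")
      case True
      have "1 \<le> (real K + 1) * (real m + 1) ^ r"
        using mult_mono[of 1 "real K + 1" 1 "(real m + 1) ^ r"] by simp
      then show ?thesis using True by simp
    next
      case False
      have "real (a m) \<le> real (K * (m + 1) ^ r)" using assms of_nat_mono by blast
      also have "\<dots> = real K * (real m + 1) ^ r" by (simp add: add.commute)
      also have "\<dots> \<le> (real K + 1) * (real m + 1) ^ r" by (simp add: mult_right_mono)
      finally show ?thesis using False by (subst ln_le_cancel_iff) auto
    qed
    also have "\<dots> = ln (real K + 1) + real r * ln (real m + 1)"
      by (simp add: ln_mult ln_realpow)
    also have "\<dots> \<le> ln (real K + 1) + real r * (ln (real m) + 1)"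
    proof (intro add_left_mono mult_left_mono)
      have "real m + 1 \<le> real m * 2" using m by simp
      also have "\<dots> \<le> real m * exp 1" using exp_ge_add_one_self[of 1] by (intro mult_left_mono) auto
      finally have "real m + 1 \<le> real m * exp 1" .
      then have "ln (real m + 1) \<le> ln (real m * exp 1)" using m by (subst ln_le_cancel_iff) auto
      then show "ln (real m + 1) \<le> ln (real m) + 1" using m by (simp add: ln_mult)
    qed simp
    finally have "ln (real (a m)) \<le> real r * ln (real m) + L"
      by (simp add: L_def algebra_simps)
    then show ?thesis using lnm by (simp add: field_simps)
  qed
  then have "limsup (\<lambda>m. ereal (ln (real (a m)) / ln (real m)))
      \<le> limsup (\<lambda>m. ereal (real r + L / ln (real m)))"
    by (intro Limsup_mono eventually_sequentiallyI[of 2]) simp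
  also have "\<dots> = ereal (real r)"
  proof (rule lim_imp_Limsup)
    have "(\<lambda>m. real r + L / ln (real m)) \<longlonglongrightarrow> real r + 0"
      by (intro tendsto_add tendsto_const tendsto_const_div_ln)
    then show "(\<lambda>m. ereal (real r + L / ln (real m))) \<longlonglongrightarrow> ereal (real r)" by simp
  qed simp
  finally show ?thesis .
qed

text \<open>The chord of the convex function \<open>(1 + u) ^ D\<close> over the unit interval has
  slope \<open>2 ^ D - 1\<close>.\<close>

lemma one_plus_power_le:
  fixes u :: real
  assumes "0 \<le> u" "u \<le> 1" shows "(1 + u) ^ D \<le> 1 + (2 ^ D - 1) * u"
proof (induction D)
  case (Suc D)
  have "(1 + u) ^ Suc D \<le> (1 + (2 ^ D - 1) * u) * (1 + u)"
    using Suc assms by (simp add: mult_left_mono mult.commute)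
  also have "\<dots> = 1 + 2 ^ D * u + (2 ^ D - 1) * u * u" by (simp add: algebra_simps)
  also have "(2 ^ D - 1) * u * u \<le> (2 ^ D - 1) * u * 1"
    using assms by (intro mult_left_mono) auto
  finally show ?case by (simp add: algebra_simps)
qed simp

text \<open>A discrete form of \<open>a' \<ge> c * a powr ((d - 1) / d)\<close>, whose solutions
  grow like the \<open>d\<close>-th power of the variable; for small \<open>\<kappa>\<close> the
  function \<open>(\<kappa> * m) powr d\<close> is a subsolution.\<close>

lemma powr_growth:
  fixes a :: "nat \<Rightarrow> real"
  assumes d: "d \<ge> 1" and c: "c > 0" and a1: "a 1 \<ge> 1"
    and step: "\<And>m. a (Suc m) \<ge> a m + c * a m powr ((d - 1) / d)"
  obtains \<kappa> where "\<kappa> > 0" "\<And>m. m \<ge> 1 \<Longrightarrow> a m \<ge> (\<kappa> * real m) powr d"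
proof -
  define D where "D = nat \<lceil>d\<rceil>"
  \<comment> \<open>\<open>\<kappa> \<le> 1\<close> gives the start at \<open>m = 1\<close>;
    \<open>\<kappa> * 2 ^ D \<le> c\<close> controls the increment, since
    \<open>(1 + 1 / m) powr d\<close> is at most \<open>1 + 2 ^ D / m\<close>.\<close>
  define \<kappa> where "\<kappa> = min 1 (c / 2 ^ D)"
  have \<kappa>: "\<kappa> > 0" "\<kappa> \<le> 1" "\<kappa> * 2 ^ D \<le> c" using c by (auto simp: \<kappa>_def min_def field_simps)
  have "a m \<ge> (\<kappa> * real m) powr d" if "m \<ge> 1" for m
    using that
  proof (induction m rule: dec_induct)
    case base
    have "\<kappa> powr d \<le> 1 powr d" using \<kappa> d by (intro powr_mono2) auto
    then show ?case using a1 by simp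
  next
    case (step m)
    let ?t = "\<kappa> * real m"
    have m: "real m \<ge> 1" using step by simp
    have t: "?t > 0" using \<kappa> m by simp
    have am: "a m > 0" using step.IH t by (smt (verit) powr_gt_zero)
    have "?t powr (d - 1) = (?t powr d) powr ((d - 1) / d)" using d by (simp add: powr_powr)
    also have "\<dots> \<le> a m powr ((d - 1) / d)" using step.IH d by (intro powr_mono2) auto
    finally have 1: "?t powr (d - 1) \<le> a m powr ((d - 1) / d)" .
    have "\<kappa> * real (Suc m) = ?t * (1 + 1 / real m)" using m by (simp add: field_simps)
    then have "(\<kappa> * real (Suc m)) powr d = (?t * (1 + 1 / real m)) powr d" by (simp only:)
    also have "\<dots> = ?t powr d * (1 + 1 / real m) powr d" by (rule powr_mult)
    also have "(1 + 1 / real m) powr d \<le> 1 + 2 ^ D * (1 / real m)"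
    proof -
      have "d \<le> real D" using d by (simp add: D_def)
      then have "(1 + 1 / real m) powr d \<le> (1 + 1 / real m) powr real D"
        using m by (intro powr_mono) auto
      also have "\<dots> = (1 + 1 / real m) ^ D" using m by (intro powr_realpow) (simp add: add_pos_pos)
      also have "\<dots> \<le> 1 + (2 ^ D - 1) * (1 / real m)" using m by (intro one_plus_power_le) auto
      also have "\<dots> \<le> 1 + 2 ^ D * (1 / real m)" using m by (simp add: divide_right_mono)
      finally show ?thesis .
    qed
    also have "?t powr d * (1 + 2 ^ D * (1 / real m)) = ?t powr d + (\<kappa> * 2 ^ D) * ?t powr (d - 1)"
    proof -
      have "?t powr d = ?t powr (d - 1) * ?t" using t powr_add[of ?t "d - 1" 1] by simp
      then show ?thesis using m by (simp add: field_simps)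
    qed
    also have "\<dots> \<le> a m + c * a m powr ((d - 1) / d)"
      using step.IH 1 \<kappa> c by (intro add_mono mult_mono) auto
    also have "\<dots> \<le> a (Suc m)" by (rule assms(4))
    finally show ?case using t by (simp add: mult_left_mono)
  qed
  then show ?thesis using that \<kappa> by blast
qed

lemma limsup_log_ge:
  fixes a :: "nat \<Rightarrow> real"
  assumes "\<kappa> > 0" "\<And>m. m \<ge> 1 \<Longrightarrow> a m \<ge> (\<kappa> * real m) powr d"
  shows "ereal d \<le> limsup (\<lambda>m. ereal (ln (a m) / ln (real m)))"
proof -
  let ?L = "d * ln \<kappa>"
  have "(\<lambda>m. d + ?L / ln (real m)) \<longlonglongrightarrow> d + 0"
    by (intro tendsto_add tendsto_const tendsto_const_div_ln)
  then have "(\<lambda>m. ereal (d + ?L / ln (real m))) \<longlonglongrightarrow> ereal d" by simp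
  then have "ereal d = limsup (\<lambda>m. ereal (d + ?L / ln (real m)))"
    by (intro lim_imp_Limsup[symmetric]) auto
  also have "\<dots> \<le> limsup (\<lambda>m. ereal (ln (a m) / ln (real m)))"
  proof (intro Limsup_mono eventually_sequentiallyI[of 2])
    fix m :: nat assume m: "m \<ge> 2"
    have lnm: "ln (real m) > 0" using m by simp
    have t: "\<kappa> * real m > 0" using assms(1) m by simp
    have "d * (ln \<kappa> + ln (real m)) = d * ln (\<kappa> * real m)"
      using assms(1) m by (simp add: ln_mult)
    also have "\<dots> = ln ((\<kappa> * real m) powr d)" using t by (simp add: ln_powr)
    also have "\<dots> \<le> ln (a m)"
      using assms(2)[of m] m t by (intro ln_mono) auto
    finally have "d * (ln \<kappa> + ln (real m)) / ln (real m) \<le> ln (a m) / ln (real m)"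
      using lnm by (intro divide_right_mono) auto
    moreover have "d + ?L / ln (real m) = d * (ln \<kappa> + ln (real m)) / ln (real m)"
      using lnm by (simp add: field_simps)
    ultimately show "ereal (d + ?L / ln (real m)) \<le> ereal (ln (a m) / ln (real m))"
      by simp
  qed
  finally show ?thesis .
qed

section \<open>Gelfand-Kirillov dimension and lower transcendence degree of
  \<open>D(B)\<close>\<close>

context diffop_algebra
begin

abbreviation "pw \<equiv> powsp (end_scale \<phi>) (\<circ>) id"

text \<open>\<open>powsp\<close> adds factors on the right, whereas \<open>VDI\<close> multiplies on
  the left; associativity reconciles the two.\<close>

lemma comp_powsp:
  assumes V: "V \<subseteq> DiffOps \<phi>" and v: "v \<in> V"
  shows "w \<in> pw V m \<Longrightarrow> v \<circ> w \<in> pw V (Suc m)"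
proof (induction m arbitrary: w)
  have kl: "klinear \<phi> v" using V v DiffOps_klinear by blast
  have lin: "v \<circ> w \<in> U" if U: "E.subspace U" "\<And>a. a \<in> A \<Longrightarrow> v \<circ> a \<in> U" and w: "w \<in> E.span A" for U A w
    using w
  proof (induction rule: E.span_induct_alt)
    case base
    have "v \<circ> 0 = 0" using klinear_0[OF kl] by (auto simp: fun_eq_iff)
    then show ?case using E.subspace_0[OF U(1)] by metis
  next
    case (step c a y)
    have "v \<circ> (end_scale \<phi> c a + y) = end_scale \<phi> c (v \<circ> a) + (v \<circ> y)"
      using klinear_add[OF kl] klinear_scale[OF kl] by (auto simp: end_scale_def fun_eq_iff)
    then show ?case
      using E.subspace_add[OF U(1) E.subspace_scale[OF U(1) U(2)[OF step(1)]] step(2)] by metis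
  qed
  {
    case 0
    have "v \<circ> a \<in> pw V (Suc 0)" if "a \<in> {id}" for a
      using that v comp_in_prodsp[of id "E.span {id}" v V] by (simp add: E.span_base)
    moreover have "E.subspace (pw V (Suc 0))" unfolding powsp.simps by (rule subspace_prodsp)
    moreover have "w \<in> E.span {id}" using 0 unfolding powsp.simps .
    ultimately show ?case using lin by blast
  next
    case (Suc m)
    have "v \<circ> a \<in> pw V (Suc (Suc m))" if a: "a \<in> {u \<circ> w | u w. u \<in> pw V m \<and> w \<in> V}" for a
    proof -
      obtain u w where uw: "u \<in> pw V m" "w \<in> V" "a = u \<circ> w" using a by blast
      have "(v \<circ> u) \<circ> w \<in> pw V (Suc (Suc m))"
        unfolding powsp.simps(2)[of _ _ _ _ "Suc m"] by (rule comp_in_prodsp[OF Suc.IH[OF uw(1)] uw(2)])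
      then show ?thesis by (simp only: uw comp_assoc)
    qed
    moreover have "w \<in> E.span {u \<circ> w | u w. u \<in> pw V m \<and> w \<in> V}"
      using Suc.prems unfolding powsp.simps prodsp_def .
    moreover have "E.subspace (pw V (Suc (Suc m)))" by (simp add: subspace_prodsp)
    ultimately show ?case using lin by blast
  }
qed

lemma prodsp_powsp_subset:
  assumes "V \<subseteq> DiffOps \<phi>" shows "prodsp (end_scale \<phi>) (\<circ>) V (pw V m) \<subseteq> pw V (Suc m)"
  unfolding prodsp_def[of _ _ V]
proof (rule E.span_minimal)
  show "{v \<circ> w | v w. v \<in> V \<and> w \<in> pw V m} \<subseteq> pw V (Suc m)" using comp_powsp[OF assms] by blast
  show "E.subspace (pw V (Suc m))" by (simp add: subspace_prodsp)
qed

lemma id_in_powsp: "id \<in> V \<Longrightarrow> id \<in> pw V m"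
proof (induction m)
  case (Suc m)
  then have "id \<circ> id \<in> pw V (Suc m)" unfolding powsp.simps by (intro comp_in_prodsp)
  then show ?case by (simp only: id_comp)
qed (simp add: E.span_base)

lemma id_nonzero: "(id :: 'b \<Rightarrow> 'b) \<noteq> 0"
  by (metis id_apply zero_fun_apply zero_neq_one)

lemma dim_pos:
  assumes "w \<in> W" "w \<noteq> 0" "E.fin_dim W" shows "E.dim W \<ge> 1"
proof -
  have "E.independent {w}" using assms(2) by simp
  then show ?thesis using E.independent_card_le(2)[of "{w}" W] assms by auto
qed

lemma VDI_limsup:
  assumes V: "subframe (end_scale \<phi>) id (DiffOps \<phi>) V"
    and VDI: "VDI (end_scale \<phi>) (\<circ>) (DiffOps \<phi>) V d" and d: "d \<ge> 1"
  shows "ereal d \<le> limsup (\<lambda>m. ereal (ln (real (E.dim (pw V m))) / ln (real m)))"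
proof -
  have VD: "V \<subseteq> DiffOps \<phi>" "id \<in> V" using V by (auto simp: subframe_def fd_iff)
  have fd: "fd_subspace (end_scale \<phi>) (DiffOps \<phi>) (pw V m)" for m using powsp_growth[OF V] by metis
  then have fin: "E.fin_dim (pw V m)" for m by (simp add: fd_iff)
  have ge1: "E.dim (pw V m) \<ge> 1" for m
    by (rule dim_pos[OF id_in_powsp[OF VD(2)] id_nonzero fin])
  obtain c where c: "c > 0" and step: "\<And>W. fd_subspace (end_scale \<phi>) (DiffOps \<phi>) W \<Longrightarrow> W \<noteq> {0} \<Longrightarrow>
      real (E.dim (prodsp (end_scale \<phi>) (\<circ>) V W)) \<ge> real (E.dim W) + c * real (E.dim W) powr ((d - 1) / d)"
    using VDI unfolding VDI_def by blast
  define a where "a m = real (E.dim (pw V m))" for m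
  have "a (Suc m) \<ge> a m + c * a m powr ((d - 1) / d)" for m
  proof -
    have "pw V m \<noteq> {0}" using id_in_powsp[OF VD(2), of m] id_nonzero by blast
    then have "a m + c * a m powr ((d - 1) / d) \<le> real (E.dim (prodsp (end_scale \<phi>) (\<circ>) V (pw V m)))"
      unfolding a_def by (rule step[OF fd])
    also have "\<dots> \<le> a (Suc m)"
      unfolding a_def of_nat_le_iff by (rule E.dim_le[OF prodsp_powsp_subset[OF VD(1)] fin])
    finally show ?thesis .
  qed
  moreover have "a 1 \<ge> 1" using ge1[of 1] by (simp add: a_def)
  ultimately obtain \<kappa> where "\<kappa> > 0" "\<And>m. m \<ge> 1 \<Longrightarrow> a m \<ge> (\<kappa> * real m) powr d"
    using powr_growth[OF d c, where a = a] by blast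
  then show ?thesis using limsup_log_ge[of \<kappa> d a] by (simp add: a_def)
qed

lemma limsup_powsp_le:
  assumes V: "subframe (end_scale \<phi>) id (DiffOps \<phi>) V"
  shows "limsup (\<lambda>m. ereal (ln (real (E.dim (pw V m))) / ln (real m))) \<le> ereal (2 * real n)"
proof -
  obtain K where "\<And>m. E.dim (pw V m) \<le> K * (m + 1) ^ (2 * n)" using powsp_growth[OF V] by metis
  from limsup_log_le[of "\<lambda>m. E.dim (pw V m)", OF this] show ?thesis by simp
qed

lemma GKdim_le: "GKdim (end_scale \<phi>) (\<circ>) id (DiffOps \<phi>) \<le> ereal (2 * real n)"
  unfolding GKdim_def using limsup_powsp_le by (intro SUP_least) auto

lemma dims_positive_rank:
  assumes n: "n > 0"
  shows "GKdim (end_scale \<phi>) (\<circ>) id (DiffOps \<phi>) = ereal (2 * real n)"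
    and "LDdim (end_scale \<phi>) (\<circ>) id (DiffOps \<phi>) = ereal (2 * real n)"
proof -
  obtain V where V: "subframe (end_scale \<phi>) id (DiffOps \<phi>) V"
    "VDI (end_scale \<phi>) (\<circ>) (DiffOps \<phi>) V (2 * real n)" using exists_VDI[OF n] by blast
  have n1: "2 * real n \<ge> 1" using n by simp
  have "ereal (2 * real n) \<le> GKdim (end_scale \<phi>) (\<circ>) id (DiffOps \<phi>)"
    unfolding GKdim_def by (rule SUP_upper2[of V]) (use V VDI_limsup[OF V n1] in auto)
  then show "GKdim (end_scale \<phi>) (\<circ>) id (DiffOps \<phi>) = ereal (2 * real n)"
    using GKdim_le by (rule antisym[rotated])
  \<comment> \<open>This \<open>V\<close> leaves the dimension of no nonzero \<open>W\<close>
    unchanged, so \<open>LDdim\<close> is computed by its second branch.\<close>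
  have no_stable: "E.dim (prodsp (end_scale \<phi>) (\<circ>) V W) \<noteq> E.dim W"
    if W: "fd_subspace (end_scale \<phi>) (DiffOps \<phi>) W" "W \<noteq> {0}" for W
  proof -
    obtain c where c: "c > 0" and "real (E.dim (prodsp (end_scale \<phi>) (\<circ>) V W))
        \<ge> real (E.dim W) + c * real (E.dim W) powr ((2 * real n - 1) / (2 * real n))"
      using V(2) W unfolding VDI_def by blast
    moreover obtain w where "w \<in> W" "w \<noteq> 0" using W E.subspace_0 by (auto simp: fd_iff)
    then have "E.dim W \<ge> 1" using dim_pos W by (auto simp: fd_iff)
    then have "c * real (E.dim W) powr ((2 * real n - 1) / (2 * real n)) > 0" using c by simp
    ultimately show ?thesis by linarith
  qed
  have neg: "\<not> (\<forall>V. subframe (end_scale \<phi>) id (DiffOps \<phi>) V \<longrightarrow>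
      (\<exists>W. fd_subspace (end_scale \<phi>) (DiffOps \<phi>) W \<and> W \<noteq> {0} \<and>
        E.dim (prodsp (end_scale \<phi>) (\<circ>) V W) = E.dim W))"
  proof
    assume "\<forall>V. subframe (end_scale \<phi>) id (DiffOps \<phi>) V \<longrightarrow>
      (\<exists>W. fd_subspace (end_scale \<phi>) (DiffOps \<phi>) W \<and> W \<noteq> {0} \<and>
        E.dim (prodsp (end_scale \<phi>) (\<circ>) V W) = E.dim W)"
    from this[rule_format, OF V(1)] show False using no_stable by metis
  qed
  have "LDdim (end_scale \<phi>) (\<circ>) id (DiffOps \<phi>) =
     (SUP V \<in> {V. subframe (end_scale \<phi>) id (DiffOps \<phi>) V}.
      SUP d \<in> {d::real. d > 0 \<and> VDI (end_scale \<phi>) (\<circ>) (DiffOps \<phi>) V d}. ereal d)"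
    unfolding LDdim_def if_not_P[OF neg] ..
  also have "\<dots> = ereal (2 * real n)"
  proof (rule antisym)
    show "(SUP V \<in> {V. subframe (end_scale \<phi>) id (DiffOps \<phi>) V}.
        SUP d \<in> {d::real. d > 0 \<and> VDI (end_scale \<phi>) (\<circ>) (DiffOps \<phi>) V d}. ereal d) \<le> ereal (2 * real n)"
    proof (intro SUP_least)
      fix V d assume "V \<in> {V. subframe (end_scale \<phi>) id (DiffOps \<phi>) V}"
        and "d \<in> {d. d > 0 \<and> VDI (end_scale \<phi>) (\<circ>) (DiffOps \<phi>) V d}"
      then have *: "subframe (end_scale \<phi>) id (DiffOps \<phi>) V" "VDI (end_scale \<phi>) (\<circ>) (DiffOps \<phi>) V d"
        by auto
      show "ereal d \<le> ereal (2 * real n)"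
      \<comment> \<open>\<open>VDI_limsup\<close> covers \<open>d \<ge> 1\<close>; below that,
        \<open>d < 1 \<le> 2 * n\<close> is enough.\<close>
      proof (cases "d \<ge> 1")
        case True
        show ?thesis by (rule order_trans[OF VDI_limsup[OF * True] limsup_powsp_le[OF *(1)]])
      qed (use n1 in simp)
    qed
    show "ereal (2 * real n) \<le> (SUP V \<in> {V. subframe (end_scale \<phi>) id (DiffOps \<phi>) V}.
        SUP d \<in> {d::real. d > 0 \<and> VDI (end_scale \<phi>) (\<circ>) (DiffOps \<phi>) V d}. ereal d)"
      by (rule SUP_upper2[of V], use V in simp, rule SUP_upper, use V n in simp)
  qed
  finally show "LDdim (end_scale \<phi>) (\<circ>) id (DiffOps \<phi>) = ereal (2 * real n)" .
qed

text \<open>If no \<open>W\<close> had unchanged dimension, each multiplication by \<open>V\<close>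
  would raise the dimension by at least one, so that of \<open>pw V m\<close> would be at least
  \<open>m\<close>; but for \<open>n = 0\<close> the growth bound is a constant.\<close>

lemma dims_rank_0:
  assumes n: "n = 0"
  shows "GKdim (end_scale \<phi>) (\<circ>) id (DiffOps \<phi>) = 0"
    and "LDdim (end_scale \<phi>) (\<circ>) id (DiffOps \<phi>) = 0"
proof -
  let ?V = "E.span {id}"
  have V: "subframe (end_scale \<phi>) id (DiffOps \<phi>) ?V"
    unfolding subframe_def fd_iff E.fin_dim_def
    using E.span_minimal[OF _ subspace_DiffOps, of "{id}"] id_DiffOps
    by (auto intro: E.span_base exI[of _ "{id}"])
  have "0 = liminf (\<lambda>m::nat. 0 :: ereal)" by (simp add: Liminf_const)
  also have "\<dots> \<le> liminf (\<lambda>m. ereal (ln (real (E.dim (pw ?V m))) / ln (real m)))"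
  proof (intro Liminf_mono always_eventually allI)
    \<comment> \<open>Holds for every natural number, so the quotients at \<open>m = 0\<close> and
      \<open>m = 1\<close> need no separate treatment.\<close>
    have "0 \<le> ln (real k)" for k :: nat by (cases k) auto
    then show "0 \<le> ereal (ln (real (E.dim (pw ?V m))) / ln (real m))" for m by simp
  qed
  also have "\<dots> \<le> limsup (\<lambda>m. ereal (ln (real (E.dim (pw ?V m))) / ln (real m)))"
    by (rule Liminf_le_Limsup) simp
  also have "\<dots> \<le> GKdim (end_scale \<phi>) (\<circ>) id (DiffOps \<phi>)"
    unfolding GKdim_def by (rule SUP_upper2[of ?V]) (use V in auto)
  finally show "GKdim (end_scale \<phi>) (\<circ>) id (DiffOps \<phi>) = 0"
    using GKdim_le n by (intro antisym) (auto simp: zero_ereal_def)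
  have "\<exists>W. fd_subspace (end_scale \<phi>) (DiffOps \<phi>) W \<and> W \<noteq> {0} \<and>
      E.dim (prodsp (end_scale \<phi>) (\<circ>) V W) = E.dim W"
    if V: "subframe (end_scale \<phi>) id (DiffOps \<phi>) V" for V
  proof (rule ccontr)
    assume no: "\<not> ?thesis"
    have VD: "V \<subseteq> DiffOps \<phi>" "id \<in> V" "E.fin_dim V" using V by (auto simp: subframe_def fd_iff)
    obtain K where K: "\<And>m. E.dim (pw V m) \<le> K * (m + 1) ^ (2 * n)"
      and fd: "\<And>m. fd_subspace (end_scale \<phi>) (DiffOps \<phi>) (pw V m)" using powsp_growth[OF V] by blast
    have "E.dim (pw V m) \<ge> m" for m
    proof (induction m)
      case (Suc m)
      let ?VW = "prodsp (end_scale \<phi>) (\<circ>) V (pw V m)"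
      have "pw V m \<subseteq> ?VW"
      proof
        fix w assume "w \<in> pw V m"
        then have "id \<circ> w \<in> ?VW" using VD(2) by (intro comp_in_prodsp)
        then show "w \<in> ?VW" by simp
      qed
      moreover have "E.fin_dim ?VW" using fd[of m] VD by (intro fin_dim_prodsp) (auto simp: fd_iff)
      ultimately have "E.dim (pw V m) \<le> E.dim ?VW" by (rule E.dim_le)
      moreover have "pw V m \<noteq> {0}" using id_in_powsp[OF VD(2), of m] id_nonzero by blast
      then have "E.dim ?VW \<noteq> E.dim (pw V m)" using no fd by blast
      moreover have "E.dim ?VW \<le> E.dim (pw V (Suc m))"
        by (rule E.dim_le[OF prodsp_powsp_subset[OF VD(1)]]) (use fd in \<open>simp only: fd_iff\<close>)
      ultimately show ?case using Suc.IH by linarith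
    qed simp
    from this[of "Suc K"] K[of "Suc K"] n show False by simp
  qed
  then show "LDdim (end_scale \<phi>) (\<circ>) id (DiffOps \<phi>) = 0" unfolding LDdim_def by simp
qed

end

text \<open>Products of the generators form a countable set; \<open>from_nat_into\<close> enumerates
  it, with repetitions if it is finite.\<close>

lemma (in kalgebra) countable_spanning_sequence:
  assumes "affine_alg \<phi>" obtains g :: "nat \<Rightarrow> 'b" where "B.span (range g) = UNIV"
proof -
  obtain S where S: "finite S" "gen_subalg \<phi> S = UNIV" using assms by (auto simp: affine_alg_def)
  define Z where "Z = prod_list ` lists S"
  have "countable Z" unfolding Z_def by (intro countable_image countable_lists countable_finite S)
  moreover have one: "1 \<in> Z" unfolding Z_def by (rule image_eqI[of _ _ "[]"]) auto
  ultimately have range: "range (from_nat_into Z) = Z" by (intro range_from_nat_into) auto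
  have "b \<in> B.span Z" for b
  proof -
    have "b \<in> gen_subalg \<phi> S" using S by simp
    then show ?thesis
    proof induction
      case (scal c)
      then show ?case using B.span_scale[OF B.span_base[OF one], of c] by simp
    next
      case (gen s)
      then have "s \<in> Z" unfolding Z_def by (intro image_eqI[of _ _ "[s]"]) auto
      then show ?case by (rule B.span_base)
    next
      case (add x y)
      then show ?case by (intro B.span_add)
    next
      case (mult x y)
      have "a * b \<in> B.span Z" if ab: "a \<in> Z" "b \<in> Z" for a b
      proof -
        obtain l l' where "l \<in> lists S" "l' \<in> lists S" "a = prod_list l" "b = prod_list l'"
          using ab by (auto simp: Z_def)
        then have "a * b \<in> Z" unfolding Z_def by (intro image_eqI[of _ _ "l @ l'"]) auto
        then show ?thesis by (rule B.span_base)
      qed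
      then show ?case using mult(3,4) by (rule span_mult_closed)
    qed
  qed
  then have "B.span (range (from_nat_into Z)) = UNIV" unfolding range by blast
  then show ?thesis by (rule that)
qed

theorem theorem3p4:
  fixes \<phi> :: "'k::field_char_0 \<Rightarrow> 'b::idom" and n :: nat
  assumes "alg_hom_struct \<phi>"
    and "affine_alg \<phi>"
    and "trdeg_is \<phi> n"
  shows "LD_stable (end_scale \<phi>) (\<circ>) id (DiffOps \<phi>)
    \<and> LDdim (end_scale \<phi>) (\<circ>) id (DiffOps \<phi>) = ereal (2 * real n)"
proof -
  interpret kalgebra \<phi> by standard fact
  obtain xs where xs: "length xs = n" "alg_indep \<phi> xs" and max: "\<And>ys. alg_indep \<phi> ys \<Longrightarrow> length ys \<le> n"
    using assms(3) by (auto simp: trdeg_is_def)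
  obtain g :: "nat \<Rightarrow> 'b" where g: "B.span (range g) = UNIV"
    using countable_spanning_sequence[OF assms(2)] by blast
  interpret diffop_algebra \<phi> xs n g
    by unfold_locales (use xs max g assms in auto)
  show ?thesis
    using dims_positive_rank dims_rank_0 by (cases "n = 0") (simp_all add: LD_stable_def)
qed

end
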